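(* Let $M=B\times_f\overline{F}$ be an $m$-dimensional nontrivial warped product proper pointwise semi-slant submanifold of a $(2n+1)$-dimensional cosymplectic manifold $(N,\phi,\xi,\eta,g)$ with the semi-slant function $\theta$ such that $\mathcal{D}_1=TB$, $\mathcal{D}_2=T\overline{F}$, and $\xi$ is normal to $M$ with $\xi\in\Gamma(\mu)$. Write $\dim\mathcal{D}_1=2m_1$ and $\dim\mathcal{D}_2=2m_2$ (so $m=2m_1+2m_2$). Assume that $n=m_1+2m_2$. Then $$\|h\|^2\ \ge\ 4m_2(\csc^2\theta+\cot^2\theta)\,\|\nabla(\ln f)\|^2,$$ with equality holding if and only if $g(h(Z,W),V)=0$ for all $Z,W\in\Gamma(T\overline{F})$ and $V\in\Gamma(TM^{\perp})$.
   Context: An almost contact metric manifold $(N,\phi,\xi,\eta,g)$ is a smooth manifold $N$ of dimension $2n+1$ with a tensor field $\phi$ of type $(1,1)$, a vector field $\xi$, a $1$-form $\eta$ and a Riemannian metric $g$ such that $\phi^2=-I+\eta\otimes\xi$, $\eta(\xi)=1$ and $g(\phi X,\phi Y)=g(X,Y)-\eta(X)\eta(Y)$ for all vector fields $X,Y$ (hence $\phi\xi=0$, $\eta\circ\phi=0$, $\eta(X)=g(X,\xi)$). With $\overline{\nabla}$ the Levi-Civita connection of $(N,g)$, it is cosymplectic iff $\overline{\nabla}\phi=0$ (then also $\overline{\nabla}\eta=0$, $\overline{\nabla}\xi=0$). A submanifold $M$ of $N$ is a pointwise semi-slant submanifold if there is a distribution $\mathcal{D}_1\subset TM$ such that $TM=\mathcal{D}_1\oplus\mathcal{D}_2$,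 $\phi(\mathcal{D}_1)\subset\mathcal{D}_1$, and at each given point $p\in M$ the angle $\theta=\theta(X)$ between $\phi X$ and $(\mathcal{D}_2)_p$ is constant for nonzero $X\in(\mathcal{D}_2)_p$, where $\mathcal{D}_2$ is the orthogonal complement of $\mathcal{D}_1$ in $TM$. The function $\theta$ on $M$ is the semi-slant function; $M$ is proper if $\theta$ takes values in $(0,\frac{\pi}{2})$. When $\xi$ is normal to $M$ and $M$ is proper, $\dim\mathcal{D}_1$ and $\dim\mathcal{D}_2$ are even. For $X$ tangent to $M$ write $\phi X=TX+FX$, with $TX$ tangent and $FX$ normal to $M$. $\mu$ denotes the orthogonal complement of $F\mathcal{D}_2$ in the normal bundle $TM^\perp$. For Riemannian manifolds $(B,g_B)$, $(\overline{F},g_{\overline{F}})$ and a positive smooth function $f$ on $B$, the warped product $B\times_f\overline{F}$ is $B\times\overline{F}$ with metric $g_B+f^2g_{\overline{F}}$; it is trivial if the warping function $f$ is constant. Here $M$ with the induced metric is such a warped product, and $TB$, $T\overline{F}$ are identified with the corresponding subbundles of $TM$. $h$ is the second fundamental form of $M$ in $N$, $\|h\|^2=\sum_{i,j=1}^m g(h(e_i,e_j),h(e_i,e_j))$ for a local orthonormal frame $e_1,\dots,e_m$ of $TM$; $\nabla(\ln f)$ is the gradient on $M$ of $\ln f$ (with $f$ regarded as a function on $M$). *)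

theory Defs
  imports "HOL-Analysis.Analysis" "HOL-Library.Function_Algebras"
begin

text \<open>
  Tangent vectors are represented as operators on real functions, hence as elements of the type
  \<open>('p \<Rightarrow> real) \<Rightarrow> real\<close>. Pointwise operations make this a real vector space, so that
  \<^const>\<open>subspace\<close>, \<^const>\<open>span\<close> and \<^const>\<open>dim\<close> from the library apply.
\<close>

instantiation "fun" :: (type, real_vector) real_vector
begin

definition scaleR_fun :: "real \<Rightarrow> ('a \<Rightarrow> 'b) \<Rightarrow> 'a \<Rightarrow> 'b" where
  "scaleR_fun c f = (\<lambda>x. c *\<^sub>R f x)"

instance
  by standard (auto simp: scaleR_fun_def plus_fun_def fun_eq_iff algebra_simps)

end

definition linear_on_space :: "'a::real_vector set \<Rightarrow> ('a \<Rightarrow> 'b::real_vector) \<Rightarrow> bool" where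
  "linear_on_space S L \<longleftrightarrow>
     (\<forall>u\<in>S. \<forall>v\<in>S. \<forall>a b. L (a *\<^sub>R u + b *\<^sub>R v) = a *\<^sub>R L u + b *\<^sub>R L v)"


subsection \<open>Smooth manifolds\<close>

primrec iterated_deriv ::
    "'a::real_normed_vector list \<Rightarrow> ('a \<Rightarrow> 'b::real_normed_vector) \<Rightarrow> 'a \<Rightarrow> 'b" where
  "iterated_deriv [] f = f"
| "iterated_deriv (v # vs) f = (\<lambda>x. frechet_derivative (iterated_deriv vs f) (at x) v)"

text \<open>Class \<open>C\<^sup>\<infinity>\<close>: every iterated directional derivative is (Frechet) differentiable.\<close>

definition smooth_on ::
    "'a::real_normed_vector set \<Rightarrow> ('a \<Rightarrow> 'b::real_normed_vector) \<Rightarrow> bool" where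
  "smooth_on S f \<longleftrightarrow> open S \<and> (\<forall>vs. \<forall>x\<in>S. iterated_deriv vs f differentiable (at x))"

text \<open>
  A manifold is a whole type \<open>'p\<close> with an atlas modelled on a Euclidean space \<open>'e\<close>, its dimension
  being \<open>DIM('e)\<close>. A chart is a domain together with a coordinate map; the values of the coordinate
  map outside the domain are irrelevant.
\<close>

type_synonym ('p, 'e) chart = "'p set \<times> ('p \<Rightarrow> 'e)"
type_synonym 'p tangent = "('p \<Rightarrow> real) \<Rightarrow> real"
type_synonym 'p metric = "'p \<Rightarrow> 'p tangent \<Rightarrow> 'p tangent \<Rightarrow> real"
type_synonym 'p vfield = "'p \<Rightarrow> 'p tangent"

definition is_chart :: "('p::topological_space, 'e::euclidean_space) chart \<Rightarrow> bool" where
  "is_chart = (\<lambda>(U, x). open U \<and> open (x ` U) \<and> homeomorphism U (x ` U) x (inv_into U x))"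

definition smooth_atlas ::
    "('p::{t2_space, second_countable_topology}, 'e::euclidean_space) chart set \<Rightarrow> bool" where
  "smooth_atlas A \<longleftrightarrow>
     (\<forall>c\<in>A. is_chart c) \<and> (\<Union>c\<in>A. fst c) = UNIV \<and>
     (\<forall>(U, x)\<in>A. \<forall>(V, y)\<in>A. smooth_on (x ` (U \<inter> V)) (y \<circ> inv_into U x))"

definition smooth_fun_on ::
    "('p::topological_space, 'e::euclidean_space) chart set \<Rightarrow> 'p set \<Rightarrow> ('p \<Rightarrow> real) \<Rightarrow> bool" where
  "smooth_fun_on A W f \<longleftrightarrow>
     open W \<and> (\<forall>(U, x)\<in>A. smooth_on (x ` (U \<inter> W)) (f \<circ> inv_into U x))"

definition smooth_near ::
    "('p::topological_space, 'e::euclidean_space) chart set \<Rightarrow> 'p \<Rightarrow> ('p \<Rightarrow> real) \<Rightarrow> bool" where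
  "smooth_near A p f \<longleftrightarrow> (\<exists>W. p \<in> W \<and> smooth_fun_on A W f)"

definition smooth_map ::
    "('p::topological_space, 'e::euclidean_space) chart set \<Rightarrow>
     ('q::topological_space, 'd::euclidean_space) chart set \<Rightarrow> ('p \<Rightarrow> 'q) \<Rightarrow> bool" where
  "smooth_map A A' F \<longleftrightarrow>
     continuous_on UNIV F \<and>
     (\<forall>(U, x)\<in>A. \<forall>(V, y)\<in>A'. smooth_on (x ` (U \<inter> F -` V)) (y \<circ> F \<circ> inv_into U x))"

definition prod_atlas ::
    "('b, 'd) chart set \<Rightarrow> ('f, 'e) chart set \<Rightarrow> ('b \<times> 'f, 'd \<times> 'e) chart set" where
  "prod_atlas AB AF = {(U \<times> V, map_prod x y) | U x V y. (U, x) \<in> AB \<and> (V, y) \<in> AF}"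

text \<open>
  Tangent vectors at \<open>p\<close> are the directional derivatives at \<open>p\<close> in coordinates. They are normalised
  to vanish on functions that are not smooth near \<open>p\<close>, so that equality of operators is equality of
  tangent vectors.
\<close>

definition tangent_space ::
    "('p::topological_space, 'e::euclidean_space) chart set \<Rightarrow> 'p \<Rightarrow> 'p tangent set" where
  "tangent_space A p =
     {v. \<exists>(U, x)\<in>A. p \<in> U \<and>
        (\<exists>u. v = (\<lambda>f. if smooth_near A p f
                      then frechet_derivative (f \<circ> inv_into U x) (at (x p)) u else 0))}"

definition differential ::
    "('q::topological_space, 'd::euclidean_space) chart set \<Rightarrow> ('p \<Rightarrow> 'q) \<Rightarrow> 'p \<Rightarrow>
     'p tangent \<Rightarrow> 'q tangent" where
  "differential A' F p v = (\<lambda>f. if smooth_near A' (F p) f then v (f \<circ> F) else 0)"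


subsection \<open>Vector fields, metrics, connections\<close>

definition vector_field_on ::
    "('p::topological_space, 'e::euclidean_space) chart set \<Rightarrow> 'p set \<Rightarrow> 'p vfield \<Rightarrow> bool" where
  "vector_field_on A U X \<longleftrightarrow>
     open U \<and> (\<forall>p\<in>U. X p \<in> tangent_space A p) \<and>
     (\<forall>W f. W \<subseteq> U \<longrightarrow> smooth_fun_on A W f \<longrightarrow> smooth_fun_on A W (\<lambda>p. X p f))"

definition vector_field_near ::
    "('p::topological_space, 'e::euclidean_space) chart set \<Rightarrow> 'p \<Rightarrow> 'p vfield \<Rightarrow> bool" where
  "vector_field_near A p X \<longleftrightarrow> (\<exists>U. p \<in> U \<and> vector_field_on A U X)"

definition lie_bracket ::
    "('p::topological_space, 'e::euclidean_space) chart set \<Rightarrow> 'p vfield \<Rightarrow> 'p vfield \<Rightarrow>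
     'p vfield" where
  "lie_bracket A X Y p =
     (\<lambda>f. if smooth_near A p f then X p (\<lambda>q. Y q f) - Y p (\<lambda>q. X q f) else 0)"

definition riemannian_metric ::
    "('p::topological_space, 'e::euclidean_space) chart set \<Rightarrow> 'p metric \<Rightarrow> bool" where
  "riemannian_metric A g \<longleftrightarrow>
     (\<forall>p. \<forall>u\<in>tangent_space A p. \<forall>v\<in>tangent_space A p. g p u v = g p v u) \<and>
     (\<forall>p. \<forall>v\<in>tangent_space A p. linear_on_space (tangent_space A p) (\<lambda>u. g p u v)) \<and>
     (\<forall>p. \<forall>u\<in>tangent_space A p. u \<noteq> 0 \<longrightarrow> g p u u > 0) \<and>
     (\<forall>U X Y. vector_field_on A U X \<longrightarrow> vector_field_on A U Y \<longrightarrow>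
        smooth_fun_on A U (\<lambda>p. g p (X p) (Y p)))"

text \<open>
  \<open>nabla p x Y\<close> is the covariant derivative at \<open>p\<close> of the field \<open>Y\<close>, defined near \<open>p\<close>, in the
  direction of the tangent vector \<open>x\<close> at \<open>p\<close>.
\<close>

type_synonym 'p conn = "'p \<Rightarrow> 'p tangent \<Rightarrow> 'p vfield \<Rightarrow> 'p tangent"

definition affine_connection ::
    "('p::topological_space, 'e::euclidean_space) chart set \<Rightarrow> 'p conn \<Rightarrow> bool" where
  "affine_connection A nabla \<longleftrightarrow>
     (\<forall>p Y. vector_field_near A p Y \<longrightarrow>
        (\<forall>x\<in>tangent_space A p. nabla p x Y \<in> tangent_space A p) \<and>
        linear_on_space (tangent_space A p) (\<lambda>x. nabla p x Y)) \<and>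
     (\<forall>p Y Z. vector_field_near A p Y \<longrightarrow> vector_field_near A p Z \<longrightarrow>
        (\<forall>x\<in>tangent_space A p. nabla p x (\<lambda>q. Y q + Z q) = nabla p x Y + nabla p x Z)) \<and>
     (\<forall>p f Y. smooth_near A p f \<longrightarrow> vector_field_near A p Y \<longrightarrow>
        (\<forall>x\<in>tangent_space A p.
           nabla p x (\<lambda>q. f q *\<^sub>R Y q) = x f *\<^sub>R Y p + f p *\<^sub>R nabla p x Y)) \<and>
     (\<forall>U X Y. vector_field_on A U X \<longrightarrow> vector_field_on A U Y \<longrightarrow>
        vector_field_on A U (\<lambda>p. nabla p (X p) Y))"

definition levi_civita ::
    "('p::topological_space, 'e::euclidean_space) chart set \<Rightarrow> 'p metric \<Rightarrow> 'p conn \<Rightarrow> bool" where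
  "levi_civita A g nabla \<longleftrightarrow>
     affine_connection A nabla \<and>
     (\<forall>U X Y. vector_field_on A U X \<longrightarrow> vector_field_on A U Y \<longrightarrow>
        (\<forall>p\<in>U. nabla p (X p) Y - nabla p (Y p) X = lie_bracket A X Y p)) \<and>
     (\<forall>U Y Z. vector_field_on A U Y \<longrightarrow> vector_field_on A U Z \<longrightarrow>
        (\<forall>p\<in>U. \<forall>x\<in>tangent_space A p.
           x (\<lambda>q. g q (Y q) (Z q)) = g p (nabla p x Y) (Z p) + g p (Y p) (nabla p x Z)))"

definition gradient ::
    "('p::topological_space, 'e::euclidean_space) chart set \<Rightarrow> 'p metric \<Rightarrow> ('p \<Rightarrow> real) \<Rightarrow>
     'p vfield" where
  "gradient A g u p =
     (THE G. G \<in> tangent_space A p \<and> (\<forall>v\<in>tangent_space A p. g p G v = v u))"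


subsection \<open>Almost contact metric and cosymplectic manifolds\<close>

definition almost_contact_metric ::
    "('p::topological_space, 'e::euclidean_space) chart set \<Rightarrow> ('p \<Rightarrow> 'p tangent \<Rightarrow> 'p tangent) \<Rightarrow>
     'p vfield \<Rightarrow> ('p \<Rightarrow> 'p tangent \<Rightarrow> real) \<Rightarrow> 'p metric \<Rightarrow> bool" where
  "almost_contact_metric A phi xi eta g \<longleftrightarrow>
     riemannian_metric A g \<and> vector_field_on A UNIV xi \<and>
     (\<forall>p. phi p ` tangent_space A p \<subseteq> tangent_space A p \<and>
          linear_on_space (tangent_space A p) (phi p) \<and>
          linear_on_space (tangent_space A p) (eta p)) \<and>
     (\<forall>U X. vector_field_on A U X \<longrightarrow>
          vector_field_on A U (\<lambda>p. phi p (X p)) \<and> smooth_fun_on A U (\<lambda>p. eta p (X p))) \<and>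
     (\<forall>p. \<forall>u\<in>tangent_space A p. phi p (phi p u) = - u + eta p u *\<^sub>R xi p) \<and>
     (\<forall>p. eta p (xi p) = 1) \<and>
     (\<forall>p. \<forall>u\<in>tangent_space A p. \<forall>v\<in>tangent_space A p.
          g p (phi p u) (phi p v) = g p u v - eta p u * eta p v)"

definition cosymplectic ::
    "('p::topological_space, 'e::euclidean_space) chart set \<Rightarrow> ('p \<Rightarrow> 'p tangent \<Rightarrow> 'p tangent) \<Rightarrow>
     'p vfield \<Rightarrow> ('p \<Rightarrow> 'p tangent \<Rightarrow> real) \<Rightarrow> 'p metric \<Rightarrow> 'p conn \<Rightarrow> bool" where
  "cosymplectic A phi xi eta g nabla \<longleftrightarrow>
     almost_contact_metric A phi xi eta g \<and> levi_civita A g nabla \<and>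
     (\<forall>U Y. vector_field_on A U Y \<longrightarrow> (\<forall>p\<in>U. \<forall>x\<in>tangent_space A p.
        nabla p x (\<lambda>q. phi q (Y q)) - phi p (nabla p x Y) = 0))"


subsection \<open>Submanifolds\<close>

text \<open>
  A submanifold is an injective immersion \<open>F\<close> of a manifold with atlas \<open>A\<close> into one with
  atlas \<open>A'\<close>.
\<close>

definition submanifold ::
    "('p::topological_space, 'e::euclidean_space) chart set \<Rightarrow>
     ('q::topological_space, 'd::euclidean_space) chart set \<Rightarrow> ('p \<Rightarrow> 'q) \<Rightarrow> bool" where
  "submanifold A A' F \<longleftrightarrow>
     smooth_map A A' F \<and> inj F \<and> (\<forall>p. inj_on (differential A' F p) (tangent_space A p))"

definition induced_metric ::
    "('q::topological_space, 'd::euclidean_space) chart set \<Rightarrow> ('p \<Rightarrow> 'q) \<Rightarrow> 'q metric \<Rightarrow>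
     'p metric" where
  "induced_metric A' F g p u v = g (F p) (differential A' F p u) (differential A' F p v)"

definition tangent_image ::
    "('p::topological_space, 'e::euclidean_space) chart set \<Rightarrow>
     ('q::topological_space, 'd::euclidean_space) chart set \<Rightarrow> ('p \<Rightarrow> 'q) \<Rightarrow> 'p \<Rightarrow>
     'q tangent set" where
  "tangent_image A A' F p = differential A' F p ` tangent_space A p"

definition normal_bundle ::
    "('p::topological_space, 'e::euclidean_space) chart set \<Rightarrow>
     ('q::topological_space, 'd::euclidean_space) chart set \<Rightarrow> ('p \<Rightarrow> 'q) \<Rightarrow> 'q metric \<Rightarrow> 'p \<Rightarrow>
     'q tangent set" where
  "normal_bundle A A' F g p =
     {v \<in> tangent_space A' (F p). \<forall>w\<in>tangent_image A A' F p. g (F p) v w = 0}"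

definition orth_proj ::
    "('v::real_vector \<Rightarrow> 'v \<Rightarrow> real) \<Rightarrow> 'v set \<Rightarrow> 'v \<Rightarrow> 'v" where
  "orth_proj G S v = (THE w. w \<in> S \<and> (\<forall>u\<in>S. G (v - w) u = 0))"

definition normal_part ::
    "('p::topological_space, 'e::euclidean_space) chart set \<Rightarrow>
     ('q::topological_space, 'd::euclidean_space) chart set \<Rightarrow> ('p \<Rightarrow> 'q) \<Rightarrow> 'q metric \<Rightarrow> 'p \<Rightarrow>
     'q tangent \<Rightarrow> 'q tangent" where
  "normal_part A A' F g p v = v - orth_proj (g (F p)) (tangent_image A A' F p) v"

text \<open>Smooth sections over \<open>U\<close> of the pullback bundle \<open>F\<^sup>*TN\<close>.\<close>

definition field_along ::
    "('p::topological_space, 'e::euclidean_space) chart set \<Rightarrow>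
     ('q::topological_space, 'd::euclidean_space) chart set \<Rightarrow> ('p \<Rightarrow> 'q) \<Rightarrow> 'p set \<Rightarrow>
     ('p \<Rightarrow> 'q tangent) \<Rightarrow> bool" where
  "field_along A A' F U V \<longleftrightarrow>
     open U \<and> (\<forall>p\<in>U. V p \<in> tangent_space A' (F p)) \<and>
     (\<forall>W f. smooth_fun_on A' W f \<longrightarrow> smooth_fun_on A (U \<inter> F -` W) (\<lambda>p. V p f))"

definition field_along_near ::
    "('p::topological_space, 'e::euclidean_space) chart set \<Rightarrow>
     ('q::topological_space, 'd::euclidean_space) chart set \<Rightarrow> ('p \<Rightarrow> 'q) \<Rightarrow> 'p \<Rightarrow>
     ('p \<Rightarrow> 'q tangent) \<Rightarrow> bool" where
  "field_along_near A A' F p V \<longleftrightarrow> (\<exists>U. p \<in> U \<and> field_along A A' F U V)"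

text \<open>
  \<open>D p x V\<close> is the derivative of a field \<open>V\<close> along \<open>F\<close> in the direction of \<open>x\<close>, with respect to the
  connection \<open>nabla\<close> of the ambient manifold. Since every field along \<open>F\<close> is locally a combination
  of restrictions of ambient fields with smooth coefficients, \<open>D\<close> is uniquely determined; it gives
  a meaning to \<open>nabla\<close> applied to fields that are defined only on the submanifold.
\<close>

definition pullback_connection ::
    "('p::topological_space, 'e::euclidean_space) chart set \<Rightarrow>
     ('q::topological_space, 'd::euclidean_space) chart set \<Rightarrow> ('p \<Rightarrow> 'q) \<Rightarrow> 'q conn \<Rightarrow>
     ('p \<Rightarrow> 'p tangent \<Rightarrow> ('p \<Rightarrow> 'q tangent) \<Rightarrow> 'q tangent) \<Rightarrow> bool" where
  "pullback_connection A A' F nabla D \<longleftrightarrow>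
     (\<forall>p V. field_along_near A A' F p V \<longrightarrow>
        (\<forall>x\<in>tangent_space A p. D p x V \<in> tangent_space A' (F p)) \<and>
        linear_on_space (tangent_space A p) (\<lambda>x. D p x V)) \<and>
     (\<forall>p V W. field_along_near A A' F p V \<longrightarrow> field_along_near A A' F p W \<longrightarrow>
        (\<forall>x\<in>tangent_space A p. D p x (\<lambda>q. V q + W q) = D p x V + D p x W)) \<and>
     (\<forall>p f V. smooth_near A p f \<longrightarrow> field_along_near A A' F p V \<longrightarrow>
        (\<forall>x\<in>tangent_space A p. D p x (\<lambda>q. f q *\<^sub>R V q) = x f *\<^sub>R V p + f p *\<^sub>R D p x V)) \<and>
     (\<forall>U X V. vector_field_on A U X \<longrightarrow> field_along A A' F U V \<longrightarrow>
        field_along A A' F U (\<lambda>p. D p (X p) V)) \<and>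
     (\<forall>p Y. vector_field_near A' (F p) Y \<longrightarrow>
        (\<forall>x\<in>tangent_space A p. D p x (\<lambda>q. Y (F q)) = nabla (F p) (differential A' F p x) Y))"

text \<open>
  The second fundamental form \<open>h p x y\<close>, for \<open>x\<close>, \<open>y\<close> tangent to the submanifold at \<open>p\<close>, is given by
  the normal component of the ambient covariant derivative of tangent fields.
\<close>

definition second_fundamental_form ::
    "('p::topological_space, 'e::euclidean_space) chart set \<Rightarrow>
     ('q::topological_space, 'd::euclidean_space) chart set \<Rightarrow> ('p \<Rightarrow> 'q) \<Rightarrow> 'q metric \<Rightarrow>
     ('p \<Rightarrow> 'p tangent \<Rightarrow> ('p \<Rightarrow> 'q tangent) \<Rightarrow> 'q tangent) \<Rightarrow>
     ('p \<Rightarrow> 'p tangent \<Rightarrow> 'p tangent \<Rightarrow> 'q tangent) \<Rightarrow> bool" where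
  "second_fundamental_form A A' F g D h \<longleftrightarrow>
     (\<forall>U X Y. vector_field_on A U X \<longrightarrow> vector_field_on A U Y \<longrightarrow>
        (\<forall>p\<in>U. h p (X p) (Y p) =
           normal_part A A' F g p (D p (X p) (\<lambda>q. differential A' F q (Y q)))))"

definition orthonormal_basis ::
    "('v::real_vector \<Rightarrow> 'v \<Rightarrow> real) \<Rightarrow> 'v set \<Rightarrow> 'v list \<Rightarrow> bool" where
  "orthonormal_basis G S es \<longleftrightarrow>
     set es \<subseteq> S \<and> span (set es) = S \<and>
     (\<forall>i<length es. \<forall>j<length es. G (es ! i) (es ! j) = (if i = j then 1 else 0))"

text \<open>The value of the squared norm does not depend on the orthonormal basis that is chosen.\<close>

definition sff_norm_sq ::
    "('p::topological_space, 'e::euclidean_space) chart set \<Rightarrow>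
     ('q::topological_space, 'd::euclidean_space) chart set \<Rightarrow> ('p \<Rightarrow> 'q) \<Rightarrow> 'q metric \<Rightarrow>
     ('p \<Rightarrow> 'p tangent \<Rightarrow> 'p tangent \<Rightarrow> 'q tangent) \<Rightarrow> 'p \<Rightarrow> real" where
  "sff_norm_sq A A' F g h p =
     (let es = (SOME es. orthonormal_basis (induced_metric A' F g p) (tangent_space A p) es)
      in \<Sum>i<length es. \<Sum>j<length es.
           g (F p) (h p (es ! i) (es ! j)) (h p (es ! i) (es ! j)))"


subsection \<open>Pointwise semi-slant submanifolds\<close>

definition distribution ::
    "('p::topological_space, 'e::euclidean_space) chart set \<Rightarrow> ('p \<Rightarrow> 'p tangent set) \<Rightarrow> bool" where
  "distribution A D \<longleftrightarrow>
     (\<forall>p. subspace (D p) \<and> D p \<subseteq> tangent_space A p) \<and>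
     (\<forall>p. \<exists>U Xs. p \<in> U \<and> open U \<and> (\<forall>X\<in>set Xs. vector_field_on A U X) \<and>
        (\<forall>q\<in>U. D q = span ((\<lambda>X. X q) ` set Xs) \<and> dim (D q) = length Xs))"

text \<open>
  Angle between two vectors, and between a vector and a subspace. If the projection of \<open>v\<close> to the
  subspace is zero, the latter is \<open>arccos 0 = pi / 2\<close>, as it should be.
\<close>

definition vec_angle :: "('v::real_vector \<Rightarrow> 'v \<Rightarrow> real) \<Rightarrow> 'v \<Rightarrow> 'v \<Rightarrow> real" where
  "vec_angle G v w = arccos (G v w / (sqrt (G v v) * sqrt (G w w)))"

definition subspace_angle :: "('v::real_vector \<Rightarrow> 'v \<Rightarrow> real) \<Rightarrow> 'v \<Rightarrow> 'v set \<Rightarrow> real" where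
  "subspace_angle G v S = vec_angle G v (orth_proj G S v)"

text \<open>
  \<open>D1\<close> and \<open>D2\<close> are distributions on the abstract manifold; \<open>phi\<close> acts on their images in the tangent
  spaces of the ambient manifold.
\<close>

definition pointwise_semi_slant ::
    "('p::topological_space, 'e::euclidean_space) chart set \<Rightarrow>
     ('q::topological_space, 'd::euclidean_space) chart set \<Rightarrow> ('p \<Rightarrow> 'q) \<Rightarrow>
     ('q \<Rightarrow> 'q tangent \<Rightarrow> 'q tangent) \<Rightarrow> 'q metric \<Rightarrow>
     ('p \<Rightarrow> 'p tangent set) \<Rightarrow> ('p \<Rightarrow> 'p tangent set) \<Rightarrow> ('p \<Rightarrow> real) \<Rightarrow> bool" where
  "pointwise_semi_slant A A' F phi g D1 D2 theta \<longleftrightarrow>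
     submanifold A A' F \<and> distribution A D1 \<and>
     (\<forall>p. D2 p = {v \<in> tangent_space A p. \<forall>w\<in>D1 p. induced_metric A' F g p v w = 0}) \<and>
     (\<forall>p. tangent_space A p = {u + v | u v. u \<in> D1 p \<and> v \<in> D2 p} \<and> D1 p \<inter> D2 p = {0}) \<and>
     (\<forall>p. phi (F p) ` (differential A' F p ` D1 p) \<subseteq> differential A' F p ` D1 p) \<and>
     (\<forall>p. \<forall>x\<in>D2 p. x \<noteq> 0 \<longrightarrow>
        subspace_angle (g (F p)) (phi (F p) (differential A' F p x))
          (differential A' F p ` D2 p) = theta p)"

definition proper_pointwise_semi_slant ::
    "('p::topological_space, 'e::euclidean_space) chart set \<Rightarrow>
     ('q::topological_space, 'd::euclidean_space) chart set \<Rightarrow> ('p \<Rightarrow> 'q) \<Rightarrow>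
     ('q \<Rightarrow> 'q tangent \<Rightarrow> 'q tangent) \<Rightarrow> 'q metric \<Rightarrow>
     ('p \<Rightarrow> 'p tangent set) \<Rightarrow> ('p \<Rightarrow> 'p tangent set) \<Rightarrow> ('p \<Rightarrow> real) \<Rightarrow> bool" where
  "proper_pointwise_semi_slant A A' F phi g D1 D2 theta \<longleftrightarrow>
     pointwise_semi_slant A A' F phi g D1 D2 theta \<and> (\<forall>p. 0 < theta p \<and> theta p < pi / 2)"

text \<open>The normal part \<open>F x\<close> of \<open>phi x\<close>, for \<open>x\<close> tangent to the submanifold \<open>i\<close>.\<close>

definition F_part ::
    "('p::topological_space, 'e::euclidean_space) chart set \<Rightarrow>
     ('q::topological_space, 'd::euclidean_space) chart set \<Rightarrow> ('p \<Rightarrow> 'q) \<Rightarrow>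
     ('q \<Rightarrow> 'q tangent \<Rightarrow> 'q tangent) \<Rightarrow> 'q metric \<Rightarrow> 'p \<Rightarrow> 'p tangent \<Rightarrow> 'q tangent" where
  "F_part A A' i phi g p x = normal_part A A' i g p (phi (i p) (differential A' i p x))"

definition mu_space ::
    "('p::topological_space, 'e::euclidean_space) chart set \<Rightarrow>
     ('q::topological_space, 'd::euclidean_space) chart set \<Rightarrow> ('p \<Rightarrow> 'q) \<Rightarrow>
     ('q \<Rightarrow> 'q tangent \<Rightarrow> 'q tangent) \<Rightarrow> 'q metric \<Rightarrow> ('p \<Rightarrow> 'p tangent set) \<Rightarrow> 'p \<Rightarrow>
     'q tangent set" where
  "mu_space A A' i phi g D2 p =
     {v \<in> normal_bundle A A' i g p. \<forall>x\<in>D2 p. g (i p) v (F_part A A' i phi g p x) = 0}"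


subsection \<open>Warped products\<close>

definition warped_metric ::
    "('b::topological_space, 'd::euclidean_space) chart set \<Rightarrow>
     ('f::topological_space, 'e::euclidean_space) chart set \<Rightarrow> 'b metric \<Rightarrow> 'f metric \<Rightarrow>
     ('b \<Rightarrow> real) \<Rightarrow> ('b \<times> 'f) metric" where
  "warped_metric AB AF gB gF f p u v =
     gB (fst p) (differential AB fst p u) (differential AB fst p v) +
     (f (fst p))\<^sup>2 * gF (snd p) (differential AF snd p u) (differential AF snd p v)"

text \<open>\<open>TB\<close> and \<open>TF\<close> as subbundles of \<open>T(B \<times> F)\<close>: the tangent spaces of the leaves \<open>B \<times> {y}\<close>
  and of the fibres \<open>{x} \<times> F\<close>.\<close>

definition base_bundle ::
    "('b::topological_space, 'd::euclidean_space) chart set \<Rightarrow>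
     ('f::topological_space, 'e::euclidean_space) chart set \<Rightarrow> 'b \<times> 'f \<Rightarrow>
     ('b \<times> 'f) tangent set" where
  "base_bundle AB AF p = {v \<in> tangent_space (prod_atlas AB AF) p. differential AF snd p v = 0}"

definition fibre_bundle ::
    "('b::topological_space, 'd::euclidean_space) chart set \<Rightarrow>
     ('f::topological_space, 'e::euclidean_space) chart set \<Rightarrow> 'b \<times> 'f \<Rightarrow>
     ('b \<times> 'f) tangent set" where
  "fibre_bundle AB AF p = {v \<in> tangent_space (prod_atlas AB AF) p. differential AB fst p v = 0}"

end

(*
  At each point the normal space has the orthonormal basis (1 / sin theta) F e_b together with xi,
  where e_b is an orthonormal basis of D2, because n = m1 + 2 m2 makes mu one-dimensional. The Koszul
  formula of the warped metric and nabla phi = 0 determine the components of h in this basis: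
  h(D1, D1) = 0 and g(h(X, Z), F W) = - (phi X)(ln f) g(Z, W) - X(ln f) g(Z, T W) for X in D1 and
  Z, W in D2. Summing squares gives the identity
  |h|^2 = 4 m2 (csc^2 theta + cot^2 theta) |grad ln f|^2 + |h(D2, D2)|^2.
  Bump functions pass between vectors at a point and the global sections of the equality case.
*)
theory Submission
  imports Defs
begin

section \<open>Calculus of smooth maps\<close>

text \<open>The ambient connection acts on fields of N, while h differentiates fields that exist
  only along M. The operator \<open>D\<close> between the two is given by axioms, so its metric
  compatibility, its symmetry on coordinate fields and its commutation with phi are derived first,
  by expansion in an ambient coordinate frame. Everything else is computed on coordinate fields of
  product charts: they split into base and fibre directions, and their brackets vanish. The obstacle
  is that phi maps a base coordinate field to a base field whose coefficients are not known to be
  smooth; the relation g(X, phi Z) = 0 is differentiated instead. Origin of the constant: the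
  xi-component of h vanishes because xi is parallel. Since |F Z| = sin theta |Z| and |T Z| = cos
  theta |Z|, a unit pair contributes csc^2 theta (((phi X) ln f)^2 + cos^2 theta (X ln f)^2). Summed
  over an orthonormal basis of D1, each square gives |grad ln f|^2, because phi is an isometry of
  D1. There are 2 m2 basis vectors in D2, and the mixed pairs count in both orders.\<close>

lemma iterated_deriv_append:
  "iterated_deriv (us @ vs) f = iterated_deriv us (iterated_deriv vs f)"
  by (induction us) auto

lemma smooth_on_open: "smooth_on S f \<Longrightarrow> open S"
  by (simp add: smooth_on_def)

lemma smooth_on_differentiable: "smooth_on S f \<Longrightarrow> x \<in> S \<Longrightarrow> f differentiable (at x)"
  unfolding smooth_on_def by (metis iterated_deriv.simps(1))

lemma smooth_on_has_derivative:
  "smooth_on S f \<Longrightarrow> x \<in> S \<Longrightarrow> (f has_derivative frechet_derivative f (at x)) (at x)"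
  using smooth_on_differentiable frechet_derivative_works by blast

lemma smooth_on_frechet_derivative:
  "smooth_on S f \<Longrightarrow> smooth_on S (\<lambda>x. frechet_derivative f (at x) v)"
  unfolding smooth_on_def
proof (intro conjI allI ballI)
  fix vs x assume *: "open S \<and> (\<forall>vs. \<forall>x\<in>S. iterated_deriv vs f differentiable (at x))" "x \<in> S"
  have "iterated_deriv (vs @ [v]) f = iterated_deriv vs (\<lambda>x. frechet_derivative f (at x) v)"
    by (simp add: iterated_deriv_append)
  then show "iterated_deriv vs (\<lambda>x. frechet_derivative f (at x) v) differentiable at x"
    using * by metis
qed simp

text \<open>Smoothness by coinduction: no formula for higher derivatives is ever needed. Each
  closure property below only has to exhibit a class of functions that is stable under a single
  directional derivative.\<close>

lemma smooth_on_coinduct: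
  assumes "open S" "P f"
    and step: "\<And>f. P f \<Longrightarrow>
      \<exists>f'. (\<forall>x\<in>S. (f has_derivative f' x) (at x)) \<and> (\<forall>v. P (\<lambda>x. f' x v))"
  shows "smooth_on S f"
proof -
  \<comment> \<open>Off \<open>S\<close> the derivatives are uncontrolled, so the induction tracks
    agreement on the open set \<open>S\<close> with some member of \<open>P\<close>.\<close>
  have *: "\<exists>h. P h \<and> (\<forall>x\<in>S. iterated_deriv vs f x = h x)" for vs
  proof (induction vs)
    case Nil
    then show ?case using assms(2) by auto
  next
    case (Cons v vs)
    then obtain h where h: "P h" "\<And>x. x \<in> S \<Longrightarrow> iterated_deriv vs f x = h x" by blast
    obtain h' where h': "\<And>x. x \<in> S \<Longrightarrow> (h has_derivative h' x) (at x)" "\<And>v. P (\<lambda>x. h' x v)"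
      using step[OF h(1)] by blast
    have "frechet_derivative (iterated_deriv vs f) (at x) = h' x" if "x \<in> S" for x
    proof -
      have "(iterated_deriv vs f has_derivative h' x) (at x)"
        using has_derivative_transform_within_open[OF h'(1)[OF that] assms(1) that] h(2) by metis
      then show ?thesis using frechet_derivative_at by metis
    qed
    then show ?case using h'(2)[of v] by force
  qed
  show ?thesis
    unfolding smooth_on_def
  proof (intro conjI allI ballI assms(1))
    fix vs x assume x: "x \<in> S"
    obtain h where h: "P h" "\<And>x. x \<in> S \<Longrightarrow> iterated_deriv vs f x = h x" using * by blast
    obtain h' where h': "\<And>x. x \<in> S \<Longrightarrow> (h has_derivative h' x) (at x)"
      using step[OF h(1)] by blast
    have "(iterated_deriv vs f has_derivative h' x) (at x)"
      using has_derivative_transform_within_open[OF h'(1)[OF x] assms(1) x] h(2) by metis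
    then show "iterated_deriv vs f differentiable at x" by (auto simp: differentiable_def)
  qed
qed

lemma smooth_on_cong:
  assumes "smooth_on S f" "\<And>x. x \<in> S \<Longrightarrow> f x = g x"
  shows "smooth_on S g"
proof (rule smooth_on_coinduct[where P = "\<lambda>g. \<exists>f. smooth_on S f \<and> (\<forall>x\<in>S. f x = g x)"])
  fix g assume "\<exists>f. smooth_on S f \<and> (\<forall>x\<in>S. f x = g x)"
  then obtain f where f: "smooth_on S f" "\<And>x. x \<in> S \<Longrightarrow> f x = g x" by blast
  show "\<exists>f'. (\<forall>x\<in>S. (g has_derivative f' x) (at x)) \<and>
           (\<forall>v. \<exists>f. smooth_on S f \<and> (\<forall>x\<in>S. f x = f' x v))"
  proof (intro exI[of _ "\<lambda>x. frechet_derivative f (at x)"] conjI ballI allI)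
    fix x assume x: "x \<in> S"
    show "(g has_derivative frechet_derivative f (at x)) (at x)"
      using has_derivative_transform_within_open[OF smooth_on_has_derivative[OF f(1) x]
          smooth_on_open[OF f(1)] x] f(2) by metis
  next
    fix v
    show "\<exists>fa. smooth_on S fa \<and> (\<forall>x\<in>S. fa x = frechet_derivative f (at x) v)"
      using smooth_on_frechet_derivative[OF f(1), of v] by blast
  qed
qed (use assms smooth_on_open in auto)

lemma smooth_on_subset: "smooth_on S f \<Longrightarrow> open T \<Longrightarrow> T \<subseteq> S \<Longrightarrow> smooth_on T f"
  unfolding smooth_on_def by blast

lemma smooth_on_local:
  assumes "\<And>x. x \<in> S \<Longrightarrow> \<exists>T. x \<in> T \<and> T \<subseteq> S \<and> smooth_on T f"
  shows "smooth_on S f"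
proof -
  have "open S"
    by (rule openI) (metis assms open_contains_ball subset_trans smooth_on_open)
  then show ?thesis
    using assms unfolding smooth_on_def by blast
qed

section \<open>Closure properties of smooth functions\<close>

lemma smooth_on_const: "open S \<Longrightarrow> smooth_on S (\<lambda>x. c)"
proof (rule smooth_on_coinduct[where P = "\<lambda>f. \<exists>c. f = (\<lambda>x. c)"])
  fix f :: "'a \<Rightarrow> 'b" assume "\<exists>c. f = (\<lambda>x. c)"
  then show "\<exists>f'. (\<forall>x\<in>S. (f has_derivative f' x) (at x)) \<and> (\<forall>v. \<exists>c. (\<lambda>x. f' x v) = (\<lambda>x. c))"
    by (intro exI[of _ "\<lambda>x v. 0"]) auto
qed auto

lemma smooth_on_bounded_linear:
  assumes "open S" "bounded_linear L"
  shows "smooth_on S L"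
proof (rule smooth_on_coinduct[where P = "\<lambda>f. f = L \<or> (\<exists>c. f = (\<lambda>x. c))"])
  fix f :: "'a \<Rightarrow> 'b" assume "f = L \<or> (\<exists>c. f = (\<lambda>x. c))"
  then show "\<exists>f'. (\<forall>x\<in>S. (f has_derivative f' x) (at x)) \<and>
      (\<forall>v. (\<lambda>x. f' x v) = L \<or> (\<exists>c. (\<lambda>x. f' x v) = (\<lambda>x. c)))"
  proof
    assume "f = L"
    then show ?thesis using bounded_linear_imp_has_derivative[OF assms(2)]
      by (intro exI[of _ "\<lambda>x v. L v"]) auto
  next
    assume "\<exists>c. f = (\<lambda>x. c)"
    then show ?thesis by (intro exI[of _ "\<lambda>x v. 0"]) auto
  qed
qed (use assms in auto)

lemma smooth_on_bounded_linear_compose: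
  assumes "smooth_on S f" "bounded_linear L"
  shows "smooth_on S (\<lambda>x. L (f x))"
proof (rule smooth_on_coinduct[where P = "\<lambda>h. \<exists>f. smooth_on S f \<and> h = (\<lambda>x. L (f x))"])
  fix h assume "\<exists>f. smooth_on S f \<and> h = (\<lambda>x. L (f x))"
  then obtain f where f: "smooth_on S f" "h = (\<lambda>x. L (f x))" by blast
  show "\<exists>f'. (\<forall>x\<in>S. (h has_derivative f' x) (at x)) \<and>
      (\<forall>v. \<exists>f. smooth_on S f \<and> (\<lambda>x. f' x v) = (\<lambda>x. L (f x)))"
    unfolding f(2)
    by (intro exI[of _ "\<lambda>x v. L (frechet_derivative f (at x) v)"] conjI ballI allI
        bounded_linear.has_derivative[OF assms(2)] smooth_on_has_derivative[OF f(1)])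
      (use smooth_on_frechet_derivative[OF f(1)] in blast)+
qed (use assms smooth_on_open in auto)

lemma smooth_on_add:
  assumes "smooth_on S f" "smooth_on S g"
  shows "smooth_on S (\<lambda>x. f x + g x)"
proof (rule smooth_on_coinduct[where
      P = "\<lambda>h. \<exists>f g. smooth_on S f \<and> smooth_on S g \<and> h = (\<lambda>x. f x + g x)"])
  fix h assume "\<exists>f g. smooth_on S f \<and> smooth_on S g \<and> h = (\<lambda>x. f x + g x)"
  then obtain f g where f: "smooth_on S f" "smooth_on S g" "h = (\<lambda>x. f x + g x)" by blast
  show "\<exists>f'. (\<forall>x\<in>S. (h has_derivative f' x) (at x)) \<and>
      (\<forall>v. \<exists>f g. smooth_on S f \<and> smooth_on S g \<and> (\<lambda>x. f' x v) = (\<lambda>x. f x + g x))"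
    unfolding f(3)
    by (intro exI[of _ "\<lambda>x v. frechet_derivative f (at x) v + frechet_derivative g (at x) v"]
        conjI ballI allI has_derivative_add smooth_on_has_derivative[OF f(1)]
        smooth_on_has_derivative[OF f(2)])
      (use smooth_on_frechet_derivative[OF f(1)] smooth_on_frechet_derivative[OF f(2)] in blast)+
qed (use assms smooth_on_open in auto)

lemma smooth_on_sum:
  assumes "open S" "\<And>i. i \<in> I \<Longrightarrow> smooth_on S (f i)"
  shows "smooth_on S (\<lambda>x. \<Sum>i\<in>I. f i x)"
  using assms(2)
proof (induction I rule: infinite_finite_induct)
  case (insert i I)
  then show ?case by (simp add: smooth_on_add)
qed (auto intro: smooth_on_const assms(1))

text \<open>Single products are not stable under differentiation, but by the Leibniz rule finite
  sums of them are; this is the class for the coinduction.\<close>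

inductive sum_of_products ::
    "('b::real_normed_vector \<Rightarrow> 'c::real_normed_vector \<Rightarrow> 'd::real_normed_vector) \<Rightarrow>
     'a::real_normed_vector set \<Rightarrow> ('a \<Rightarrow> 'd) \<Rightarrow> bool" for B S where
  prod: "smooth_on S f \<Longrightarrow> smooth_on S g \<Longrightarrow> sum_of_products B S (\<lambda>x. B (f x) (g x))"
| add: "sum_of_products B S f \<Longrightarrow> sum_of_products B S g \<Longrightarrow>
    sum_of_products B S (\<lambda>x. f x + g x)"

lemma smooth_on_bilinear:
  assumes "bounded_bilinear B" "smooth_on S f" "smooth_on S g"
  shows "smooth_on S (\<lambda>x. B (f x) (g x))"
proof (rule smooth_on_coinduct[where P = "sum_of_products B S"])
  fix h assume "sum_of_products B S h"
  then show "\<exists>f'. (\<forall>x\<in>S. (h has_derivative f' x) (at x)) \<and> (\<forall>v. sum_of_products B S (\<lambda>x. f' x v))"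
  proof induction
    case (prod f g)
    show ?case
      by (intro exI[of _ "\<lambda>x v. B (f x) (frechet_derivative g (at x) v) +
             B (frechet_derivative f (at x) v) (g x)"] conjI ballI allI
          bounded_bilinear.FDERIV[OF assms(1)] smooth_on_has_derivative[OF prod(1)]
          smooth_on_has_derivative[OF prod(2)] sum_of_products.intros
          smooth_on_frechet_derivative prod)
  next
    case (add f g)
    then obtain f' g' where
      "\<forall>x\<in>S. (f has_derivative f' x) (at x)" "\<forall>v. sum_of_products B S (\<lambda>x. f' x v)"
      "\<forall>x\<in>S. (g has_derivative g' x) (at x)" "\<forall>v. sum_of_products B S (\<lambda>x. g' x v)" by blast
    then show ?case
      by (intro exI[of _ "\<lambda>x v. f' x v + g' x v"])
        (auto intro: has_derivative_add sum_of_products.add)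
  qed
qed (use assms smooth_on_open in \<open>auto intro: sum_of_products.prod\<close>)

lemmas smooth_on_mult = smooth_on_bilinear[OF bounded_bilinear_mult]
  and smooth_on_scaleR = smooth_on_bilinear[OF bounded_bilinear_scaleR]

text \<open>By the chain rule, the derivative of a composite is a finite sum, over a basis of the
  middle space, of smooth coefficients times composites of partial derivatives of \<open>a\<close>
  with \<open>g\<close>. Allowing coefficients and sums makes the class stable.\<close>

inductive sum_of_composites ::
    "('a::real_normed_vector \<Rightarrow> 'b::real_normed_vector) \<Rightarrow> 'b set \<Rightarrow> 'a set \<Rightarrow>
     ('a \<Rightarrow> 'c::real_normed_vector) \<Rightarrow> bool" for g T S where
  comp: "smooth_on S b \<Longrightarrow> smooth_on T a \<Longrightarrow> sum_of_composites g T S (\<lambda>x. b x *\<^sub>R a (g x))"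
| add: "sum_of_composites g T S f \<Longrightarrow> sum_of_composites g T S h \<Longrightarrow>
    sum_of_composites g T S (\<lambda>x. f x + h x)"

lemma sum_of_composites_sum:
  assumes "open S" "open T" "finite I" "\<And>i. i \<in> I \<Longrightarrow> sum_of_composites g T S (f i)"
  shows "sum_of_composites g T S (\<lambda>x. \<Sum>i\<in>I. f i x)"
  using assms(3,4)
proof (induction I)
  case empty
  show ?case
    using sum_of_composites.comp[OF smooth_on_const[OF assms(1), of 0]
        smooth_on_const[OF assms(2), of 0], of g] by simp
next
  case (insert i I)
  then show ?case by (simp add: sum_of_composites.add)
qed

lemma smooth_on_compose:
  fixes g :: "'a::real_normed_vector \<Rightarrow> 'b::euclidean_space"
  assumes a: "smooth_on T a" and g: "smooth_on S g" and sub: "g ` S \<subseteq> T"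
  shows "smooth_on S (\<lambda>x. a (g x))"
proof (rule smooth_on_coinduct[where P = "sum_of_composites g T S"])
  note op = smooth_on_open[OF g] smooth_on_open[OF a]
  show "sum_of_composites g T S (\<lambda>x. a (g x))"
    using sum_of_composites.comp[OF smooth_on_const[OF op(1), of 1] a, of g] by simp
  fix h assume "sum_of_composites g T S h"
  then show "\<exists>f'. (\<forall>x\<in>S. (h has_derivative f' x) (at x)) \<and>
      (\<forall>v. sum_of_composites g T S (\<lambda>x. f' x v))"
  proof induction
    case (comp b a)
    let ?d = "\<lambda>x v. \<Sum>k\<in>Basis. (b x * (frechet_derivative g (at x) v \<bullet> k)) *\<^sub>R
                frechet_derivative a (at (g x)) k"
    have "((\<lambda>x. b x *\<^sub>R a (g x)) has_derivative
        (\<lambda>v. ?d x v + frechet_derivative b (at x) v *\<^sub>R a (g x))) (at x)" if x: "x \<in> S" for x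
    proof -
      have a': "(a has_derivative frechet_derivative a (at (g x))) (at (g x))"
        using smooth_on_has_derivative[OF comp(2)] sub x by blast
      have l: "linear (frechet_derivative a (at (g x)))"
        using a' has_derivative_linear by blast
      have "b x *\<^sub>R frechet_derivative a (at (g x)) w =
        (\<Sum>k\<in>Basis. (b x * (w \<bullet> k)) *\<^sub>R frechet_derivative a (at (g x)) k)" for w
      proof -
        have "frechet_derivative a (at (g x)) w =
            frechet_derivative a (at (g x)) (\<Sum>k\<in>Basis. (w \<bullet> k) *\<^sub>R k)"
          by (simp add: euclidean_representation)
        also have "\<dots> = (\<Sum>k\<in>Basis. (w \<bullet> k) *\<^sub>R frechet_derivative a (at (g x)) k)"
          by (simp add: linear_sum[OF l] linear_scale[OF l])
        finally show ?thesis by (simp add: scaleR_sum_right)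
      qed
      then have e: "(\<lambda>v. ?d x v + frechet_derivative b (at x) v *\<^sub>R a (g x)) =
        (\<lambda>v. b x *\<^sub>R frechet_derivative a (at (g x)) (frechet_derivative g (at x) v) +
          frechet_derivative b (at x) v *\<^sub>R a (g x))" by simp
      show ?thesis
        unfolding e
        by (rule bounded_bilinear.FDERIV[OF bounded_bilinear_scaleR])
          (use smooth_on_has_derivative[OF comp(1) x]
            has_derivative_compose[OF smooth_on_has_derivative[OF g x] a'] in auto)
    qed
    moreover have "sum_of_composites g T S
        (\<lambda>x. ?d x v + frechet_derivative b (at x) v *\<^sub>R a (g x))" for v
      by (intro sum_of_composites.add sum_of_composites_sum op finite_Basis
          sum_of_composites.comp smooth_on_mult smooth_on_frechet_derivative comp
          smooth_on_bounded_linear_compose[OF smooth_on_frechet_derivative[OF g]]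
          bounded_linear_inner_left)
    ultimately show ?case by (intro exI conjI ballI allI)
  next
    case (add f h)
    then obtain f' g' where
      "\<forall>x\<in>S. (f has_derivative f' x) (at x)" "\<forall>v. sum_of_composites g T S (\<lambda>x. f' x v)"
      "\<forall>x\<in>S. (h has_derivative g' x) (at x)" "\<forall>v. sum_of_composites g T S (\<lambda>x. g' x v)" by blast
    then show ?case
      by (intro exI[of _ "\<lambda>x v. f' x v + g' x v"])
        (auto intro: has_derivative_add sum_of_composites.add)
  qed
qed (use g smooth_on_open in auto)

lemma smooth_on_Pair:
  assumes "smooth_on S f" "smooth_on S g"
  shows "smooth_on S (\<lambda>x. (f x, g x))"
proof -
  have "smooth_on S (\<lambda>x. (f x, 0) + (0, g x))"
    by (intro smooth_on_add smooth_on_bounded_linear_compose[OF assms(1)]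
        smooth_on_bounded_linear_compose[OF assms(2)])
      (auto intro!: bounded_linear_Pair bounded_linear_ident bounded_linear_zero)
  then show ?thesis by simp
qed

section \<open>Smoothness of the logarithm\<close>

lemma DERIV_inverse_power:
  "x \<noteq> 0 \<Longrightarrow>
    ((\<lambda>x. inverse x ^ n) has_real_derivative - real n * inverse x ^ (n + 1)) (at x)"
proof (induction n)
  case (Suc n)
  have "((\<lambda>x. inverse x * inverse x ^ n) has_real_derivative
      - real (Suc n) * inverse x ^ (Suc n + 1)) (at x)"
    by (rule DERIV_cong[OF DERIV_mult[OF DERIV_inverse[OF Suc.prems] Suc.IH[OF Suc.prems]]])
      (simp add: algebra_simps)
  then show ?case by simp
qed simp

text \<open>The class of ln and all c x^(-n) is stable under differentiation: ln falls into the
  second kind after one step and stays there.\<close>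

lemma smooth_on_ln: "smooth_on {0<..} (ln :: real \<Rightarrow> real)"
proof (rule smooth_on_coinduct[where P = "\<lambda>f. f = ln \<or> (\<exists>c n. f = (\<lambda>x. c * inverse x ^ n))"])
  fix f :: "real \<Rightarrow> real" assume "f = ln \<or> (\<exists>c n. f = (\<lambda>x. c * inverse x ^ n))"
  then show "\<exists>f'. (\<forall>x\<in>{0<..}. (f has_derivative f' x) (at x)) \<and>
      (\<forall>v. (\<lambda>x. f' x v) = ln \<or> (\<exists>c n. (\<lambda>x. f' x v) = (\<lambda>x. c * inverse x ^ n)))"
  proof
    assume f: "f = ln"
    show ?thesis unfolding f
    proof (intro exI[of _ "\<lambda>x v. v * inverse x ^ 1"] conjI ballI allI)
      fix x :: real assume "x \<in> {0<..}"
      then show "(ln has_derivative (\<lambda>v. v * inverse x ^ 1)) (at x)"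
        by (auto intro!: derivative_eq_intros simp: divide_inverse)
    qed blast
  next
    assume "\<exists>c n. f = (\<lambda>x. c * inverse x ^ n)"
    then obtain c n where f: "f = (\<lambda>x. c * inverse x ^ n)" by blast
    show ?thesis unfolding f
    proof (intro exI[of _ "\<lambda>x v. (- c * real n * v) * inverse x ^ (n + 1)"] conjI ballI allI)
      fix x :: real assume "x \<in> {0<..}"
      then show "((\<lambda>x. c * inverse x ^ n) has_derivative
          (\<lambda>v. - c * real n * v * inverse x ^ (n + 1))) (at x)"
        using DERIV_cmult[OF DERIV_inverse_power[of x n], of c] unfolding has_field_derivative_def
        by (auto elim!: has_derivative_eq_rhs simp: fun_eq_iff)
    qed blast
  qed
qed auto

text \<open>The double difference of f over a parallelogram with sides e u and e v does not depend
  on the order of the sides. Two mean value steps write it as e^2 times a mixed derivative at a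
  point near x, in either order, and continuity at x then excludes different values.\<close>

lemma second_derivative_symmetric:
  fixes f :: "'a::real_normed_vector \<Rightarrow> real"
  assumes f: "smooth_on S f" and x: "x \<in> S"
  shows "frechet_derivative (\<lambda>y. frechet_derivative f (at y) u) (at x) v =
         frechet_derivative (\<lambda>y. frechet_derivative f (at y) v) (at x) u"
proof -
  define d where "d = (\<lambda>u y. frechet_derivative f (at y) u)"
  define dd where "dd = (\<lambda>u v y. frechet_derivative (d u) (at y) v)"
  have sd: "smooth_on S (d u)" for u
    unfolding d_def by (rule smooth_on_frechet_derivative[OF f])
  have sdd: "smooth_on S (dd u v)" for u v
    unfolding dd_def by (rule smooth_on_frechet_derivative[OF sd])
  obtain r where r: "r > 0" "ball x r \<subseteq> S"
    using smooth_on_open[OF f] x open_contains_ball by blast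
  have line: "((\<lambda>t. F (a + t *\<^sub>R w)) has_derivative (\<lambda>s. s * frechet_derivative F (at (a + t *\<^sub>R w)) w)) (at t)"
    if "smooth_on S F" "a + t *\<^sub>R w \<in> S" for F :: "'a \<Rightarrow> real" and a w t
  proof -
    have F: "(F has_derivative frechet_derivative F (at (a + t *\<^sub>R w))) (at (a + t *\<^sub>R w))"
      using smooth_on_has_derivative that by blast
    have "((\<lambda>t. a + t *\<^sub>R w) has_derivative (\<lambda>s. s *\<^sub>R w)) (at t)"
      by (auto intro!: derivative_eq_intros)
    from has_derivative_compose[OF this F] show ?thesis
      by (simp add: linear_scale[OF has_derivative_linear[OF F]])
  qed
  have quot: "\<exists>s t. 0 < s \<and> s < e \<and> 0 < t \<and> t < e \<and>
      f (x + e *\<^sub>R u + e *\<^sub>R v) - f (x + e *\<^sub>R u) - f (x + e *\<^sub>R v) + f x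
        = e * (e * dd u v (x + s *\<^sub>R u + t *\<^sub>R v))"
    if e: "e > 0" "e * (norm u + norm v) < r" for e u v
  proof -
    have inS: "x + s *\<^sub>R u + t *\<^sub>R v \<in> S" if "0 \<le> s" "s \<le> e" "0 \<le> t" "t \<le> e" for s t
    proof -
      have "norm (s *\<^sub>R u + t *\<^sub>R v) \<le> s * norm u + t * norm v"
        using norm_triangle_ineq[of "s *\<^sub>R u" "t *\<^sub>R v"] that by simp
      also have "\<dots> \<le> e * norm u + e * norm v"
        by (intro add_mono mult_right_mono that) auto
      also have "\<dots> < r" using e by (simp add: distrib_left)
      finally have "norm (s *\<^sub>R u + t *\<^sub>R v) < r" .
      moreover have "dist x (x + s *\<^sub>R u + t *\<^sub>R v) = norm (s *\<^sub>R u + t *\<^sub>R v)"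
        by (metis add.assoc add_diff_cancel_left' dist_commute dist_norm)
      ultimately show ?thesis using r(2) by (auto simp: subset_iff)
    qed
    \<comment> \<open>\<open>F\<close> is the increment of f in direction v as a function of the
      position along u; one mean value step along u and one along v produce \<open>s\<close> and
      \<open>t\<close>.\<close>
    define F where "F = (\<lambda>s. f ((x + e *\<^sub>R v) + s *\<^sub>R u) - f (x + s *\<^sub>R u))"
    have "\<exists>s>0. s < e \<and> F e - F 0 =
        (e - 0) * (d u ((x + e *\<^sub>R v) + s *\<^sub>R u) - d u (x + s *\<^sub>R u))"
    proof (rule MVT2[OF e(1)])
      fix s assume s: "0 \<le> s" "s \<le> e"
      have "(x + e *\<^sub>R v) + s *\<^sub>R u \<in> S" "x + s *\<^sub>R u \<in> S"
        using inS[of s e] inS[of s 0] s e by (auto simp: algebra_simps)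
      then show "(F has_real_derivative d u ((x + e *\<^sub>R v) + s *\<^sub>R u) - d u (x + s *\<^sub>R u)) (at s)"
        unfolding F_def has_field_derivative_def d_def
        by (rule has_derivative_eq_rhs[OF has_derivative_diff[OF line[OF f] line[OF f]]])
          (auto simp: fun_eq_iff algebra_simps)
    qed
    then obtain s where s: "s > 0" "s < e"
      "F e - F 0 = e * (d u ((x + e *\<^sub>R v) + s *\<^sub>R u) - d u (x + s *\<^sub>R u))" by auto
    define H where "H = (\<lambda>t. d u ((x + s *\<^sub>R u) + t *\<^sub>R v))"
    have "\<exists>t>0. t < e \<and> H e - H 0 = (e - 0) * dd u v ((x + s *\<^sub>R u) + t *\<^sub>R v)"
    proof (rule MVT2[OF e(1)])
      fix t assume t: "0 \<le> t" "t \<le> e"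
      show "(H has_real_derivative dd u v ((x + s *\<^sub>R u) + t *\<^sub>R v)) (at t)"
        unfolding H_def has_field_derivative_def dd_def
        by (rule has_derivative_eq_rhs[OF line[OF sd]])
          (use inS[of s t] s t in \<open>auto simp: fun_eq_iff\<close>)
    qed
    then obtain t where t: "t > 0" "t < e" "H e - H 0 = e * dd u v ((x + s *\<^sub>R u) + t *\<^sub>R v)"
      by auto
    have "f (x + e *\<^sub>R u + e *\<^sub>R v) - f (x + e *\<^sub>R u) - f (x + e *\<^sub>R v) + f x = F e - F 0"
      by (simp add: F_def algebra_simps)
    also have "\<dots> = e * (H e - H 0)" using s(3) by (simp add: H_def algebra_simps)
    finally show ?thesis using s t by auto
  qed
  have "dd u v x = dd v u x"
  proof (rule ccontr)
    assume ne: "dd u v x \<noteq> dd v u x"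
    \<comment> \<open>Half the gap: numbers within this distance of the two mixed derivatives cannot
      coincide.\<close>
    define \<epsilon> where "\<epsilon> = \<bar>dd u v x - dd v u x\<bar> / 2"
    have \<epsilon>: "\<epsilon> > 0" using ne by (simp add: \<epsilon>_def)
    have "\<exists>\<delta>>0. \<forall>y. dist y x < \<delta> \<longrightarrow> \<bar>dd u v y - dd u v x\<bar> < \<epsilon>" for u v
    proof -
      have "isCont (dd u v) x"
        using differentiable_imp_continuous_within smooth_on_differentiable[OF sdd x] by blast
      then show ?thesis using \<epsilon> by (auto simp: continuous_at_eps_delta dist_real_def)
    qed
    then obtain \<delta>1 \<delta>2 where \<delta>: "\<delta>1 > 0" "\<And>y. dist y x < \<delta>1 \<Longrightarrow> \<bar>dd u v y - dd u v x\<bar> < \<epsilon>"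
      "\<delta>2 > 0" "\<And>y. dist y x < \<delta>2 \<Longrightarrow> \<bar>dd v u y - dd v u x\<bar> < \<epsilon>" by metis
    define R where "R = min r (min \<delta>1 \<delta>2)"
    \<comment> \<open>The summand 1 keeps the denominator positive when \<open>u\<close> and
      \<open>v\<close> both vanish.\<close>
    define e where "e = R / (norm u + norm v + 1)"
    have R: "R > 0" using r \<delta> by (simp add: R_def)
    have e: "e > 0" "e * (norm u + norm v) < R"
    proof -
      have p: "norm u + norm v + 1 > 0" by (simp add: add_nonneg_pos)
      show "e > 0" unfolding e_def using R p by simp
      have "e * (norm u + norm v) < e * (norm u + norm v + 1)" using \<open>e > 0\<close> by simp
      also have "\<dots> = R" unfolding e_def using p by simp
      finally show "e * (norm u + norm v) < R" .
    qed
    have near: "dist (x + s *\<^sub>R u + t *\<^sub>R v) x < R" if "0 < s" "s < e" "0 < t" "t < e" for s t u' v'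
    proof -
      have "dist (x + s *\<^sub>R u + t *\<^sub>R v) x = norm (s *\<^sub>R u + t *\<^sub>R v)"
        by (simp add: dist_norm algebra_simps)
      also have "\<dots> \<le> s * norm u + t * norm v"
        using norm_triangle_ineq[of "s *\<^sub>R u" "t *\<^sub>R v"] that by simp
      also have "\<dots> \<le> e * norm u + e * norm v"
        using that by (intro add_mono mult_right_mono) auto
      also have "\<dots> < R" using e by (simp add: distrib_left)
      finally show ?thesis .
    qed
    obtain s t where st: "0 < s" "s < e" "0 < t" "t < e"
      "f (x + e *\<^sub>R u + e *\<^sub>R v) - f (x + e *\<^sub>R u) - f (x + e *\<^sub>R v) + f x
        = e * (e * dd u v (x + s *\<^sub>R u + t *\<^sub>R v))"
      using quot[of e u v] e by (auto simp: R_def)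
    obtain s' t' where st': "0 < s'" "s' < e" "0 < t'" "t' < e"
      "f (x + e *\<^sub>R v + e *\<^sub>R u) - f (x + e *\<^sub>R v) - f (x + e *\<^sub>R u) + f x
        = e * (e * dd v u (x + s' *\<^sub>R v + t' *\<^sub>R u))"
      using quot[of e v u] e by (auto simp: R_def add.commute)
    have "f (x + e *\<^sub>R v + e *\<^sub>R u) = f (x + e *\<^sub>R u + e *\<^sub>R v)" by (simp add: algebra_simps)
    then have "e * (e * dd u v (x + s *\<^sub>R u + t *\<^sub>R v)) = e * (e * dd v u (x + s' *\<^sub>R v + t' *\<^sub>R u))"
      using st(5) st'(5) by linarith
    then have "dd u v (x + s *\<^sub>R u + t *\<^sub>R v) = dd v u (x + s' *\<^sub>R v + t' *\<^sub>R u)"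
      using e by simp
    moreover have "\<bar>dd u v (x + s *\<^sub>R u + t *\<^sub>R v) - dd u v x\<bar> < \<epsilon>"
      using \<delta>(2) near[OF st(1-4)] by (auto simp: R_def)
    moreover have "\<bar>dd v u (x + s' *\<^sub>R v + t' *\<^sub>R u) - dd v u x\<bar> < \<epsilon>"
      using \<delta>(4) near[OF st'(3,4) st'(1,2)] by (auto simp: R_def algebra_simps)
    ultimately show False unfolding \<epsilon>_def by (simp add: abs_if split: if_splits)
  qed
  then show ?thesis by (simp add: dd_def d_def)
qed

text \<open>For positive t this is t^(-n) exp(-1/t). The exponent n is a parameter because the
  derivative of member n is a combination of members n + 2 and n + 1, so the whole family spans a
  class stable under differentiation.\<close>

definition flat_power :: "nat \<Rightarrow> real \<Rightarrow> real" where
  "flat_power n t = (if t > 0 then inverse t ^ n * exp (- inverse t) else 0)"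

lemma flat_power_tendsto: "(flat_power n \<longlongrightarrow> 0) (at 0)"
proof -
  have "((\<lambda>s::real. s ^ n / exp s) \<longlongrightarrow> 0) at_top" by (rule tendsto_power_div_exp_0)
  then have "((\<lambda>t::real. inverse t ^ n / exp (inverse t)) \<longlongrightarrow> 0) (at_right 0)"
    using filterlim_compose filterlim_inverse_at_top_right by blast
  then have r: "(flat_power n \<longlongrightarrow> 0) (at_right 0)"
    by (rule Lim_transform_eventually)
      (auto simp: flat_power_def exp_minus divide_inverse intro!: eventually_at_rightI[of 0 1])
  have l: "(flat_power n \<longlongrightarrow> 0) (at_left 0)"
    by (rule Lim_transform_eventually[OF tendsto_const])
      (auto simp: flat_power_def intro!: eventually_at_leftI[of "-1" 0])
  show ?thesis using l r by (simp add: filterlim_at_split)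
qed

lemma flat_power_deriv:
  "(flat_power n has_real_derivative flat_power (n + 2) t - real n * flat_power (n + 1) t) (at t)"
proof -
  consider "t > 0" | "t < 0" | "t = 0" by linarith
  then show ?thesis
  proof cases
    case 1
    have "((\<lambda>t. inverse t ^ n * exp (- inverse t)) has_real_derivative
        flat_power (n + 2) t - real n * flat_power (n + 1) t) (at t)"
    proof (rule DERIV_cong[OF DERIV_mult[OF DERIV_inverse_power]])
      show "((\<lambda>t. exp (- inverse t)) has_real_derivative exp (- inverse t) * inverse t ^ 2) (at t)"
        using 1 by (auto intro!: derivative_eq_intros simp: power2_eq_square)
    qed (use 1 in \<open>auto simp: flat_power_def algebra_simps power2_eq_square\<close>)
    then show ?thesis
      by (rule DERIV_cong_ev[THEN iffD1, rotated -1, OF _ refl _ refl])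
        (use eventually_nhds_in_open[of "{0<..}" t] 1 in
          \<open>auto simp: flat_power_def elim!: eventually_mono\<close>)
  next
    case 2
    have "((\<lambda>t. 0) has_real_derivative flat_power (n + 2) t - real n * flat_power (n + 1) t) (at t)"
      using 2 by (auto simp: flat_power_def)
    then show ?thesis
      by (rule DERIV_cong_ev[THEN iffD1, rotated -1, OF _ refl _ refl])
        (use eventually_nhds_in_open[of "{..<0}" t] 2 in
          \<open>auto simp: flat_power_def elim!: eventually_mono\<close>)
  next
    \<comment> \<open>At 0 the difference quotient of member n is member n + 1, which tends to
      0.\<close>
    case 3
    have "((\<lambda>h. (flat_power n (0 + h) - flat_power n 0) / h) \<longlongrightarrow> 0) (at 0)"
      by (rule Lim_transform_eventually[OF flat_power_tendsto[of "n + 1"]])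
        (auto simp: flat_power_def eventually_at_filter field_simps)
    then show ?thesis using 3 by (simp add: DERIV_def flat_power_def)
  qed
qed

inductive flat_span :: "(real \<Rightarrow> real) \<Rightarrow> bool" where
  base: "flat_span (\<lambda>t. c * flat_power n t)"
| add: "flat_span f \<Longrightarrow> flat_span g \<Longrightarrow> flat_span (\<lambda>t. f t + g t)"

lemma smooth_on_flat_power: "smooth_on UNIV (flat_power n)"
proof (rule smooth_on_coinduct[where P = flat_span])
  show "flat_span (flat_power n)" using flat_span.base[of 1 n] by simp
  fix f assume "flat_span f"
  then show "\<exists>f'. (\<forall>x\<in>UNIV. (f has_derivative f' x) (at x)) \<and> (\<forall>v. flat_span (\<lambda>x. f' x v))"
  proof induction
    case (base c n)
    show ?case
    proof (intro exI[of _ "\<lambda>t v. (v * c) * flat_power (n + 2) t +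
             (- (v * c * real n)) * flat_power (n + 1) t"] conjI ballI allI)
      fix t
      have "((\<lambda>t. c * flat_power n t) has_real_derivative
          c * (flat_power (n + 2) t - real n * flat_power (n + 1) t)) (at t)"
        by (rule DERIV_cmult[OF flat_power_deriv])
      then show "((\<lambda>t. c * flat_power n t) has_derivative
          (\<lambda>v. v * c * flat_power (n + 2) t + - (v * c * real n) * flat_power (n + 1) t)) (at t)"
        unfolding has_field_derivative_def
        by (rule has_derivative_eq_rhs) (simp add: fun_eq_iff algebra_simps)
    qed (intro flat_span.intros)
  next
    case (add f g)
    then obtain f' g' where
      "\<forall>x\<in>UNIV. (f has_derivative f' x) (at x)" "\<forall>v. flat_span (\<lambda>x. f' x v)"
      "\<forall>x\<in>UNIV. (g has_derivative g' x) (at x)" "\<forall>v. flat_span (\<lambda>x. g' x v)" by blast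
    then show ?case
      by (intro exI[of _ "\<lambda>x v. f' x v + g' x v"]) (auto intro: has_derivative_add flat_span.add)
  qed
qed simp

lemma smooth_bump:
  fixes a :: "'a::euclidean_space"
  assumes "r > 0"
  obtains b :: "'a \<Rightarrow> real" where "smooth_on UNIV b" "b a > 0" "\<And>x. dist a x \<ge> r \<Longrightarrow> b x = 0"
proof
  \<comment> \<open>The squared distance is polynomial in x, hence smooth also at the centre; member
    0 of the family is positive exactly for positive arguments, here inside the ball of radius
    r.\<close>
  let ?b = "\<lambda>x. flat_power 0 (r\<^sup>2 - (x - a) \<bullet> (x - a))"
  have s: "smooth_on UNIV (\<lambda>x. x - a)"
    using smooth_on_add[OF smooth_on_bounded_linear[OF open_UNIV bounded_linear_ident]
        smooth_on_const[OF open_UNIV, of "- a"]] by simp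
  have "smooth_on UNIV (\<lambda>x. r\<^sup>2 + (- 1) *\<^sub>R ((x - a) \<bullet> (x - a)))"
    by (intro smooth_on_add smooth_on_const open_UNIV smooth_on_scaleR
        smooth_on_bilinear[OF bounded_bilinear_inner s s])
  then have "smooth_on UNIV (\<lambda>x. r\<^sup>2 - (x - a) \<bullet> (x - a))" by simp
  from smooth_on_compose[OF smooth_on_flat_power this]
  show "smooth_on UNIV ?b" by simp
  show "?b a > 0" using assms by (simp add: flat_power_def)
  show "?b x = 0" if "dist a x \<ge> r" for x
  proof -
    have "r\<^sup>2 \<le> (x - a) \<bullet> (x - a)"
      using that assms
      by (metis abs_le_square_iff abs_norm_cancel abs_of_pos dist_commute dist_norm
          power2_norm_eq_inner)
    then show ?thesis by (simp add: flat_power_def)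
  qed
qed

section \<open>Charts and tangent vectors\<close>

lemma scaleR_fun_apply [simp]: "(c *\<^sub>R f) x = c *\<^sub>R f x"
  by (simp add: scaleR_fun_def)

text \<open>The directional derivative in chart coordinates, with the same default 0 off smooth
  germs as in \<open>tangent_space\<close>; as a function of the point it is the coordinate field
  with constant direction u.\<close>

definition coord_vector ::
    "('p::topological_space, 'e::euclidean_space) chart set \<Rightarrow> 'p set \<Rightarrow> ('p \<Rightarrow> 'e) \<Rightarrow> 'e \<Rightarrow>
     'p vfield" where
  "coord_vector A U x u p =
     (\<lambda>f. if smooth_near A p f then frechet_derivative (f \<circ> inv_into U x) (at (x p)) u else 0)"

locale manifold =
  fixes A :: "('p::{t2_space, second_countable_topology}, 'e::euclidean_space) chart set"
  assumes atlas: "smooth_atlas A"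
begin

lemma chartE: obtains U x where "(U, x) \<in> A" "p \<in> U"
proof -
  have "p \<in> (\<Union>c\<in>A. fst c)" using atlas by (simp add: smooth_atlas_def)
  then show ?thesis using that by auto
qed

lemma
  assumes "(U, x) \<in> A"
  shows chart_open: "open U"
    and chart_inj: "inj_on x U"
    and chart_inv: "\<And>p. p \<in> U \<Longrightarrow> inv_into U x (x p) = p"
    and chart_continuous: "continuous_on U x"
    and chart_inv_continuous: "continuous_on (x ` U) (inv_into U x)"
    and chart_image_open: "\<And>W. open W \<Longrightarrow> open (x ` (U \<inter> W))"
proof -
  have c: "open U" "open (x ` U)" and h: "homeomorphism U (x ` U) x (inv_into U x)"
    using atlas assms by (auto simp: smooth_atlas_def is_chart_def)
  show "open U" by (rule c)
  show inv: "inv_into U x (x p) = p" if "p \<in> U" for p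
    using h that by (auto simp: homeomorphism_def)
  show "inj_on x U" by (metis inj_on_inverseI inv)
  show "continuous_on U x" "continuous_on (x ` U) (inv_into U x)"
    using h by (auto simp: homeomorphism_def)
  show "open (x ` (U \<inter> W))" if "open W" for W
  proof -
    have "openin (top_of_set (x ` U)) (x ` (U \<inter> W))"
      by (rule homeomorphism_imp_open_map[OF h]) (use that in auto)
    then show ?thesis using c(2) openin_open_trans by blast
  qed
qed

lemma transition_smooth:
  "(U, x) \<in> A \<Longrightarrow> (V, y) \<in> A \<Longrightarrow> smooth_on (x ` (U \<inter> V)) (y \<circ> inv_into U x)"
  using atlas by (auto simp: smooth_atlas_def)

section \<open>Smooth functions on a manifold\<close>

lemma smooth_fun_on_open: "smooth_fun_on A W f \<Longrightarrow> open W"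
  by (simp add: smooth_fun_on_def)

lemma smooth_fun_onD:
  "smooth_fun_on A W f \<Longrightarrow> (U, x) \<in> A \<Longrightarrow> smooth_on (x ` (U \<inter> W)) (f \<circ> inv_into U x)"
  by (auto simp: smooth_fun_on_def)

lemma smooth_fun_on_chartsI:
  assumes "open W" "\<And>U x. (U, x) \<in> A \<Longrightarrow> smooth_on (x ` (U \<inter> W)) (f \<circ> inv_into U x)"
  shows "smooth_fun_on A W f"
  using assms by (auto simp: smooth_fun_on_def)

text \<open>The definition quantifies over all charts; smoothness of the transition maps reduces it
  to one chart around each point.\<close>

lemma smooth_fun_onI:
  assumes "\<And>p. p \<in> W \<Longrightarrow> \<exists>U x W'. (U, x) \<in> A \<and> p \<in> U \<and> p \<in> W' \<and> W' \<subseteq> W \<and> open W' \<and>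
    smooth_on (x ` (U \<inter> W')) (f \<circ> inv_into U x)"
  shows "smooth_fun_on A W f"
proof (rule smooth_fun_on_chartsI)
  show "open W" by (subst open_subopen) (meson assms)
  fix V y assume V: "(V, y) \<in> A"
  show "smooth_on (y ` (V \<inter> W)) (f \<circ> inv_into V y)"
  proof (rule smooth_on_local)
    fix z assume "z \<in> y ` (V \<inter> W)"
    then obtain p where p: "p \<in> V" "p \<in> W" "z = y p" by blast
    obtain U x W' where U: "(U, x) \<in> A" "p \<in> U" "p \<in> W'" "W' \<subseteq> W" "open W'"
      "smooth_on (x ` (U \<inter> W')) (f \<circ> inv_into U x)"
      using assms[OF p(2)] by blast
    have o: "open (y ` (V \<inter> (U \<inter> W')))"
      by (rule chart_image_open[OF V]) (use chart_open[OF U(1)] U(5) in auto)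
    have "smooth_on (y ` (V \<inter> (U \<inter> W'))) (x \<circ> inv_into V y)"
      by (rule smooth_on_subset[OF transition_smooth[OF V U(1)] o]) auto
    then have "smooth_on (y ` (V \<inter> (U \<inter> W'))) (\<lambda>z. (f \<circ> inv_into U x) ((x \<circ> inv_into V y) z))"
      by (rule smooth_on_compose[OF U(6)]) (auto simp: chart_inv[OF V])
    then have "smooth_on (y ` (V \<inter> (U \<inter> W'))) (f \<circ> inv_into V y)"
      by (rule smooth_on_cong) (auto simp: chart_inv[OF V] chart_inv[OF U(1)])
    then show "\<exists>T. z \<in> T \<and> T \<subseteq> y ` (V \<inter> W) \<and> smooth_on T (f \<circ> inv_into V y)"
      using p U by (intro exI[of _ "y ` (V \<inter> (U \<inter> W'))"]) auto
  qed
qed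

lemma smooth_fun_on_subset:
  assumes "smooth_fun_on A W f" "open W'" "W' \<subseteq> W"
  shows "smooth_fun_on A W' f"
proof (rule smooth_fun_onI)
  fix p assume p: "p \<in> W'"
  obtain U x where U: "(U, x) \<in> A" "p \<in> U" by (rule chartE)
  have "smooth_on (x ` (U \<inter> W')) (f \<circ> inv_into U x)"
    by (rule smooth_on_subset[OF smooth_fun_onD[OF assms(1) U(1)] chart_image_open[OF U(1) assms(2)]])
      (use assms(3) in auto)
  then show "\<exists>U x V. (U, x) \<in> A \<and> p \<in> U \<and> p \<in> V \<and> V \<subseteq> W' \<and> open V \<and>
      smooth_on (x ` (U \<inter> V)) (f \<circ> inv_into U x)"
    using p U assms(2) by blast
qed

lemma smooth_fun_on_local:
  assumes "\<And>p. p \<in> W \<Longrightarrow> \<exists>W'. p \<in> W' \<and> W' \<subseteq> W \<and> smooth_fun_on A W' f"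
  shows "smooth_fun_on A W f"
proof (rule smooth_fun_onI)
  fix p assume "p \<in> W"
  then obtain W' where W': "p \<in> W'" "W' \<subseteq> W" "smooth_fun_on A W' f" using assms by blast
  obtain U x where U: "(U, x) \<in> A" "p \<in> U" by (rule chartE)
  show "\<exists>U x W'. (U, x) \<in> A \<and> p \<in> U \<and> p \<in> W' \<and> W' \<subseteq> W \<and> open W' \<and>
      smooth_on (x ` (U \<inter> W')) (f \<circ> inv_into U x)"
    using W' U smooth_fun_onD[OF W'(3) U(1)] smooth_fun_on_open by blast
qed

lemma smooth_fun_on_cong:
  assumes "smooth_fun_on A W f" "\<And>p. p \<in> W \<Longrightarrow> f p = g p"
  shows "smooth_fun_on A W g"
proof (rule smooth_fun_on_chartsI[OF smooth_fun_on_open[OF assms(1)]])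
  fix V y assume V: "(V, y) \<in> A"
  show "smooth_on (y ` (V \<inter> W)) (g \<circ> inv_into V y)"
    by (rule smooth_on_cong[OF smooth_fun_onD[OF assms(1) V]])
      (auto simp: chart_inv[OF V] assms(2))
qed

lemma smooth_fun_on_const: "open W \<Longrightarrow> smooth_fun_on A W (\<lambda>p. c)"
  unfolding smooth_fun_on_def o_def by (auto intro!: smooth_on_const chart_image_open)

lemma smooth_fun_on_add:
  "smooth_fun_on A W f \<Longrightarrow> smooth_fun_on A W g \<Longrightarrow> smooth_fun_on A W (\<lambda>p. f p + g p)"
  unfolding smooth_fun_on_def o_def by (auto intro!: smooth_on_add)

lemma smooth_fun_on_mult:
  "smooth_fun_on A W f \<Longrightarrow> smooth_fun_on A W g \<Longrightarrow> smooth_fun_on A W (\<lambda>p. f p * g p)"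
  unfolding smooth_fun_on_def o_def by (auto intro!: smooth_on_mult)

lemma smooth_fun_on_minus: "smooth_fun_on A W f \<Longrightarrow> smooth_fun_on A W (\<lambda>p. - f p)"
  using smooth_fun_on_mult[OF smooth_fun_on_const[OF smooth_fun_on_open], of W f f "- 1"] by simp

lemma smooth_fun_on_sum:
  "open W \<Longrightarrow> (\<And>i. i \<in> I \<Longrightarrow> smooth_fun_on A W (f i)) \<Longrightarrow>
    smooth_fun_on A W (\<lambda>p. \<Sum>i\<in>I. f i p)"
  by (induction I rule: infinite_finite_induct)
    (auto intro: smooth_fun_on_const smooth_fun_on_add)

lemma smooth_fun_on_compose_real:
  fixes \<phi> :: "real \<Rightarrow> real"
  assumes "smooth_fun_on A W f" "smooth_on T \<phi>" "f ` W \<subseteq> T"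
  shows "smooth_fun_on A W (\<lambda>p. \<phi> (f p))"
proof (rule smooth_fun_on_chartsI[OF smooth_fun_on_open[OF assms(1)]])
  fix V y assume V: "(V, y) \<in> A"
  have "smooth_on (y ` (V \<inter> W)) (\<lambda>z. \<phi> ((f \<circ> inv_into V y) z))"
    by (rule smooth_on_compose[OF assms(2) smooth_fun_onD[OF assms(1) V]])
      (use assms(3) in \<open>auto simp: chart_inv[OF V]\<close>)
  then show "smooth_on (y ` (V \<inter> W)) ((\<lambda>p. \<phi> (f p)) \<circ> inv_into V y)" by (simp add: o_def)
qed

lemma smooth_fun_on_chart_compose:
  fixes \<phi> :: "'e \<Rightarrow> real"
  assumes U: "(U, x) \<in> A" and \<phi>: "smooth_on T \<phi>" "x ` U \<subseteq> T"
  shows "smooth_fun_on A U (\<lambda>p. \<phi> (x p))"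
proof (rule smooth_fun_onI)
  fix p assume p: "p \<in> U"
  have o: "open (x ` U)" using chart_image_open[OF U open_UNIV] by simp
  have "smooth_on (x ` U) (\<lambda>p. \<phi> (id p))"
    by (rule smooth_on_compose[OF \<phi>(1)])
      (use \<phi>(2) o in \<open>auto simp: id_def intro: smooth_on_bounded_linear bounded_linear_ident\<close>)
  then have "smooth_on (x ` (U \<inter> U)) ((\<lambda>p. \<phi> (x p)) \<circ> inv_into U x)"
    by (auto intro: smooth_on_cong simp: chart_inv[OF U])
  then show "\<exists>U' x' W'. (U', x') \<in> A \<and> p \<in> U' \<and> p \<in> W' \<and> W' \<subseteq> U \<and> open W' \<and>
      smooth_on (x' ` (U' \<inter> W')) ((\<lambda>p. \<phi> (x p)) \<circ> inv_into U' x')"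
    using U p chart_open[OF U] by blast
qed

lemma smooth_fun_on_coord: "(U, x) \<in> A \<Longrightarrow> smooth_fun_on A U (\<lambda>p. x p \<bullet> k)"
  by (rule smooth_fun_on_chart_compose[where \<phi> = "\<lambda>z. z \<bullet> k", OF _ smooth_on_bounded_linear[OF open_UNIV bounded_linear_inner_left]])
    simp_all

lemma smooth_nearI: "smooth_fun_on A W f \<Longrightarrow> p \<in> W \<Longrightarrow> smooth_near A p f"
  by (auto simp: smooth_near_def)

lemma smooth_near2E:
  assumes "smooth_near A p f" "smooth_near A p g"
  obtains W where "p \<in> W" "smooth_fun_on A W f" "smooth_fun_on A W g"
proof -
  obtain V W where *: "p \<in> V" "p \<in> W" "smooth_fun_on A V f" "smooth_fun_on A W g"
    using assms by (auto simp: smooth_near_def)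
  note o = open_Int[OF *(3,4)[THEN smooth_fun_on_open]]
  show ?thesis
    using that[OF _ smooth_fun_on_subset[OF *(3) o Int_lower1] smooth_fun_on_subset[OF *(4) o Int_lower2]]
      *(1,2) by blast
qed

lemma smooth_near_const: "smooth_near A p (\<lambda>q. c)"
  by (rule smooth_nearI[OF smooth_fun_on_const[OF open_UNIV]]) simp

lemma smooth_near_add:
  "smooth_near A p f \<Longrightarrow> smooth_near A p g \<Longrightarrow> smooth_near A p (\<lambda>q. f q + g q)"
proof -
  assume "smooth_near A p f" "smooth_near A p g"
  then obtain W where W: "p \<in> W" "smooth_fun_on A W f" "smooth_fun_on A W g"
    by (rule smooth_near2E)
  show ?thesis by (rule smooth_nearI[OF smooth_fun_on_add[OF W(2,3)] W(1)])
qed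

lemma smooth_near_mult:
  "smooth_near A p f \<Longrightarrow> smooth_near A p g \<Longrightarrow> smooth_near A p (\<lambda>q. f q * g q)"
proof -
  assume "smooth_near A p f" "smooth_near A p g"
  then obtain W where W: "p \<in> W" "smooth_fun_on A W f" "smooth_fun_on A W g"
    by (rule smooth_near2E)
  show ?thesis by (rule smooth_nearI[OF smooth_fun_on_mult[OF W(2,3)] W(1)])
qed

lemma smooth_near_sum:
  "(\<And>i. i \<in> I \<Longrightarrow> smooth_near A p (f i)) \<Longrightarrow> smooth_near A p (\<lambda>q. \<Sum>i\<in>I. f i q)"
  by (induction I rule: infinite_finite_induct)
    (auto intro: smooth_near_const smooth_near_add)

lemma smooth_near_cong:
  assumes "open W" "p \<in> W" "\<And>q. q \<in> W \<Longrightarrow> f q = g q"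
  shows "smooth_near A p f \<longleftrightarrow> smooth_near A p g"
proof -
  have "smooth_near A p g" if fg: "\<And>q. q \<in> W \<Longrightarrow> f q = g q" and f: "smooth_near A p f"
    for f g :: "'p \<Rightarrow> real"
  proof -
    obtain V where V: "p \<in> V" "smooth_fun_on A V f" using f by (auto simp: smooth_near_def)
    have "smooth_fun_on A (V \<inter> W) f"
      by (rule smooth_fun_on_subset[OF V(2)]) (use V smooth_fun_on_open assms in auto)
    then have "smooth_fun_on A (V \<inter> W) g" by (rule smooth_fun_on_cong) (use fg in auto)
    then show ?thesis by (rule smooth_nearI) (use V assms in auto)
  qed
  from this[of f g] this[of g f] assms(3) show ?thesis by auto
qed

lemma smooth_near_in_chart:
  assumes "smooth_near A p f" "(U, x) \<in> A" "p \<in> U"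
  obtains T where "x p \<in> T" "T \<subseteq> x ` U" "smooth_on T (f \<circ> inv_into U x)"
proof -
  obtain W where W: "p \<in> W" "smooth_fun_on A W f" using assms by (auto simp: smooth_near_def)
  show ?thesis
    by (rule that[of "x ` (U \<inter> W)"]) (use W smooth_fun_onD[OF W(2) assms(2)] assms in auto)
qed

lemma smooth_near_has_derivative:
  assumes "smooth_near A p f" "(U, x) \<in> A" "p \<in> U"
  shows "((f \<circ> inv_into U x) has_derivative frechet_derivative (f \<circ> inv_into U x) (at (x p))) (at (x p))"
  using smooth_near_in_chart[OF assms] smooth_on_has_derivative by metis

section \<open>Coordinate vectors and tangent spaces\<close>

lemma coord_vector_smooth:
  "smooth_near A p f \<Longrightarrow>
    coord_vector A U x u p f = frechet_derivative (f \<circ> inv_into U x) (at (x p)) u"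
  by (simp add: coord_vector_def)

lemma coord_vector_not_smooth: "\<not> smooth_near A p f \<Longrightarrow> coord_vector A U x u p f = 0"
  by (simp add: coord_vector_def)

lemma coord_vector_derivative:
  assumes "smooth_near A p f" "(U, x) \<in> A" "p \<in> U"
    and "((f \<circ> inv_into U x) has_derivative f') (at (x p))"
  shows "coord_vector A U x u p f = f' u"
  using coord_vector_smooth[OF assms(1)] frechet_derivative_at[OF assms(4)] by metis

lemma coord_vector_linear:
  assumes "(U, x) \<in> A" "p \<in> U"
  shows "linear (\<lambda>u. coord_vector A U x u p)"
proof -
  have l: "linear (frechet_derivative (f \<circ> inv_into U x) (at (x p)))" if "smooth_near A p f" for f
    using smooth_near_has_derivative[OF that assms] has_derivative_linear by blast
  show ?thesis
    by (rule linearI)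
      (auto simp: coord_vector_def fun_eq_iff linear_add[OF l] linear_scale[OF l])
qed

lemma coord_vector_in_tangent_space:
  "(U, x) \<in> A \<Longrightarrow> p \<in> U \<Longrightarrow> coord_vector A U x u p \<in> tangent_space A p"
  unfolding tangent_space_def coord_vector_def by blast

text \<open>The definition lets each tangent vector come from its own chart. The chain rule through
  the transition map rewrites it in the given chart, with direction changed by the derivative of
  that map.\<close>

lemma tangent_space_eq:
  assumes U: "(U, x) \<in> A" "p \<in> U"
  shows "tangent_space A p = range (\<lambda>u. coord_vector A U x u p)"
proof
  show "range (\<lambda>u. coord_vector A U x u p) \<subseteq> tangent_space A p"
    using coord_vector_in_tangent_space[OF U] by blast
  show "tangent_space A p \<subseteq> range (\<lambda>u. coord_vector A U x u p)"
  proof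
    fix v assume "v \<in> tangent_space A p"
    then obtain V y u where V: "(V, y) \<in> A" "p \<in> V" and v: "v = coord_vector A V y u p"
      unfolding tangent_space_def coord_vector_def by blast
    let ?t = "x \<circ> inv_into V y"
    have t: "(?t has_derivative frechet_derivative ?t (at (y p))) (at (y p))"
      by (rule smooth_on_has_derivative[OF transition_smooth[OF V(1) U(1)]]) (use U V in auto)
    have "coord_vector A V y u p f = coord_vector A U x (frechet_derivative ?t (at (y p)) u) p f" for f
    proof (cases "smooth_near A p f")
      case True
      have "?t (y p) = x p" using chart_inv[OF V] by simp
      then have "((\<lambda>z. (f \<circ> inv_into U x) (?t z)) has_derivative
          (\<lambda>u. frechet_derivative (f \<circ> inv_into U x) (at (x p)) (frechet_derivative ?t (at (y p)) u)))
          (at (y p))"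
        using has_derivative_compose[OF t] smooth_near_has_derivative[OF True U] by metis
      then have "((f \<circ> inv_into V y) has_derivative
          (\<lambda>u. frechet_derivative (f \<circ> inv_into U x) (at (x p)) (frechet_derivative ?t (at (y p)) u)))
          (at (y p))"
        by (rule has_derivative_transform_within_open[OF _ chart_image_open[OF V(1) chart_open[OF U(1)]]])
          (use U V in \<open>auto simp: chart_inv[OF V(1)] chart_inv[OF U(1)]\<close>)
      from coord_vector_derivative[OF True V this] coord_vector_smooth[OF True] show ?thesis by metis
    qed (simp add: coord_vector_not_smooth)
    then show "v \<in> range (\<lambda>u. coord_vector A U x u p)" unfolding v by blast
  qed
qed

lemma tangentE:
  assumes "v \<in> tangent_space A p" "(U, x) \<in> A" "p \<in> U"
  obtains u where "v = coord_vector A U x u p"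
  using assms tangent_space_eq by auto

lemma subspace_tangent_space: "subspace (tangent_space A p)"
proof -
  obtain U x where U: "(U, x) \<in> A" "p \<in> U" by (rule chartE)
  show ?thesis
    unfolding tangent_space_eq[OF U]
    by (rule linear_subspace_image[OF coord_vector_linear[OF U] subspace_UNIV])
qed

lemma tangent_not_smooth: "v \<in> tangent_space A p \<Longrightarrow> \<not> smooth_near A p f \<Longrightarrow> v f = 0"
  unfolding tangent_space_def by auto

text \<open>For smooth germs this is locality of the derivative in a chart; for the others both
  sides are 0 by the normalisation of tangent vectors.\<close>

lemma tangent_local:
  assumes v: "v \<in> tangent_space A p" and W: "open W" "p \<in> W" "\<And>q. q \<in> W \<Longrightarrow> f q = g q"
  shows "v f = v g"
proof (cases "smooth_near A p f")
  case True
  have "smooth_near A p f \<longleftrightarrow> smooth_near A p g"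
    by (rule smooth_near_cong[OF W(1,2)]) (rule W(3))
  then have g: "smooth_near A p g" using True by simp
  obtain U x where U: "(U, x) \<in> A" "p \<in> U" by (rule chartE)
  obtain u where u: "v = coord_vector A U x u p" using tangentE[OF v U] .
  have "((g \<circ> inv_into U x) has_derivative frechet_derivative (f \<circ> inv_into U x) (at (x p))) (at (x p))"
    by (rule has_derivative_transform_within_open[OF smooth_near_has_derivative[OF True U]
          chart_image_open[OF U(1) W(1)]])
      (use U W in \<open>auto simp: chart_inv[OF U(1)]\<close>)
  from coord_vector_derivative[OF g U this] coord_vector_smooth[OF True] u show ?thesis by metis
next
  case False
  have "smooth_near A p f \<longleftrightarrow> smooth_near A p g"
    by (rule smooth_near_cong[OF W(1,2)]) (rule W(3))
  then have "\<not> smooth_near A p g" using False by simp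
  then show ?thesis using False tangent_not_smooth[OF v] by simp
qed

lemma tangent_add:
  assumes v: "v \<in> tangent_space A p" and "smooth_near A p f" "smooth_near A p g"
  shows "v (\<lambda>q. f q + g q) = v f + v g"
proof -
  obtain U x where U: "(U, x) \<in> A" "p \<in> U" by (rule chartE)
  obtain u where u: "v = coord_vector A U x u p" using tangentE[OF v U] .
  note d = smooth_near_has_derivative[OF assms(2) U] smooth_near_has_derivative[OF assms(3) U]
  have "coord_vector A U x u p (\<lambda>q. f q + g q) =
      frechet_derivative (f \<circ> inv_into U x) (at (x p)) u + frechet_derivative (g \<circ> inv_into U x) (at (x p)) u"
    by (rule coord_vector_derivative[OF smooth_near_add[OF assms(2,3)] U])
      (use has_derivative_add[OF d] in \<open>simp add: o_def\<close>)
  then show ?thesis by (simp add: u coord_vector_smooth assms)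
qed

lemma tangent_mult:
  assumes v: "v \<in> tangent_space A p" and "smooth_near A p f" "smooth_near A p g"
  shows "v (\<lambda>q. f q * g q) = v f * g p + f p * v g"
proof -
  obtain U x where U: "(U, x) \<in> A" "p \<in> U" by (rule chartE)
  obtain u where u: "v = coord_vector A U x u p" using tangentE[OF v U] .
  note d = smooth_near_has_derivative[OF assms(2) U] smooth_near_has_derivative[OF assms(3) U]
  have "coord_vector A U x u p (\<lambda>q. f q * g q) =
      f p * frechet_derivative (g \<circ> inv_into U x) (at (x p)) u + frechet_derivative (f \<circ> inv_into U x) (at (x p)) u * g p"
    by (rule coord_vector_derivative[OF smooth_near_mult[OF assms(2,3)] U])
      (use has_derivative_mult[OF d] chart_inv[OF U] in \<open>simp add: o_def\<close>)
  then show ?thesis by (simp add: u coord_vector_smooth assms)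
qed

lemma tangent_const: assumes v: "v \<in> tangent_space A p" shows "v (\<lambda>q. c) = 0"
proof -
  obtain U x where U: "(U, x) \<in> A" "p \<in> U" by (rule chartE)
  obtain u where u: "v = coord_vector A U x u p" using tangentE[OF v U] .
  show ?thesis by (simp add: u coord_vector_smooth smooth_near_const o_def)
qed

lemma tangent_sum:
  assumes v: "v \<in> tangent_space A p" and "\<And>i. i \<in> I \<Longrightarrow> smooth_near A p (f i)"
  shows "v (\<lambda>q. \<Sum>i\<in>I. f i q) = (\<Sum>i\<in>I. v (f i))"
  using assms(2)
  by (induction I rule: infinite_finite_induct)
    (auto simp: tangent_const[OF v] tangent_add[OF v] smooth_near_sum)

lemma tangent_chain:
  assumes v: "v \<in> tangent_space A p" and f: "smooth_near A p f"
    and "smooth_near A p (\<lambda>q. \<phi> (f q))" and \<phi>: "(\<phi> has_real_derivative c) (at (f p))"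
  shows "v (\<lambda>q. \<phi> (f q)) = c * v f"
proof -
  obtain U x where U: "(U, x) \<in> A" "p \<in> U" by (rule chartE)
  obtain u where u: "v = coord_vector A U x u p" using tangentE[OF v U] .
  have \<phi>': "(\<phi> has_derivative (*) c) (at ((f \<circ> inv_into U x) (x p)))"
    using \<phi> chart_inv[OF U] by (simp add: has_field_derivative_def)
  have "coord_vector A U x u p (\<lambda>q. \<phi> (f q)) = c * frechet_derivative (f \<circ> inv_into U x) (at (x p)) u"
    by (rule coord_vector_derivative[OF assms(3) U])
      (use has_derivative_compose[OF smooth_near_has_derivative[OF f U] \<phi>'] in \<open>simp add: o_def\<close>)
  then show ?thesis by (simp add: u coord_vector_smooth f)
qed

lemma coord_vector_coord:
  assumes U: "(U, x) \<in> A" "p \<in> U"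
  shows "coord_vector A U x u p (\<lambda>q. x q \<bullet> k) = u \<bullet> k"
proof (rule coord_vector_derivative[OF smooth_nearI[OF smooth_fun_on_coord[OF U(1)] U(2)] U])
  have "((\<lambda>z. z \<bullet> k) has_derivative (\<lambda>u. u \<bullet> k)) (at (x p))"
    by (auto intro!: derivative_eq_intros)
  then show "((\<lambda>q. x q \<bullet> k) \<circ> inv_into U x has_derivative (\<lambda>u. u \<bullet> k)) (at (x p))"
    by (rule has_derivative_transform_within_open[OF _ chart_image_open[OF U(1) open_UNIV]])
      (use U in \<open>auto simp: chart_inv[OF U(1)]\<close>)
qed

lemma coord_vector_eq_0_iff:
  assumes U: "(U, x) \<in> A" "p \<in> U"
  shows "coord_vector A U x u p = 0 \<longleftrightarrow> u = 0"
proof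
  assume "coord_vector A U x u p = 0"
  then have "u \<bullet> k = 0" for k using coord_vector_coord[OF U, of u k] by simp
  then show "u = 0" using inner_eq_zero_iff by blast
qed (use linear_0[OF coord_vector_linear[OF U]] in simp)

lemma tangent_expand:
  assumes U: "(U, x) \<in> A" "p \<in> U" and v: "v \<in> tangent_space A p"
  shows "v = (\<Sum>k\<in>Basis. v (\<lambda>q. x q \<bullet> k) *\<^sub>R coord_vector A U x k p)"
proof -
  obtain u where u: "v = coord_vector A U x u p" using tangentE[OF v U] .
  note l = coord_vector_linear[OF U]
  have "v = coord_vector A U x (\<Sum>k\<in>Basis. (u \<bullet> k) *\<^sub>R k) p" by (simp add: euclidean_representation u)
  also have "\<dots> = (\<Sum>k\<in>Basis. (u \<bullet> k) *\<^sub>R coord_vector A U x k p)"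
    by (simp add: linear_sum[OF l] linear_scale[OF l])
  finally show ?thesis unfolding u coord_vector_coord[OF U] .
qed

text \<open>The bound on the size of a spanning set is what later turns a large enough orthonormal
  family into a basis.\<close>

lemma tangent_space_span:
  "\<exists>B. finite B \<and> card B \<le> DIM('e) \<and> tangent_space A p = span B"
proof -
  obtain U x where U: "(U, x) \<in> A" "p \<in> U" by (rule chartE)
  have "tangent_space A p = (\<lambda>u. coord_vector A U x u p) ` span Basis"
    by (simp add: tangent_space_eq[OF U])
  also have "\<dots> = span ((\<lambda>u. coord_vector A U x u p) ` Basis)"
    by (rule linear_span_image[OF coord_vector_linear[OF U], symmetric])
  finally show ?thesis by (metis card_image_le finite_Basis finite_imageI)
qed

section \<open>Vector fields and commuting coordinate fields\<close>

lemma vector_field_onD: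
  assumes "vector_field_on A U X"
  shows "open U" "\<And>p. p \<in> U \<Longrightarrow> X p \<in> tangent_space A p"
    "\<And>W f. W \<subseteq> U \<Longrightarrow> smooth_fun_on A W f \<Longrightarrow> smooth_fun_on A W (\<lambda>p. X p f)"
  using assms by (auto simp: vector_field_on_def)

lemma vector_field_on_coord_vector:
  assumes U: "(U, x) \<in> A"
  shows "vector_field_on A U (coord_vector A U x u)"
  unfolding vector_field_on_def
proof (intro conjI ballI allI impI chart_open[OF U] coord_vector_in_tangent_space[OF U])
  fix W f assume W: "W \<subseteq> U" and f: "smooth_fun_on A W f"
  let ?h = "f \<circ> inv_into U x"
  show "smooth_fun_on A W (\<lambda>p. coord_vector A U x u p f)"
  proof (rule smooth_fun_onI)
    fix p assume p: "p \<in> W"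
    have "smooth_on (x ` (U \<inter> W)) (\<lambda>z. frechet_derivative ?h (at z) u)"
      by (rule smooth_on_frechet_derivative[OF smooth_fun_onD[OF f U]])
    then have "smooth_on (x ` (U \<inter> W)) ((\<lambda>p. coord_vector A U x u p f) \<circ> inv_into U x)"
      by (rule smooth_on_cong)
        (auto simp: chart_inv[OF U] coord_vector_smooth[OF smooth_nearI[OF f]])
    then show "\<exists>U' x' W'. (U', x') \<in> A \<and> p \<in> U' \<and> p \<in> W' \<and> W' \<subseteq> W \<and> open W' \<and>
        smooth_on (x' ` (U' \<inter> W')) ((\<lambda>p. coord_vector A U x u p f) \<circ> inv_into U' x')"
      using p W U smooth_fun_on_open[OF f] by blast
  qed
qed

text \<open>In the chart both sides are second directional derivatives of the coordinate expression
  of f, and these are symmetric.\<close>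

lemma coord_vector_commute:
  assumes U: "(U, x) \<in> A" "p \<in> U" and f: "smooth_near A p f"
  shows "coord_vector A U x u p (\<lambda>q. coord_vector A U x v q f) =
         coord_vector A U x v p (\<lambda>q. coord_vector A U x u q f)"
proof -
  let ?h = "f \<circ> inv_into U x"
  obtain W where W: "p \<in> W" "smooth_fun_on A W f" using f by (auto simp: smooth_near_def)
  have UW: "smooth_fun_on A (U \<inter> W) f"
    by (rule smooth_fun_on_subset[OF W(2)]) (use smooth_fun_on_open[OF W(2)] chart_open[OF U(1)] in auto)
  have s: "smooth_on (x ` (U \<inter> W)) ?h" using smooth_fun_onD[OF W(2) U(1)] .
  have "coord_vector A U x u p (\<lambda>q. coord_vector A U x v q f) =
      frechet_derivative (\<lambda>z. frechet_derivative ?h (at z) v) (at (x p)) u" for u v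
  proof (rule coord_vector_derivative[OF _ U])
    show "smooth_near A p (\<lambda>q. coord_vector A U x v q f)"
      by (rule smooth_nearI[OF vector_field_onD(3)[OF vector_field_on_coord_vector[OF U(1)] _ UW]])
        (use U W in auto)
    have "((\<lambda>z. frechet_derivative ?h (at z) v) has_derivative
        frechet_derivative (\<lambda>z. frechet_derivative ?h (at z) v) (at (x p))) (at (x p))"
      by (rule smooth_on_has_derivative[OF smooth_on_frechet_derivative[OF s]]) (use U W in auto)
    then show "((\<lambda>q. coord_vector A U x v q f) \<circ> inv_into U x has_derivative
        frechet_derivative (\<lambda>z. frechet_derivative ?h (at z) v) (at (x p))) (at (x p))"
      by (rule has_derivative_transform_within_open[OF _ smooth_on_open[OF s]])
        (use U W in \<open>auto simp: chart_inv[OF U(1)] coord_vector_smooth[OF smooth_nearI[OF W(2)]]\<close>)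
  qed
  then show ?thesis using second_derivative_symmetric[OF s] U W by auto
qed

lemma lie_bracket_coord_vector:
  assumes U: "(U, x) \<in> A" "p \<in> U"
  shows "lie_bracket A (coord_vector A U x u) (coord_vector A U x v) p = 0"
  using coord_vector_commute[OF U] by (auto simp: lie_bracket_def fun_eq_iff)

end

section \<open>Fields along smooth maps\<close>

lemma linear_on_spaceD:
  assumes "linear_on_space S L" "u \<in> S" "v \<in> S" "subspace S"
  shows "L (u + v) = L u + L v" "L (c *\<^sub>R u) = c *\<^sub>R L u" "L (u - v) = L u - L v" "L (- u) = - L u" "L 0 = 0"
proof -
  have *: "L (a *\<^sub>R u + b *\<^sub>R v) = a *\<^sub>R L u + b *\<^sub>R L v" for a b
    using assms by (auto simp: linear_on_space_def)
  show "L (u + v) = L u + L v" using *[of 1 1] by simp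
  show "L (c *\<^sub>R u) = c *\<^sub>R L u" using *[of c 0] by simp
  show "L (u - v) = L u - L v" using *[of 1 "-1"] by simp
  show "L (- u) = - L u" using *[of "-1" 0] by simp
  show "L 0 = 0" using *[of 0 0] by simp
qed

lemma linear_on_space_sum:
  assumes "linear_on_space S L" "subspace S" "\<And>i. i \<in> I \<Longrightarrow> v i \<in> S"
  shows "L (\<Sum>i\<in>I. c i *\<^sub>R v i) = (\<Sum>i\<in>I. c i *\<^sub>R L (v i))"
proof (cases "finite I")
  case True
  then show ?thesis using assms(3)
  proof (induction I)
    case empty
    show ?case using linear_on_spaceD(5)[OF assms(1) _ _ assms(2)] subspace_0[OF assms(2)] by simp
  next
    case (insert i I)
    have "(\<Sum>i\<in>I. c i *\<^sub>R v i) \<in> S" "c i *\<^sub>R v i \<in> S"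
      by (auto intro!: subspace_sum[OF assms(2)] subspace_scale[OF assms(2)] insert)
    with insert show ?case
      by (simp add: linear_on_spaceD(1)[OF assms(1) _ _ assms(2)]
          linear_on_spaceD(2)[OF assms(1) _ _ assms(2), of "v i" "v i"])
  qed
next
  case False
  then show ?thesis
    using linear_on_spaceD(5)[OF assms(1) _ _ assms(2)] subspace_0[OF assms(2)] by simp
qed

lemma (in manifold) vector_field_on_subset:
  "vector_field_on A U X \<Longrightarrow> open V \<Longrightarrow> V \<subseteq> U \<Longrightarrow> vector_field_on A V X"
  unfolding vector_field_on_def by blast

locale smooth_map_between =
  M: manifold A + N: manifold A'
  for A :: "('p::{t2_space, second_countable_topology}, 'e::euclidean_space) chart set"
    and A' :: "('q::{t2_space, second_countable_topology}, 'd::euclidean_space) chart set" +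
  fixes F :: "'p \<Rightarrow> 'q"
  assumes smooth_map: "smooth_map A A' F"
begin

lemma open_vimage: "open W \<Longrightarrow> open (F -` W)"
  using smooth_map by (simp add: smooth_map_def continuous_on_open_vimage)

lemma smooth_in_charts:
  "(U, x) \<in> A \<Longrightarrow> (V, y) \<in> A' \<Longrightarrow> smooth_on (x ` (U \<inter> F -` V)) (y \<circ> F \<circ> inv_into U x)"
  using smooth_map by (auto simp: smooth_map_def)

lemma smooth_fun_on_pullback:
  assumes f: "smooth_fun_on A' W f"
  shows "smooth_fun_on A (F -` W) (\<lambda>p. f (F p))"
proof (rule M.smooth_fun_onI)
  fix p assume p: "p \<in> F -` W"
  obtain U x where U: "(U, x) \<in> A" "p \<in> U" by (rule M.chartE)
  obtain V y where V: "(V, y) \<in> A'" "F p \<in> V" by (rule N.chartE)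
  let ?W = "F -` (V \<inter> W)"
  have o: "open ?W"
    using open_vimage N.chart_open[OF V(1)] N.smooth_fun_on_open[OF f] by blast
  have "smooth_on (x ` (U \<inter> ?W)) (y \<circ> F \<circ> inv_into U x)"
    by (rule smooth_on_subset[OF smooth_in_charts[OF U(1) V(1)] M.chart_image_open[OF U(1) o]]) auto
  then have "smooth_on (x ` (U \<inter> ?W)) (\<lambda>z. (f \<circ> inv_into V y) ((y \<circ> F \<circ> inv_into U x) z))"
    by (rule smooth_on_compose[OF N.smooth_fun_onD[OF f V(1)]]) (auto simp: M.chart_inv[OF U(1)])
  then have "smooth_on (x ` (U \<inter> ?W)) ((\<lambda>p. f (F p)) \<circ> inv_into U x)"
    by (rule smooth_on_cong) (auto simp: M.chart_inv[OF U(1)] N.chart_inv[OF V(1)])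
  then show "\<exists>U x W'. (U, x) \<in> A \<and> p \<in> U \<and> p \<in> W' \<and> W' \<subseteq> F -` W \<and> open W' \<and>
      smooth_on (x ` (U \<inter> W')) ((\<lambda>p. f (F p)) \<circ> inv_into U x)"
    using U V p o by (intro exI[of _ U] exI[of _ x] exI[of _ ?W]) auto
qed

lemma smooth_near_pullback:
  assumes "smooth_near A' (F p) f"
  shows "smooth_near A p (\<lambda>p. f (F p))"
proof -
  obtain W where "F p \<in> W" "smooth_fun_on A' W f" using assms by (auto simp: smooth_near_def)
  then show ?thesis using smooth_fun_on_pullback by (auto simp: smooth_near_def)
qed

lemma differential_smooth:
  "smooth_near A' (F p) f \<Longrightarrow> differential A' F p v f = v (\<lambda>q. f (F q))"
  by (simp add: differential_def o_def)

lemma differential_linear: "linear (differential A' F p)"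
  by (rule linearI) (auto simp: differential_def fun_eq_iff)

text \<open>In charts around \<open>p\<close> and \<open>F p\<close> the image is the coordinate
  vector whose direction is the derivative of the coordinate expression of \<open>F\<close> applied
  to that of \<open>v\<close>.\<close>

lemma differential_in_tangent_space:
  assumes v: "v \<in> tangent_space A p"
  shows "differential A' F p v \<in> tangent_space A' (F p)"
proof -
  obtain U x where U: "(U, x) \<in> A" "p \<in> U" by (rule M.chartE)
  obtain V y where V: "(V, y) \<in> A'" "F p \<in> V" by (rule N.chartE)
  obtain u where u: "v = coord_vector A U x u p" using M.tangentE[OF v U] .
  let ?F = "y \<circ> F \<circ> inv_into U x"
  have F': "(?F has_derivative frechet_derivative ?F (at (x p))) (at (x p))"
    by (rule smooth_on_has_derivative[OF smooth_in_charts[OF U(1) V(1)]]) (use U V in auto)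
  have "differential A' F p v f = coord_vector A' V y (frechet_derivative ?F (at (x p)) u) (F p) f" for f
  proof (cases "smooth_near A' (F p) f")
    case True
    let ?f = "f \<circ> inv_into V y"
    have "?F (x p) = y (F p)" using M.chart_inv[OF U] by simp
    then have "((\<lambda>z. ?f (?F z)) has_derivative
        (\<lambda>u. frechet_derivative ?f (at (y (F p))) (frechet_derivative ?F (at (x p)) u))) (at (x p))"
      using has_derivative_compose[OF F', of ?f] N.smooth_near_has_derivative[OF True V] by simp
    then have "((\<lambda>q. f (F q)) \<circ> inv_into U x has_derivative
        (\<lambda>u. frechet_derivative ?f (at (y (F p))) (frechet_derivative ?F (at (x p)) u))) (at (x p))"
      by (rule has_derivative_transform_within_open[OF _
            M.chart_image_open[OF U(1) open_vimage[OF N.chart_open[OF V(1)]]]])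
        (use U V in \<open>auto simp: M.chart_inv[OF U(1)] N.chart_inv[OF V(1)]\<close>)
    from M.coord_vector_derivative[OF smooth_near_pullback[OF True] U this]
    show ?thesis by (simp add: differential_smooth[OF True] N.coord_vector_smooth[OF True] u)
  qed (simp add: differential_def N.coord_vector_not_smooth)
  then have "differential A' F p v = coord_vector A' V y (frechet_derivative ?F (at (x p)) u) (F p)"
    by blast
  then show ?thesis using N.coord_vector_in_tangent_space[OF V] by simp
qed

section \<open>Fields along a map\<close>

lemma field_alongD:
  assumes "field_along A A' F U V"
  shows "open U" "\<And>p. p \<in> U \<Longrightarrow> V p \<in> tangent_space A' (F p)"
    "\<And>W f. smooth_fun_on A' W f \<Longrightarrow> smooth_fun_on A (U \<inter> F -` W) (\<lambda>p. V p f)"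
  using assms by (auto simp: field_along_def)

lemma field_along_subset:
  assumes "field_along A A' F U V" "open U'" "U' \<subseteq> U"
  shows "field_along A A' F U' V"
  unfolding field_along_def
proof (intro conjI ballI allI impI assms(2))
  show "V p \<in> tangent_space A' (F p)" if "p \<in> U'" for p using field_alongD[OF assms(1)] assms(3) that by blast
  fix W f assume f: "smooth_fun_on A' W f"
  show "smooth_fun_on A (U' \<inter> F -` W) (\<lambda>p. V p f)"
    by (rule M.smooth_fun_on_subset[OF field_alongD(3)[OF assms(1) f]])
      (use assms open_vimage[OF N.smooth_fun_on_open[OF f]] in auto)
qed

lemma field_along_local:
  assumes "\<And>p. p \<in> U \<Longrightarrow> \<exists>U'. p \<in> U' \<and> U' \<subseteq> U \<and> field_along A A' F U' V"
  shows "field_along A A' F U V"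
  unfolding field_along_def
proof (intro conjI ballI allI impI)
  show "open U" by (subst open_subopen) (meson assms field_alongD(1))
  show "V p \<in> tangent_space A' (F p)" if "p \<in> U" for p using assms[OF that] field_alongD(2) by blast
  fix W f assume f: "smooth_fun_on A' W f"
  show "smooth_fun_on A (U \<inter> F -` W) (\<lambda>p. V p f)"
  proof (rule M.smooth_fun_on_local)
    fix p assume p: "p \<in> U \<inter> F -` W"
    then obtain U' where U': "p \<in> U'" "U' \<subseteq> U" "field_along A A' F U' V" using assms by blast
    show "\<exists>W'. p \<in> W' \<and> W' \<subseteq> U \<inter> F -` W \<and> smooth_fun_on A W' (\<lambda>p. V p f)"
      by (rule exI[of _ "U' \<inter> F -` W"]) (use field_alongD(3)[OF U'(3) f] p U'(1,2) in auto)
  qed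
qed

lemma field_along_cong:
  assumes "field_along A A' F U V" "\<And>p. p \<in> U \<Longrightarrow> V p = V' p"
  shows "field_along A A' F U V'"
  unfolding field_along_def
proof (intro conjI ballI allI impI field_alongD(1)[OF assms(1)])
  show "V' p \<in> tangent_space A' (F p)" if "p \<in> U" for p
    using field_alongD(2)[OF assms(1) that] assms(2)[OF that] by simp
  fix W f assume f: "smooth_fun_on A' W f"
  show "smooth_fun_on A (U \<inter> F -` W) (\<lambda>p. V' p f)"
    by (rule M.smooth_fun_on_cong[OF field_alongD(3)[OF assms(1) f]]) (simp add: assms(2))
qed

lemma field_along_add:
  assumes "field_along A A' F U V" "field_along A A' F U V'"
  shows "field_along A A' F U (\<lambda>p. V p + V' p)"
  using assms subspace_add[OF N.subspace_tangent_space]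
  by (auto simp: field_along_def intro!: M.smooth_fun_on_add)

lemma field_along_scale:
  assumes "smooth_fun_on A U a" "field_along A A' F U V"
  shows "field_along A A' F U (\<lambda>p. a p *\<^sub>R V p)"
  unfolding field_along_def
proof (intro conjI ballI allI impI field_alongD(1)[OF assms(2)])
  show "a p *\<^sub>R V p \<in> tangent_space A' (F p)" if "p \<in> U" for p
    using field_alongD(2)[OF assms(2) that] subspace_scale[OF N.subspace_tangent_space] by blast
  fix W f assume f: "smooth_fun_on A' W f"
  have "open (U \<inter> F -` W)"
    using M.smooth_fun_on_open[OF field_alongD(3)[OF assms(2) f]] .
  then show "smooth_fun_on A (U \<inter> F -` W) (\<lambda>p. (a p *\<^sub>R V p) f)"
    using M.smooth_fun_on_mult[OF M.smooth_fun_on_subset[OF assms(1)] field_alongD(3)[OF assms(2) f]]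
    by simp
qed

lemma field_along_zero: "open U \<Longrightarrow> field_along A A' F U (\<lambda>p. 0)"
  unfolding field_along_def
  using subspace_0[OF N.subspace_tangent_space] open_vimage N.smooth_fun_on_open
  by (auto intro!: M.smooth_fun_on_const)

lemma field_along_sum:
  "open U \<Longrightarrow> (\<And>i. i \<in> I \<Longrightarrow> field_along A A' F U (V i)) \<Longrightarrow>
    field_along A A' F U (\<lambda>p. \<Sum>i\<in>I. V i p)"
  by (induction I rule: infinite_finite_induct) (auto intro: field_along_zero field_along_add)

lemma field_along_comp:
  assumes Y: "vector_field_on A' W Y"
  shows "field_along A A' F (F -` W) (\<lambda>p. Y (F p))"
  unfolding field_along_def
proof (intro conjI ballI allI impI)
  show "open (F -` W)" using open_vimage N.vector_field_onD(1)[OF Y] .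
  show "Y (F p) \<in> tangent_space A' (F p)" if "p \<in> F -` W" for p
    using N.vector_field_onD(2)[OF Y] that by auto
  fix W' f assume f: "smooth_fun_on A' W' f"
  have "smooth_fun_on A' (W \<inter> W') f"
    by (rule N.smooth_fun_on_subset[OF f])
      (use N.vector_field_onD(1)[OF Y] N.smooth_fun_on_open[OF f] in auto)
  from smooth_fun_on_pullback[OF N.vector_field_onD(3)[OF Y _ this]]
  show "smooth_fun_on A (F -` W \<inter> F -` W') (\<lambda>p. Y (F p) f)" by (simp add: vimage_Int)
qed

lemma field_along_differential:
  assumes X: "vector_field_on A U X"
  shows "field_along A A' F U (\<lambda>p. differential A' F p (X p))"
  unfolding field_along_def
proof (intro conjI ballI allI impI)
  show "open U" using M.vector_field_onD(1)[OF X] .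
  show "differential A' F p (X p) \<in> tangent_space A' (F p)" if "p \<in> U" for p
    using differential_in_tangent_space M.vector_field_onD(2)[OF X that] by blast
  fix W f assume f: "smooth_fun_on A' W f"
  have o: "open (U \<inter> F -` W)"
    using M.vector_field_onD(1)[OF X] open_vimage[OF N.smooth_fun_on_open[OF f]] by blast
  have "smooth_fun_on A (U \<inter> F -` W) (\<lambda>p. X p (\<lambda>q. f (F q)))"
    by (rule M.vector_field_onD(3)[OF X]) (use M.smooth_fun_on_subset[OF smooth_fun_on_pullback[OF f] o] in auto)
  then show "smooth_fun_on A (U \<inter> F -` W) (\<lambda>p. differential A' F p (X p) f)"
    by (rule M.smooth_fun_on_cong) (use differential_smooth N.smooth_nearI[OF f] in auto)
qed

lemma field_along_components:
  assumes V: "field_along A A' F U V" and W: "(W, y) \<in> A'"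
  shows "smooth_fun_on A (U \<inter> F -` W) (\<lambda>p. V p (\<lambda>q. y q \<bullet> k))"
    and "p \<in> U \<inter> F -` W \<Longrightarrow>
      V p = (\<Sum>k\<in>Basis. V p (\<lambda>q. y q \<bullet> k) *\<^sub>R coord_vector A' W y k (F p))"
proof -
  show "smooth_fun_on A (U \<inter> F -` W) (\<lambda>p. V p (\<lambda>q. y q \<bullet> k))"
    by (rule field_alongD(3)[OF V N.smooth_fun_on_coord[OF W]])
  show "V p = (\<Sum>k\<in>Basis. V p (\<lambda>q. y q \<bullet> k) *\<^sub>R coord_vector A' W y k (F p))" if "p \<in> U \<inter> F -` W"
    by (rule N.tangent_expand[OF W _ field_alongD(2)[OF V]]) (use that in auto)
qed

lemma field_along_coord:
  "(W, y) \<in> A' \<Longrightarrow> field_along A A' F (F -` W) (\<lambda>p. coord_vector A' W y k (F p))"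
  by (rule field_along_comp[OF N.vector_field_on_coord_vector])

text \<open>Smoothness of \<phi> is given for ambient fields only, and \<open>V\<close> need not be
  the restriction of one. Locally \<open>V\<close> is a combination of restricted coordinate fields
  with smooth coefficients, and fibrewise linearity moves \<phi> onto those.\<close>

lemma field_along_tensor:
  assumes V: "field_along A A' F U V"
    and lin: "\<And>p. linear_on_space (tangent_space A' p) (\<phi> p)"
    and smooth: "\<And>W Y. vector_field_on A' W Y \<Longrightarrow> vector_field_on A' W (\<lambda>p. \<phi> p (Y p))"
  shows "field_along A A' F U (\<lambda>p. \<phi> (F p) (V p))"
proof (rule field_along_local)
  fix p assume p: "p \<in> U"
  obtain W y where W: "(W, y) \<in> A'" "F p \<in> W" by (rule N.chartE)
  have o: "open (U \<inter> F -` W)"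
    using field_alongD(1)[OF V] open_vimage[OF N.chart_open[OF W(1)]] by blast
  have "field_along A A' F (U \<inter> F -` W)
      (\<lambda>p. \<Sum>k\<in>Basis. V p (\<lambda>q. y q \<bullet> k) *\<^sub>R \<phi> (F p) (coord_vector A' W y k (F p)))"
    by (intro field_along_sum o field_along_scale field_along_components(1)[OF V W(1)]
        field_along_subset[OF field_along_comp[OF smooth[OF N.vector_field_on_coord_vector[OF W(1)]]] o])
      auto
  then have "field_along A A' F (U \<inter> F -` W) (\<lambda>p. \<phi> (F p) (V p))"
  proof (rule field_along_cong)
    fix q assume q: "q \<in> U \<inter> F -` W"
    have "\<phi> (F q) (V q) = \<phi> (F q) (\<Sum>k\<in>Basis. V q (\<lambda>q. y q \<bullet> k) *\<^sub>R coord_vector A' W y k (F q))"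
      using field_along_components(2)[OF V W(1) q] by simp
    also have "\<dots> = (\<Sum>k\<in>Basis. V q (\<lambda>q. y q \<bullet> k) *\<^sub>R \<phi> (F q) (coord_vector A' W y k (F q)))"
      by (rule linear_on_space_sum[OF lin N.subspace_tangent_space])
        (use q N.coord_vector_in_tangent_space[OF W(1)] in auto)
    finally show "(\<Sum>k\<in>Basis. V q (\<lambda>q. y q \<bullet> k) *\<^sub>R \<phi> (F q) (coord_vector A' W y k (F q))) =
        \<phi> (F q) (V q)" by simp
  qed
  then show "\<exists>U'. p \<in> U' \<and> U' \<subseteq> U \<and> field_along A A' F U' (\<lambda>p. \<phi> (F p) (V p))"
    by (intro exI[of _ "U \<inter> F -` W"]) (use p W in simp)
qed

text \<open>The extra argument p of \<alpha> leaves room for a second field along the map, so that a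
  bilinear form can be treated one slot at a time.\<close>

lemma smooth_fun_on_tensor:
  fixes \<alpha> :: "'q \<Rightarrow> 'q tangent \<Rightarrow> 'p \<Rightarrow> real"
  assumes V: "field_along A A' F U V"
    and lin: "\<And>p. p \<in> U \<Longrightarrow> linear_on_space (tangent_space A' (F p)) (\<lambda>v. \<alpha> (F p) v p)"
    and smooth: "\<And>W Y. vector_field_on A' W Y \<Longrightarrow>
      smooth_fun_on A (U \<inter> F -` W) (\<lambda>p. \<alpha> (F p) (Y (F p)) p)"
  shows "smooth_fun_on A U (\<lambda>p. \<alpha> (F p) (V p) p)"
proof (rule M.smooth_fun_on_local)
  fix p assume p: "p \<in> U"
  obtain W y where W: "(W, y) \<in> A'" "F p \<in> W" by (rule N.chartE)
  have o: "open (U \<inter> F -` W)"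
    using field_alongD(1)[OF V] open_vimage[OF N.chart_open[OF W(1)]] by blast
  have "smooth_fun_on A (U \<inter> F -` W)
      (\<lambda>p. \<Sum>k\<in>Basis. V p (\<lambda>q. y q \<bullet> k) * \<alpha> (F p) (coord_vector A' W y k (F p)) p)"
    by (intro M.smooth_fun_on_sum o M.smooth_fun_on_mult field_along_components(1)[OF V W(1)]
        smooth[OF N.vector_field_on_coord_vector[OF W(1)]])
  then have "smooth_fun_on A (U \<inter> F -` W) (\<lambda>p. \<alpha> (F p) (V p) p)"
  proof (rule M.smooth_fun_on_cong)
    fix q assume q: "q \<in> U \<inter> F -` W"
    have "\<alpha> (F q) (V q) q = \<alpha> (F q) (\<Sum>k\<in>Basis. V q (\<lambda>q. y q \<bullet> k) *\<^sub>R coord_vector A' W y k (F q)) q"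
      using field_along_components(2)[OF V W(1) q] by simp
    also have "\<dots> = (\<Sum>k\<in>Basis. V q (\<lambda>q. y q \<bullet> k) *\<^sub>R \<alpha> (F q) (coord_vector A' W y k (F q)) q)"
      by (rule linear_on_space_sum[OF lin N.subspace_tangent_space])
        (use q N.coord_vector_in_tangent_space[OF W(1)] in auto)
    finally show "(\<Sum>k\<in>Basis. V q (\<lambda>q. y q \<bullet> k) * \<alpha> (F q) (coord_vector A' W y k (F q)) q) =
        \<alpha> (F q) (V q) q" by simp
  qed
  then show "\<exists>W'. p \<in> W' \<and> W' \<subseteq> U \<and> smooth_fun_on A W' (\<lambda>p. \<alpha> (F p) (V p) p)"
    by (intro exI[of _ "U \<inter> F -` W"]) (use p W in simp)
qed

end

lemma riemannian_metricD:
  assumes g: "riemannian_metric A g"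
  shows "u \<in> tangent_space A p \<Longrightarrow> v \<in> tangent_space A p \<Longrightarrow> g p u v = g p v u"
    and "v \<in> tangent_space A p \<Longrightarrow> linear_on_space (tangent_space A p) (\<lambda>u. g p u v)"
    and "v \<in> tangent_space A p \<Longrightarrow> v \<noteq> 0 \<Longrightarrow> g p v v > 0"
    and "vector_field_on A U X \<Longrightarrow> vector_field_on A U Y \<Longrightarrow>
      smooth_fun_on A U (\<lambda>p. g p (X p) (Y p))"
  using assms unfolding riemannian_metric_def by blast+

lemma (in manifold) riemannian_metric_linear_right:
  assumes g: "riemannian_metric A g" and u: "u \<in> tangent_space A p"
  shows "linear_on_space (tangent_space A p) (g p u)"
  unfolding linear_on_space_def
proof (intro ballI allI)
  fix v w a b assume vw: "v \<in> tangent_space A p" "w \<in> tangent_space A p"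
  then have "a *\<^sub>R v + b *\<^sub>R w \<in> tangent_space A p"
    by (simp add: subspace_add subspace_scale subspace_tangent_space)
  with vw show "g p u (a *\<^sub>R v + b *\<^sub>R w) = a *\<^sub>R g p u v + b *\<^sub>R g p u w"
    using riemannian_metricD(1)[OF g u] riemannian_metricD(2)[OF g u] by (simp add: linear_on_space_def)
qed

text \<open>Two applications of \<open>smooth_fun_on_tensor\<close>: the first replaces
  \<open>V\<close> by an ambient field, the second \<open>W\<close>; for two ambient fields the
  function is a pullback.\<close>

lemma (in smooth_map_between) smooth_fun_on_metric:
  assumes g: "riemannian_metric A' g"
    and V: "field_along A A' F U V" and W: "field_along A A' F U W"
  shows "smooth_fun_on A U (\<lambda>p. g (F p) (V p) (W p))"
proof (rule smooth_fun_on_tensor[OF V, where \<alpha> = "\<lambda>q v p. g q v (W p)"])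
  show "linear_on_space (tangent_space A' (F p)) (\<lambda>v. g (F p) v (W p))" if "p \<in> U" for p
    using riemannian_metricD(2)[OF g] field_alongD(2)[OF W that] by blast
  fix S Y assume Y: "vector_field_on A' S Y"
  have o: "open (U \<inter> F -` S)"
    using field_alongD(1)[OF V] open_vimage[OF N.vector_field_onD(1)[OF Y]] by blast
  show "smooth_fun_on A (U \<inter> F -` S) (\<lambda>p. g (F p) (Y (F p)) (W p))"
  proof (rule smooth_fun_on_tensor[OF field_along_subset[OF W o Int_lower1],
        where \<alpha> = "\<lambda>q v p. g q (Y q) v"])
    show "linear_on_space (tangent_space A' (F p)) (g (F p) (Y (F p)))" if "p \<in> U \<inter> F -` S" for p
      using N.riemannian_metric_linear_right[OF g N.vector_field_onD(2)[OF Y]] that by simp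
    fix T Z assume Z: "vector_field_on A' T Z"
    have oT: "open (S \<inter> T)" using N.vector_field_onD(1)[OF Y] N.vector_field_onD(1)[OF Z] by blast
    have "smooth_fun_on A (F -` (S \<inter> T)) (\<lambda>p. g (F p) (Y (F p)) (Z (F p)))"
      by (intro smooth_fun_on_pullback riemannian_metricD(4)[OF g]
          N.vector_field_on_subset[OF Y oT] N.vector_field_on_subset[OF Z oT]) auto
    then show "smooth_fun_on A (U \<inter> F -` S \<inter> F -` T) (\<lambda>p. g (F p) (Y (F p)) (Z (F p)))"
      by (rule M.smooth_fun_on_subset) (use o open_vimage[OF N.vector_field_onD(1)[OF Z]] in auto)
  qed
qed

section \<open>The pullback of the Levi-Civita connection\<close>

lemma affine_connectionD:
  assumes c: "affine_connection A nabla" and Y: "vector_field_near A p Y"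
  shows "x \<in> tangent_space A p \<Longrightarrow> nabla p x Y \<in> tangent_space A p"
    and "linear_on_space (tangent_space A p) (\<lambda>x. nabla p x Y)"
    and "smooth_near A p f \<Longrightarrow> x \<in> tangent_space A p \<Longrightarrow>
      nabla p x (\<lambda>q. f q *\<^sub>R Y q) = x f *\<^sub>R Y p + f p *\<^sub>R nabla p x Y"
proof -
  from c have "\<forall>p Y. vector_field_near A p Y \<longrightarrow>
        (\<forall>x\<in>tangent_space A p. nabla p x Y \<in> tangent_space A p) \<and>
        linear_on_space (tangent_space A p) (\<lambda>x. nabla p x Y)"
    unfolding affine_connection_def by (elim conjE)
  with Y show "x \<in> tangent_space A p \<Longrightarrow> nabla p x Y \<in> tangent_space A p"
    and "linear_on_space (tangent_space A p) (\<lambda>x. nabla p x Y)" by auto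
  from c have "\<forall>p f Y. smooth_near A p f \<longrightarrow> vector_field_near A p Y \<longrightarrow>
        (\<forall>x\<in>tangent_space A p.
           nabla p x (\<lambda>q. f q *\<^sub>R Y q) = x f *\<^sub>R Y p + f p *\<^sub>R nabla p x Y)"
    unfolding affine_connection_def by (elim conjE)
  with Y show "smooth_near A p f \<Longrightarrow> x \<in> tangent_space A p \<Longrightarrow>
      nabla p x (\<lambda>q. f q *\<^sub>R Y q) = x f *\<^sub>R Y p + f p *\<^sub>R nabla p x Y" by auto
qed

lemma levi_civitaD:
  assumes "levi_civita A g nabla"
  shows "affine_connection A nabla"
    and "vector_field_on A U X \<Longrightarrow> vector_field_on A U Y \<Longrightarrow> p \<in> U \<Longrightarrow>
      nabla p (X p) Y - nabla p (Y p) X = lie_bracket A X Y p"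
    and "vector_field_on A U Y \<Longrightarrow> vector_field_on A U Z \<Longrightarrow> p \<in> U \<Longrightarrow> x \<in> tangent_space A p \<Longrightarrow>
      x (\<lambda>q. g q (Y q) (Z q)) = g p (nabla p x Y) (Z p) + g p (Y p) (nabla p x Z)"
  using assms unfolding levi_civita_def by auto

locale pullback_levi_civita = smooth_map_between A A' F
  for A :: "('p::{t2_space, second_countable_topology}, 'e::euclidean_space) chart set"
    and A' :: "('q::{t2_space, second_countable_topology}, 'd::euclidean_space) chart set"
    and F :: "'p \<Rightarrow> 'q" +
  fixes g :: "'q metric" and nabla :: "'q conn"
    and D :: "'p \<Rightarrow> 'p tangent \<Rightarrow> ('p \<Rightarrow> 'q tangent) \<Rightarrow> 'q tangent"
  assumes metric: "riemannian_metric A' g"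
    and levi_civita: "levi_civita A' g nabla"
    and pullback: "pullback_connection A A' F nabla D"
begin

lemma g_symmetric:
  "u \<in> tangent_space A' q \<Longrightarrow> v \<in> tangent_space A' q \<Longrightarrow> g q u v = g q v u"
  by (rule riemannian_metricD(1)[OF metric])

lemma g_linear_left:
  "v \<in> tangent_space A' q \<Longrightarrow> linear_on_space (tangent_space A' q) (\<lambda>u. g q u v)"
  by (rule riemannian_metricD(2)[OF metric])

context
  fixes p x U
  assumes p: "p \<in> U" and x: "x \<in> tangent_space A p"
begin

lemma field_along_nearI: "field_along A A' F U V \<Longrightarrow> field_along_near A A' F p V"
  using p by (auto simp: field_along_near_def)

lemma D_in_tangent_space: "field_along A A' F U V \<Longrightarrow> D p x V \<in> tangent_space A' (F p)"
  and D_linear: "field_along A A' F U V \<Longrightarrow> linear_on_space (tangent_space A p) (\<lambda>x. D p x V)"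
  using pullback field_along_nearI x unfolding pullback_connection_def by blast+

lemma D_add:
  "field_along A A' F U V \<Longrightarrow> field_along A A' F U W \<Longrightarrow>
    D p x (\<lambda>q. V q + W q) = D p x V + D p x W"
  using pullback field_along_nearI[of V] field_along_nearI[of W] x
  unfolding pullback_connection_def by blast

lemma D_scale:
  "smooth_near A p a \<Longrightarrow> field_along A A' F U V \<Longrightarrow>
    D p x (\<lambda>q. a q *\<^sub>R V q) = x a *\<^sub>R V p + a p *\<^sub>R D p x V"
  using pullback field_along_nearI[of V] x unfolding pullback_connection_def by blast

lemma D_comp:
  "vector_field_on A' W Y \<Longrightarrow> F p \<in> W \<Longrightarrow> D p x (\<lambda>q. Y (F q)) = nabla (F p) (differential A' F p x) Y"
  using pullback x unfolding pullback_connection_def vector_field_near_def by blast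

text \<open>Locality: multiply both fields by the indicator function of \<open>U\<close>, which is smooth near \<open>p\<close>.\<close>

lemma D_local:
  assumes V: "field_along A A' F U V" and V': "field_along A A' F U V'"
    and eq: "\<And>q. q \<in> U \<Longrightarrow> V q = V' q"
  shows "D p x V = D p x V'"
proof -
  define a :: "'p \<Rightarrow> real" where "a = (\<lambda>q. if q \<in> U then 1 else 0)"
  have U: "open U" by (rule field_alongD(1)[OF V])
  have "smooth_fun_on A U a"
    by (rule M.smooth_fun_on_cong[OF M.smooth_fun_on_const[OF U]]) (simp add: a_def)
  then have a: "smooth_near A p a" using p M.smooth_nearI by blast
  have xa: "x a = 0"
    using M.tangent_local[OF x U p, of a "\<lambda>q. 1"] M.tangent_const[OF x] by (simp add: a_def)
  have "(\<lambda>q. a q *\<^sub>R V q) = (\<lambda>q. a q *\<^sub>R V' q)" using eq by (auto simp: a_def)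
  then show ?thesis
    using D_scale[OF a V] D_scale[OF a V'] xa p by (simp add: a_def)
qed

lemma D_zero: assumes "open U" shows "D p x (\<lambda>q. 0) = 0"
  using D_scale[OF M.smooth_near_const[of p 0] field_along_zero[OF assms]] M.tangent_const[OF x] by simp

lemma D_sum:
  assumes "open U" "\<And>i. i \<in> I \<Longrightarrow> smooth_fun_on A U (a i)" "\<And>i. i \<in> I \<Longrightarrow> field_along A A' F U (V i)"
  shows "D p x (\<lambda>q. \<Sum>i\<in>I. a i q *\<^sub>R V i q) = (\<Sum>i\<in>I. x (a i) *\<^sub>R V i p + a i p *\<^sub>R D p x (V i))"
  using assms(2,3)
proof (induction I rule: infinite_finite_induct)
  case (insert i I)
  have "D p x (\<lambda>q. a i q *\<^sub>R V i q + (\<Sum>i\<in>I. a i q *\<^sub>R V i q)) =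
      D p x (\<lambda>q. a i q *\<^sub>R V i q) + D p x (\<lambda>q. \<Sum>i\<in>I. a i q *\<^sub>R V i q)"
    by (intro D_add field_along_scale field_along_sum assms(1) insert.prems) auto
  moreover have "D p x (\<lambda>q. a i q *\<^sub>R V i q) = x (a i) *\<^sub>R V i p + a i p *\<^sub>R D p x (V i)"
    by (rule D_scale[OF M.smooth_nearI[OF insert.prems(1) p] insert.prems(2)]) simp_all
  moreover have "D p x (\<lambda>q. \<Sum>i\<in>I. a i q *\<^sub>R V i q) =
      (\<Sum>i\<in>I. x (a i) *\<^sub>R V i p + a i p *\<^sub>R D p x (V i))"
    by (rule insert.IH) (simp_all add: insert.prems)
  ultimately show ?case by (simp only: sum.insert[OF insert.hyps])
qed (use D_zero[OF assms(1)] in auto)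

text \<open>The product rule for one pair of fields, isolated as a predicate so that it can be
  propagated from coordinate frames to arbitrary fields.\<close>

definition compatible :: "('p \<Rightarrow> 'q tangent) \<Rightarrow> ('p \<Rightarrow> 'q tangent) \<Rightarrow> bool" where
  "compatible V W \<longleftrightarrow>
    x (\<lambda>q. g (F q) (V q) (W q)) = g (F p) (D p x V) (W p) + g (F p) (V p) (D p x W)"

lemma compatible_commute:
  assumes V: "field_along A A' F U V" and W: "field_along A A' F U W" and "compatible V W"
  shows "compatible W V"
proof -
  have "x (\<lambda>q. g (F q) (V q) (W q)) = x (\<lambda>q. g (F q) (W q) (V q))"
    by (rule M.tangent_local[OF x field_alongD(1)[OF V] p])
      (rule g_symmetric[OF field_alongD(2)[OF V] field_alongD(2)[OF W]])
  then show ?thesis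
    using assms(3) g_symmetric[OF D_in_tangent_space[OF V] field_alongD(2)[OF W p]]
      g_symmetric[OF field_alongD(2)[OF V p] D_in_tangent_space[OF W]]
    by (simp add: compatible_def)
qed

lemma compatible_local:
  assumes V: "field_along A A' F U V" and V': "field_along A A' F U V'"
    and eq: "\<And>q. q \<in> U \<Longrightarrow> V q = V' q" and "compatible V W"
  shows "compatible V' W"
proof -
  have "x (\<lambda>q. g (F q) (V q) (W q)) = x (\<lambda>q. g (F q) (V' q) (W q))"
    by (rule M.tangent_local[OF x field_alongD(1)[OF V] p]) (simp add: eq)
  then show ?thesis
    using assms(4) D_local[OF V V' eq] eq[OF p] by (simp add: compatible_def)
qed

text \<open>The derivatives of the coefficients enter both sides alike: through the product rule of
  \<open>x\<close> on the left and through the Leibniz rule of \<open>D\<close> on the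
  right.\<close>

lemma compatible_sum:
  assumes a: "\<And>i. i \<in> I \<Longrightarrow> smooth_fun_on A U (a i)"
    and V: "\<And>i. i \<in> I \<Longrightarrow> field_along A A' F U (V i)"
    and W: "field_along A A' F U W"
    and c: "\<And>i. i \<in> I \<Longrightarrow> compatible (V i) W"
  shows "compatible (\<lambda>q. \<Sum>i\<in>I. a i q *\<^sub>R V i q) W"
proof -
  have U: "open U" by (rule field_alongD(1)[OF W])
  note S = N.subspace_tangent_space
  have s: "smooth_near A p (\<lambda>q. g (F q) (V i q) (W q))" if "i \<in> I" for i
    by (rule M.smooth_nearI[OF smooth_fun_on_metric[OF metric V[OF that] W] p])
  note sa = M.smooth_nearI[OF a p]
  have DV: "D p x (V i) \<in> tangent_space A' (F p)" "V i p \<in> tangent_space A' (F p)" if "i \<in> I" for i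
    using D_in_tangent_space[OF V] field_alongD(2)[OF V p] that by auto
  have "x (\<lambda>q. g (F q) (\<Sum>i\<in>I. a i q *\<^sub>R V i q) (W q)) = x (\<lambda>q. \<Sum>i\<in>I. a i q * g (F q) (V i q) (W q))"
  proof (rule M.tangent_local[OF x U p])
    fix q assume "q \<in> U"
    then show "g (F q) (\<Sum>i\<in>I. a i q *\<^sub>R V i q) (W q) = (\<Sum>i\<in>I. a i q * g (F q) (V i q) (W q))"
      using linear_on_space_sum[OF g_linear_left[OF field_alongD(2)[OF W]] S,
          where c = "\<lambda>i. a i q" and v = "\<lambda>i. V i q" and I = I] field_alongD(2)[OF V] by simp
  qed
  also have "\<dots> = (\<Sum>i\<in>I. x (\<lambda>q. a i q * g (F q) (V i q) (W q)))"
    by (rule M.tangent_sum[OF x]) (auto intro: M.smooth_near_mult sa s)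
  also have "\<dots> = (\<Sum>i\<in>I. x (a i) * g (F p) (V i p) (W p) + a i p *
      (g (F p) (D p x (V i)) (W p) + g (F p) (V i p) (D p x W)))"
    using c by (intro sum.cong refl) (simp add: M.tangent_mult[OF x sa s] compatible_def)
  also have "\<dots> = ((\<Sum>i\<in>I. x (a i) *\<^sub>R g (F p) (V i p) (W p)) +
      (\<Sum>i\<in>I. a i p *\<^sub>R g (F p) (D p x (V i)) (W p))) +
      (\<Sum>i\<in>I. a i p *\<^sub>R g (F p) (V i p) (D p x W))"
    by (simp add: sum.distrib[symmetric] algebra_simps)
  also have "\<dots> = g (F p) (\<Sum>i\<in>I. x (a i) *\<^sub>R V i p) (W p) +
      g (F p) (\<Sum>i\<in>I. a i p *\<^sub>R D p x (V i)) (W p) + g (F p) (\<Sum>i\<in>I. a i p *\<^sub>R V i p) (D p x W)"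
    using linear_on_space_sum[OF g_linear_left[OF field_alongD(2)[OF W p]] S, of I "\<lambda>i. V i p"]
      linear_on_space_sum[OF g_linear_left[OF field_alongD(2)[OF W p]] S, of I "\<lambda>i. D p x (V i)"]
      linear_on_space_sum[OF g_linear_left[OF D_in_tangent_space[OF W]] S, of I "\<lambda>i. V i p"] DV
    by simp
  also have "g (F p) (\<Sum>i\<in>I. x (a i) *\<^sub>R V i p) (W p) + g (F p) (\<Sum>i\<in>I. a i p *\<^sub>R D p x (V i)) (W p) =
      g (F p) ((\<Sum>i\<in>I. x (a i) *\<^sub>R V i p) + (\<Sum>i\<in>I. a i p *\<^sub>R D p x (V i))) (W p)"
    by (rule linear_on_spaceD(1)[OF g_linear_left[OF field_alongD(2)[OF W p]] _ _ S, symmetric])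
      (auto intro!: subspace_sum[OF S] subspace_scale[OF S] DV)
  also have "(\<Sum>i\<in>I. x (a i) *\<^sub>R V i p) + (\<Sum>i\<in>I. a i p *\<^sub>R D p x (V i)) =
      D p x (\<lambda>q. \<Sum>i\<in>I. a i q *\<^sub>R V i q)"
    using D_sum[OF U a V, of I] by (simp add: sum.distrib)
  finally show ?thesis unfolding compatible_def .
qed

lemma compatible_comp:
  assumes Y: "vector_field_on A' W Y" and Z: "vector_field_on A' W Z" and W: "F p \<in> W"
  shows "compatible (\<lambda>q. Y (F q)) (\<lambda>q. Z (F q))"
proof -
  have "smooth_near A' (F p) (\<lambda>q. g q (Y q) (Z q))"
    by (rule N.smooth_nearI[OF riemannian_metricD(4)[OF metric Y Z] W])
  then have "x (\<lambda>q. g (F q) (Y (F q)) (Z (F q))) = differential A' F p x (\<lambda>q. g q (Y q) (Z q))"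
    by (simp add: differential_smooth)
  also have "\<dots> = g (F p) (nabla (F p) (differential A' F p x) Y) (Z (F p)) +
      g (F p) (Y (F p)) (nabla (F p) (differential A' F p x) Z)"
    by (rule levi_civitaD(3)[OF levi_civita Y Z W differential_in_tangent_space[OF x]])
  finally show ?thesis by (simp add: compatible_def D_comp[OF Y W] D_comp[OF Z W])
qed

end

text \<open>The axioms relate \<open>D\<close> to the ambient connection only on restricted ambient
  fields. There the rule is the one for \<open>nabla\<close>; it then spreads by expanding both
  fields in an ambient coordinate frame.\<close>

lemma metric_compatible:
  assumes p: "p \<in> U" and x: "x \<in> tangent_space A p"
    and V: "field_along A A' F U V" and W: "field_along A A' F U W"
  shows "x (\<lambda>q. g (F q) (V q) (W q)) = g (F p) (D p x V) (W p) + g (F p) (V p) (D p x W)"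
proof -
  obtain S y where S: "(S, y) \<in> A'" "F p \<in> S" by (rule N.chartE)
  let ?U = "U \<inter> F -` S"
  have p': "p \<in> ?U" using p S by simp
  have o: "open ?U"
    using field_alongD(1)[OF V] open_vimage[OF N.chart_open[OF S(1)]] by blast
  note V' = field_along_subset[OF V o Int_lower1] and W' = field_along_subset[OF W o Int_lower1]
  let ?E = "\<lambda>k q. coord_vector A' S y k (F q)"
  have E: "field_along A A' F ?U (?E k)" for k
    by (rule field_along_subset[OF field_along_coord[OF S(1)] o Int_lower2])
  have expand: "field_along A A' F ?U (\<lambda>q. \<Sum>k\<in>Basis. V q (\<lambda>z. y z \<bullet> k) *\<^sub>R ?E k q)"
    if "field_along A A' F U V" for V
    by (intro field_along_sum o field_along_scale field_along_components(1)[OF that S(1)] E)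
  have EE: "compatible p x (?E k) (?E l)" for k l
    by (rule compatible_comp[OF p' x N.vector_field_on_coord_vector[OF S(1)]
          N.vector_field_on_coord_vector[OF S(1)] S(2)])
  \<comment> \<open>\<open>EV\<close> expands one field against the frame. Applied to
    \<open>W\<close> and read with the slots exchanged, it supplies the pairs of a frame field with
    \<open>W\<close> that the expansion of \<open>V\<close> requires.\<close>
  have EV: "compatible p x V (?E l)" if "field_along A A' F U V" for l V
  proof (rule compatible_local[OF p' x expand[OF that] field_along_subset[OF that o Int_lower1]])
    show "compatible p x (\<lambda>q. \<Sum>k\<in>Basis. V q (\<lambda>z. y z \<bullet> k) *\<^sub>R ?E k q) (?E l)"
      by (intro compatible_sum[OF p' x] field_along_components(1)[OF that S(1)] E EE)
  qed (rule field_along_components(2)[OF that S(1), symmetric])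
  have "compatible p x V W"
  proof (rule compatible_local[OF p' x expand[OF V] V'])
    show "compatible p x (\<lambda>q. \<Sum>k\<in>Basis. V q (\<lambda>z. y z \<bullet> k) *\<^sub>R ?E k q) W"
      by (intro compatible_sum[OF p' x] field_along_components(1)[OF V S(1)] E W'
          compatible_commute[OF p' x W' E] EV[OF W])
  qed (rule field_along_components(2)[OF V S(1), symmetric])
  then show ?thesis by (simp add: compatible_def[OF p' x])
qed

text \<open>The formula that determines \<open>D\<close>: the coefficients are differentiated by
  \<open>x\<close>, the restricted frame fields by \<open>nabla\<close>.\<close>

lemma D_expand:
  assumes p: "p \<in> U" and x: "x \<in> tangent_space A p"
    and V: "field_along A A' F U V" and S: "(S, y) \<in> A'" "F p \<in> S"
  shows "D p x V = (\<Sum>k\<in>Basis. x (\<lambda>q. V q (\<lambda>z. y z \<bullet> k)) *\<^sub>R coord_vector A' S y k (F p) +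
      V p (\<lambda>z. y z \<bullet> k) *\<^sub>R nabla (F p) (differential A' F p x) (coord_vector A' S y k))"
proof -
  let ?U = "U \<inter> F -` S"
  have p': "p \<in> ?U" using p S by simp
  have o: "open ?U"
    using field_alongD(1)[OF V] open_vimage[OF N.chart_open[OF S(1)]] by blast
  let ?E = "\<lambda>k q. coord_vector A' S y k (F q)"
  have E: "field_along A A' F ?U (?E k)" for k
    by (rule field_along_subset[OF field_along_coord[OF S(1)] o Int_lower2])
  have "D p x V = D p x (\<lambda>q. \<Sum>k\<in>Basis. V q (\<lambda>z. y z \<bullet> k) *\<^sub>R ?E k q)"
    by (rule D_local[OF p' x field_along_subset[OF V o Int_lower1]])
      (intro field_along_sum o field_along_scale field_along_components(1)[OF V S(1)] E,
        rule field_along_components(2)[OF V S(1)])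
  also have "\<dots> = (\<Sum>k\<in>Basis. x (\<lambda>q. V q (\<lambda>z. y z \<bullet> k)) *\<^sub>R ?E k p + V p (\<lambda>z. y z \<bullet> k) *\<^sub>R D p x (?E k))"
    by (rule D_sum[OF p' x o field_along_components(1)[OF V S(1)] E])
  finally show ?thesis
    by (simp add: D_comp[OF p' x N.vector_field_on_coord_vector[OF S(1)] S(2)])
qed

text \<open>After expansion in a frame, \<phi> commutes with the derivatives of the coefficients by
  linearity and with those of the frame fields because it is parallel.\<close>

lemma D_tensor:
  assumes p: "p \<in> U" and x: "x \<in> tangent_space A p" and V: "field_along A A' F U V"
    and maps: "\<And>p. \<phi> p ` tangent_space A' p \<subseteq> tangent_space A' p"
    and lin: "\<And>p. linear_on_space (tangent_space A' p) (\<phi> p)"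
    and smooth: "\<And>W Y. vector_field_on A' W Y \<Longrightarrow> vector_field_on A' W (\<lambda>p. \<phi> p (Y p))"
    and parallel: "\<And>W Y p x. vector_field_on A' W Y \<Longrightarrow> p \<in> W \<Longrightarrow> x \<in> tangent_space A' p \<Longrightarrow>
      nabla p x (\<lambda>q. \<phi> q (Y q)) = \<phi> p (nabla p x Y)"
  shows "D p x (\<lambda>q. \<phi> (F q) (V q)) = \<phi> (F p) (D p x V)"
proof -
  obtain S y where S: "(S, y) \<in> A'" "F p \<in> S" by (rule N.chartE)
  let ?U = "U \<inter> F -` S"
  have p': "p \<in> ?U" using p S by simp
  have o: "open ?U"
    using field_alongD(1)[OF V] open_vimage[OF N.chart_open[OF S(1)]] by blast
  let ?E = "\<lambda>k. coord_vector A' S y k"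
  note vE = N.vector_field_on_coord_vector[OF S(1)]
  have E: "field_along A A' F ?U (\<lambda>q. \<phi> (F q) (?E k (F q)))" for k
    by (rule field_along_subset[OF field_along_comp[OF smooth[OF vE]] o Int_lower2])
  note sub = N.subspace_tangent_space
  have "D p x (\<lambda>q. \<phi> (F q) (V q)) =
      D p x (\<lambda>q. \<Sum>k\<in>Basis. V q (\<lambda>z. y z \<bullet> k) *\<^sub>R \<phi> (F q) (?E k (F q)))"
  proof (rule D_local[OF p' x])
    show "field_along A A' F ?U (\<lambda>q. \<phi> (F q) (V q))"
      by (rule field_along_subset[OF field_along_tensor[OF V lin smooth] o Int_lower1])
    show "field_along A A' F ?U (\<lambda>q. \<Sum>k\<in>Basis. V q (\<lambda>z. y z \<bullet> k) *\<^sub>R \<phi> (F q) (?E k (F q)))"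
      by (intro field_along_sum o field_along_scale field_along_components(1)[OF V S(1)] E)
    fix q assume q: "q \<in> ?U"
    show "\<phi> (F q) (V q) = (\<Sum>k\<in>Basis. V q (\<lambda>z. y z \<bullet> k) *\<^sub>R \<phi> (F q) (?E k (F q)))"
      by (subst field_along_components(2)[OF V S(1) q], rule linear_on_space_sum[OF lin sub])
        (use q N.coord_vector_in_tangent_space[OF S(1)] in auto)
  qed
  also have "\<dots> = (\<Sum>k\<in>Basis. x (\<lambda>q. V q (\<lambda>z. y z \<bullet> k)) *\<^sub>R \<phi> (F p) (?E k (F p)) +
      V p (\<lambda>z. y z \<bullet> k) *\<^sub>R D p x (\<lambda>q. \<phi> (F q) (?E k (F q))))"
    by (rule D_sum[OF p' x o field_along_components(1)[OF V S(1)] E])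
  also have "\<dots> = (\<Sum>k\<in>Basis. x (\<lambda>q. V q (\<lambda>z. y z \<bullet> k)) *\<^sub>R \<phi> (F p) (?E k (F p))) +
      (\<Sum>k\<in>Basis. V p (\<lambda>z. y z \<bullet> k) *\<^sub>R \<phi> (F p) (nabla (F p) (differential A' F p x) (?E k)))"
    by (simp add: sum.distrib D_comp[OF p' x smooth[OF vE] S(2)]
        parallel[OF vE S(2) differential_in_tangent_space[OF x]])
  also have "\<dots> = \<phi> (F p) (D p x V)"
  proof -
    have n: "nabla (F p) (differential A' F p x) (?E k) \<in> tangent_space A' (F p)" for k
      using D_in_tangent_space[OF p' x field_along_subset[OF field_along_coord[OF S(1)] o Int_lower2]]
      by (simp add: D_comp[OF p' x vE S(2)])
    note e = N.coord_vector_in_tangent_space[OF S]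
    have "\<phi> (F p) (D p x V) =
      \<phi> (F p) ((\<Sum>k\<in>Basis. x (\<lambda>q. V q (\<lambda>z. y z \<bullet> k)) *\<^sub>R ?E k (F p)) +
      (\<Sum>k\<in>Basis. V p (\<lambda>z. y z \<bullet> k) *\<^sub>R nabla (F p) (differential A' F p x) (?E k)))"
      by (simp add: D_expand[OF p x V S] sum.distrib)
    also have "\<dots> = \<phi> (F p) (\<Sum>k\<in>Basis. x (\<lambda>q. V q (\<lambda>z. y z \<bullet> k)) *\<^sub>R ?E k (F p)) +
      \<phi> (F p) (\<Sum>k\<in>Basis. V p (\<lambda>z. y z \<bullet> k) *\<^sub>R nabla (F p) (differential A' F p x) (?E k))"
      by (rule linear_on_spaceD(1)[OF lin _ _ sub])
        (auto intro!: subspace_sum[OF sub] subspace_scale[OF sub] n e)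
    finally show ?thesis
      by (simp add: linear_on_space_sum[OF lin sub] n e)
  qed
  finally show ?thesis .
qed

text \<open>The pulled back connection has no torsion, stated for commuting fields. In coordinates
  the derivative is a second derivative of the map plus Christoffel terms, and each of the two is
  symmetric in u and v.\<close>

lemma D_coord_commute:
  assumes U: "(U, c) \<in> A" "p \<in> U"
  shows "D p (coord_vector A U c u p) (\<lambda>q. differential A' F q (coord_vector A U c v q)) =
         D p (coord_vector A U c v p) (\<lambda>q. differential A' F q (coord_vector A U c u q))"
proof -
  obtain S y where S: "(S, y) \<in> A'" "F p \<in> S" by (rule N.chartE)
  let ?X = "\<lambda>u. coord_vector A U c u"
  let ?E = "\<lambda>k. coord_vector A' S y k"
  let ?y = "\<lambda>k q. y (F q) \<bullet> k"
  let ?G = "\<lambda>l k. nabla (F p) (?E l (F p)) (?E k)"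
  have oS: "open (F -` S)" using open_vimage[OF N.chart_open[OF S(1)]] .
  have oU: "open U" using M.chart_open[OF U(1)] .
  note X = M.coord_vector_in_tangent_space[OF U]
  note vE = N.vector_field_on_coord_vector[OF S(1)]
  have ys: "smooth_near A p (?y k)" for k
    by (rule smooth_near_pullback[OF N.smooth_nearI[OF N.smooth_fun_on_coord[OF S(1)] S(2)]])
  have dy: "differential A' F q v (\<lambda>z. y z \<bullet> k) = v (?y k)" if "q \<in> F -` S" for q v k
    using differential_smooth[OF N.smooth_nearI[OF N.smooth_fun_on_coord[OF S(1)]]] that by auto
  \<comment> \<open>Symmetry of the Christoffel symbols: ambient coordinate fields have bracket
    0.\<close>
  have sym: "?G l k = ?G k l" for k l
  proof -
    have "?G l k - ?G k l = lie_bracket A' (?E l) (?E k) (F p)"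
      by (rule levi_civitaD(2)[OF levi_civita vE vE S(2)])
    then show ?thesis by (simp add: N.lie_bracket_coord_vector[OF S])
  qed
  have nab: "nabla (F p) (differential A' F p (?X u p)) (?E k) =
      (\<Sum>l\<in>Basis. ?X u p (?y l) *\<^sub>R ?G l k)" for u k
  proof -
    have "linear_on_space (tangent_space A' (F p)) (\<lambda>w. nabla (F p) w (?E k))"
      by (rule affine_connectionD(2)[OF levi_civitaD(1)[OF levi_civita]])
        (use vE[of k] S(2) in \<open>auto simp: vector_field_near_def\<close>)
    from linear_on_space_sum[OF this N.subspace_tangent_space,
        of Basis "\<lambda>l. ?E l (F p)" "\<lambda>l. ?X u p (?y l)"]
    have "nabla (F p) (\<Sum>l\<in>Basis. ?X u p (?y l) *\<^sub>R ?E l (F p)) (?E k) =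
      (\<Sum>l\<in>Basis. ?X u p (?y l) *\<^sub>R ?G l k)"
      using N.coord_vector_in_tangent_space[OF S] by simp
    moreover have "differential A' F p (?X u p) = (\<Sum>l\<in>Basis. ?X u p (?y l) *\<^sub>R ?E l (F p))"
      using N.tangent_expand[OF S differential_in_tangent_space[OF X]] dy S(2) by simp
    ultimately show ?thesis by simp
  qed
  have *: "D p (?X u p) (\<lambda>q. differential A' F q (?X v q)) =
     (\<Sum>k\<in>Basis. ?X u p (\<lambda>q. ?X v q (?y k)) *\<^sub>R ?E k (F p)) +
     (\<Sum>k\<in>Basis. \<Sum>l\<in>Basis. (?X v p (?y k) * ?X u p (?y l)) *\<^sub>R ?G l k)" for u v
  proof -
    have "?X u p (\<lambda>q. differential A' F q (?X v q) (\<lambda>z. y z \<bullet> k)) = ?X u p (\<lambda>q. ?X v q (?y k))" for k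
      by (rule M.tangent_local[OF X oS]) (use S(2) dy in auto)
    moreover have "differential A' F p (?X v p) (\<lambda>z. y z \<bullet> k) = ?X v p (?y k)" for k
      by (rule dy) (use S in simp)
    ultimately show ?thesis
      using D_expand[OF U(2) X[of u] field_along_differential[OF M.vector_field_on_coord_vector[OF U(1), of v]] S]
      by (simp only: sum.distrib nab scaleR_sum_right scaleR_scaleR)
  qed
  \<comment> \<open>Exchanging the two summation indices is the exchange of \<open>u\<close> and
    \<open>v\<close>, by \<open>sym\<close>.\<close>
  have "(\<Sum>k\<in>Basis. \<Sum>l\<in>Basis. (?X v p (?y k) * ?X u p (?y l)) *\<^sub>R ?G l k) =
    (\<Sum>k\<in>Basis. \<Sum>l\<in>Basis. (?X u p (?y k) * ?X v p (?y l)) *\<^sub>R ?G l k)"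
    by (subst sum.swap) (simp add: sym mult.commute)
  then show ?thesis
    unfolding * using M.coord_vector_commute[OF U ys, of u v] by simp
qed

end

section \<open>Almost contact metric manifolds\<close>

locale cosymplectic_manifold = manifold A
  for A :: "('p::{t2_space, second_countable_topology}, 'e::euclidean_space) chart set" +
  fixes phi xi eta g nabla
  assumes cosymplectic: "cosymplectic A phi xi eta g nabla"
begin

lemma
  shows metric: "riemannian_metric A g"
    and levi_civita: "levi_civita A g nabla"
    and xi_field: "vector_field_on A UNIV xi"
    and phi_in_tangent_space: "\<And>u p. u \<in> tangent_space A p \<Longrightarrow> phi p u \<in> tangent_space A p"
    and phi_linear: "\<And>p. linear_on_space (tangent_space A p) (phi p)"
    and eta_linear: "\<And>p. linear_on_space (tangent_space A p) (eta p)"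
    and phi_field: "\<And>U X. vector_field_on A U X \<Longrightarrow> vector_field_on A U (\<lambda>p. phi p (X p))"
    and phi_phi: "\<And>u p. u \<in> tangent_space A p \<Longrightarrow> phi p (phi p u) = - u + eta p u *\<^sub>R xi p"
    and eta_xi: "\<And>p. eta p (xi p) = 1"
    and phi_isometry: "\<And>u v p. u \<in> tangent_space A p \<Longrightarrow> v \<in> tangent_space A p \<Longrightarrow>
      g p (phi p u) (phi p v) = g p u v - eta p u * eta p v"
    and phi_parallel: "\<And>U Y p x. vector_field_on A U Y \<Longrightarrow> p \<in> U \<Longrightarrow> x \<in> tangent_space A p \<Longrightarrow>
      nabla p x (\<lambda>q. phi q (Y q)) = phi p (nabla p x Y)"
proof -
  note c = cosymplectic[unfolded cosymplectic_def almost_contact_metric_def]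
  show "riemannian_metric A g" "levi_civita A g nabla" "vector_field_on A UNIV xi"
    using c by simp_all
  have *: "\<forall>p. phi p ` tangent_space A p \<subseteq> tangent_space A p \<and>
          linear_on_space (tangent_space A p) (phi p) \<and>
          linear_on_space (tangent_space A p) (eta p)"
    "\<forall>U X. vector_field_on A U X \<longrightarrow>
          vector_field_on A U (\<lambda>p. phi p (X p)) \<and> smooth_fun_on A U (\<lambda>p. eta p (X p))"
    "\<forall>p. \<forall>u\<in>tangent_space A p. phi p (phi p u) = - u + eta p u *\<^sub>R xi p"
    "\<forall>p. eta p (xi p) = 1"
    "\<forall>p. \<forall>u\<in>tangent_space A p. \<forall>v\<in>tangent_space A p.
          g p (phi p u) (phi p v) = g p u v - eta p u * eta p v"
    "\<forall>U Y. vector_field_on A U Y \<longrightarrow> (\<forall>p\<in>U. \<forall>x\<in>tangent_space A p.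
        nabla p x (\<lambda>q. phi q (Y q)) - phi p (nabla p x Y) = 0)"
    by (insert c, (elim conjE, assumption)+)
  show "\<And>p. linear_on_space (tangent_space A p) (phi p)"
    and "\<And>p. linear_on_space (tangent_space A p) (eta p)" using *(1) by simp_all
  show "\<And>U X. vector_field_on A U X \<Longrightarrow> vector_field_on A U (\<lambda>p. phi p (X p))" using *(2) by simp
  show "\<And>u p. u \<in> tangent_space A p \<Longrightarrow> phi p (phi p u) = - u + eta p u *\<^sub>R xi p" using *(3) by simp
  show "\<And>p. eta p (xi p) = 1" using *(4) by simp
  show "\<And>u v p. u \<in> tangent_space A p \<Longrightarrow> v \<in> tangent_space A p \<Longrightarrow>
      g p (phi p u) (phi p v) = g p u v - eta p u * eta p v" using *(5) by simp
  show "\<And>u p. u \<in> tangent_space A p \<Longrightarrow> phi p u \<in> tangent_space A p" using *(1) by auto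
  show "\<And>U Y p x. vector_field_on A U Y \<Longrightarrow> p \<in> U \<Longrightarrow> x \<in> tangent_space A p \<Longrightarrow>
      nabla p x (\<lambda>q. phi q (Y q)) = phi p (nabla p x Y)" using *(6) by (simp add: right_minus_eq)
qed

lemma xi_in_tangent_space: "xi p \<in> tangent_space A p"
  using vector_field_onD(2)[OF xi_field] by simp

lemma xi_nonzero: "xi p \<noteq> 0"
  using eta_xi[of p] linear_on_spaceD(5)[OF eta_linear xi_in_tangent_space xi_in_tangent_space
      subspace_tangent_space, of p] by auto

text \<open>The formula for phi^2 gives phi (phi xi) = 0. Applied to w = phi xi it then gives w =
  eta(w) xi, so 0 = phi w = eta(w) w, and w = 0 either way.\<close>

lemma phi_xi: "phi p (xi p) = 0"
proof -
  let ?w = "phi p (xi p)"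
  note x = xi_in_tangent_space[of p]
  have w: "?w \<in> tangent_space A p" using phi_in_tangent_space[OF x] .
  note lin = linear_on_spaceD[OF phi_linear _ _ subspace_tangent_space]
  have "phi p ?w = 0" using phi_phi[OF x] by (simp add: eta_xi)
  then have "- ?w + eta p ?w *\<^sub>R xi p = 0"
    using phi_phi[OF w] lin(5)[OF w w] by simp
  then have e: "?w = eta p ?w *\<^sub>R xi p" by (simp add: add_eq_0_iff)
  then have "phi p ?w = eta p ?w *\<^sub>R ?w" using lin(2)[OF x x, of "eta p ?w"] by metis
  then show ?thesis using \<open>phi p ?w = 0\<close> e by auto
qed

text \<open>Put xi in the second slot of the isometry identity; its left side vanishes by
  \<open>phi_xi\<close>.\<close>

lemma eta_eq_g: "u \<in> tangent_space A p \<Longrightarrow> eta p u = g p u (xi p)"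
  using phi_isometry[OF _ xi_in_tangent_space, of u p]
    linear_on_spaceD(5)[OF riemannian_metric_linear_right[OF metric phi_in_tangent_space, of u p] _ _
      subspace_tangent_space] xi_in_tangent_space[of p]
  by (simp add: phi_xi eta_xi)

lemma g_xi_xi: "g p (xi p) (xi p) = 1"
  using eta_eq_g[OF xi_in_tangent_space] eta_xi by simp

text \<open>Compute phi^3 v in two ways, with phi^2 outermost or innermost; the results differ by
  eta(phi v) xi.\<close>

lemma eta_phi:
  assumes v: "v \<in> tangent_space A p" shows "eta p (phi p v) = 0"
proof -
  note lin = linear_on_spaceD[OF phi_linear _ _ subspace_tangent_space]
  note x = xi_in_tangent_space[of p]
  note pv = phi_in_tangent_space[OF v]
  have ex: "eta p v *\<^sub>R xi p \<in> tangent_space A p"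
    by (rule subspace_scale[OF subspace_tangent_space x])
  have mv: "- v \<in> tangent_space A p" by (rule subspace_neg[OF subspace_tangent_space v])
  have "- phi p v + eta p (phi p v) *\<^sub>R xi p = phi p (phi p (phi p v))"
    using phi_phi[OF pv] by simp
  also have "\<dots> = phi p (- v + eta p v *\<^sub>R xi p)" using phi_phi[OF v] by simp
  also have "\<dots> = - phi p v"
    using lin(1)[OF mv ex] lin(4)[OF v v] lin(2)[OF x x, of "eta p v"] by (simp add: phi_xi)
  finally show ?thesis using xi_nonzero by simp
qed

text \<open>Apply the isometry identity to u and phi v, then reduce phi (phi v); the eta-terms
  vanish because eta kills the image of phi.\<close>

lemma phi_skew:
  assumes u: "u \<in> tangent_space A p" and v: "v \<in> tangent_space A p"
  shows "g p (phi p u) v = - g p u (phi p v)"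
proof -
  note pu = phi_in_tangent_space[OF u] and pv = phi_in_tangent_space[OF v]
  note x = xi_in_tangent_space[of p]
  note lin = linear_on_spaceD[OF riemannian_metric_linear_right[OF metric pu] _ _ subspace_tangent_space]
  have ex: "eta p v *\<^sub>R xi p \<in> tangent_space A p"
    by (rule subspace_scale[OF subspace_tangent_space x])
  have mv: "- v \<in> tangent_space A p" by (rule subspace_neg[OF subspace_tangent_space v])
  have "g p u (phi p v) = g p (phi p u) (phi p (phi p v))"
    using phi_isometry[OF u pv] eta_phi[OF v] by simp
  also have "\<dots> = - g p (phi p u) v + eta p v * g p (phi p u) (xi p)"
    using lin(1)[OF mv ex] lin(4)[OF v v] lin(2)[OF x x, of "eta p v"] by (simp add: phi_phi[OF v])
  also have "g p (phi p u) (xi p) = 0" using eta_eq_g[OF pu] eta_phi[OF u] by simp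
  finally show ?thesis by simp
qed

text \<open>Since phi is parallel and kills xi, phi also kills nabla xi, which is therefore a
  multiple of xi. The constant length of xi forces the factor to be 0.\<close>

lemma nabla_xi:
  assumes x: "x \<in> tangent_space A p" shows "nabla p x xi = 0"
proof -
  let ?w = "nabla p x xi"
  have near: "vector_field_near A p xi" using xi_field by (auto simp: vector_field_near_def)
  have w: "?w \<in> tangent_space A p"
    by (rule affine_connectionD(1)[OF levi_civitaD(1)[OF levi_civita] near x])
  \<comment> \<open>The zero field is written as 0 times xi so that the Leibniz rule yields its
    covariant derivative.\<close>
  have "nabla p x (\<lambda>q. 0 *\<^sub>R xi q) = x (\<lambda>q. 0) *\<^sub>R xi p + 0 *\<^sub>R nabla p x xi"
    by (rule affine_connectionD(3)[OF levi_civitaD(1)[OF levi_civita] near smooth_near_const x])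
  then have "nabla p x (\<lambda>q. 0) = 0" using tangent_const[OF x] by simp
  then have "phi p ?w = 0" using phi_parallel[OF xi_field UNIV_I x] by (simp add: phi_xi)
  then have "- ?w + eta p ?w *\<^sub>R xi p = 0"
    using phi_phi[OF w] linear_on_spaceD(5)[OF phi_linear w w subspace_tangent_space] by simp
  then have e: "?w = eta p ?w *\<^sub>R xi p" by (simp add: add_eq_0_iff)
  have "x (\<lambda>q. g q (xi q) (xi q)) = g p ?w (xi p) + g p (xi p) ?w"
    by (rule levi_civitaD(3)[OF levi_civita xi_field xi_field UNIV_I x])
  then have "2 * g p ?w (xi p) = 0"
    using riemannian_metricD(1)[OF metric w xi_in_tangent_space] tangent_const[OF x, of 1]
    by (simp add: g_xi_xi)
  then show ?thesis using e eta_eq_g[OF w] by simp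
qed

end

section \<open>Inner products on subspaces\<close>

text \<open>\<open>S\<close> will be a tangent space inside the space of all operators on functions.
  The form is arbitrary off \<open>S\<close>, so every law carries membership premises.\<close>

locale inner_space =
  fixes S :: "'v::real_vector set" and G :: "'v \<Rightarrow> 'v \<Rightarrow> real"
  assumes subspace: "subspace S"
    and commute: "u \<in> S \<Longrightarrow> v \<in> S \<Longrightarrow> G u v = G v u"
    and linear_left: "v \<in> S \<Longrightarrow> linear_on_space S (\<lambda>u. G u v)"
    and pos: "v \<in> S \<Longrightarrow> v \<noteq> 0 \<Longrightarrow> G v v > 0"
begin

lemma linear_right: assumes "u \<in> S" shows "linear_on_space S (G u)"
  unfolding linear_on_space_def
proof (intro ballI allI)
  fix v w a b assume vw: "v \<in> S" "w \<in> S"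
  then have "a *\<^sub>R v + b *\<^sub>R w \<in> S" by (simp add: subspace_add subspace_scale subspace)
  with vw show "G u (a *\<^sub>R v + b *\<^sub>R w) = a *\<^sub>R G u v + b *\<^sub>R G u w"
    using commute[OF assms] linear_left[OF assms] by (simp add: linear_on_space_def)
qed

lemmas add_left = linear_on_spaceD(1)[OF linear_left _ _ subspace]
  and diff_left = linear_on_spaceD(3)[OF linear_left _ _ subspace]
  and add_right = linear_on_spaceD(1)[OF linear_right _ _ subspace]
  and diff_right = linear_on_spaceD(3)[OF linear_right _ _ subspace]

lemma scale_left: "u \<in> S \<Longrightarrow> v \<in> S \<Longrightarrow> G (c *\<^sub>R u) v = c * G u v"
  and scale_right: "u \<in> S \<Longrightarrow> v \<in> S \<Longrightarrow> G u (c *\<^sub>R v) = c * G u v"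
  using linear_on_spaceD(2)[OF linear_left, of v u u]
    linear_on_spaceD(2)[OF linear_right, of u v v] subspace by auto

lemma zero_left: "v \<in> S \<Longrightarrow> G 0 v = 0"
  and zero_right: "v \<in> S \<Longrightarrow> G v 0 = 0"
  using linear_on_spaceD(5)[OF linear_left, of v v v] linear_on_spaceD(5)[OF linear_right, of v v v]
    subspace by auto

lemma sum_left:
  "v \<in> S \<Longrightarrow> (\<And>i. i \<in> I \<Longrightarrow> u i \<in> S) \<Longrightarrow> G (\<Sum>i\<in>I. c i *\<^sub>R u i) v = (\<Sum>i\<in>I. c i * G (u i) v)"
  using linear_on_space_sum[OF linear_left subspace, of v I u c] by simp

lemma sum_right:
  "v \<in> S \<Longrightarrow> (\<And>i. i \<in> I \<Longrightarrow> u i \<in> S) \<Longrightarrow> G v (\<Sum>i\<in>I. c i *\<^sub>R u i) = (\<Sum>i\<in>I. c i * G v (u i))"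
  using linear_on_space_sum[OF linear_right subspace, of v I u c] by simp

lemma nonneg: "v \<in> S \<Longrightarrow> G v v \<ge> 0"
  using pos[of v] zero_left[of v] by (cases "v = 0") auto

lemma eq_0_iff: "v \<in> S \<Longrightarrow> G v v = 0 \<longleftrightarrow> v = 0"
  using pos[of v] zero_left[of v] by (cases "v = 0") simp_all

lemma lincomb_in: "(\<And>i. i \<in> I \<Longrightarrow> u i \<in> S) \<Longrightarrow> (\<Sum>i\<in>I. c i *\<^sub>R u i) \<in> S"
  by (auto intro!: subspace_sum[OF subspace] subspace_scale[OF subspace])

section \<open>Orthonormal systems and projections\<close>

definition orthonormal :: "'v set \<Rightarrow> bool" where
  "orthonormal B \<longleftrightarrow> finite B \<and> B \<subseteq> S \<and> (\<forall>a\<in>B. \<forall>b\<in>B. G a b = (if a = b then 1 else 0))"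

definition onb :: "'v set \<Rightarrow> 'v set \<Rightarrow> bool" where
  "onb E B \<longleftrightarrow> orthonormal B \<and> span B = E"

lemma orthonormalD:
  assumes "orthonormal B"
  shows "finite B" "\<And>b. b \<in> B \<Longrightarrow> b \<in> S" "\<And>a b. a \<in> B \<Longrightarrow> b \<in> B \<Longrightarrow> G a b = (if a = b then 1 else 0)"
  using assms unfolding orthonormal_def by blast+

lemma orthonormal_coeff:
  assumes B: "orthonormal B" and a: "a \<in> B"
  shows "G (\<Sum>b\<in>B. c b *\<^sub>R b) a = c a"
proof -
  have "G (\<Sum>b\<in>B. c b *\<^sub>R b) a = (\<Sum>b\<in>B. c b * G b a)"
    by (rule sum_left) (use orthonormalD(2)[OF B] a in auto)
  also have "\<dots> = (\<Sum>b\<in>B. if b = a then c b else 0)"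
    by (intro sum.cong) (use orthonormalD(3)[OF B] a in auto)
  finally show ?thesis using orthonormalD(1)[OF B] a by simp
qed

lemma orthonormal_independent:
  assumes B: "orthonormal B" shows "independent B"
proof (rule independent_if_scalars_zero[OF orthonormalD(1)[OF B]])
  fix c a assume s: "(\<Sum>b\<in>B. c b *\<^sub>R b) = 0" and a: "a \<in> B"
  have "c a = G 0 a" using orthonormal_coeff[OF B a, of c] s by simp
  then show "c a = 0" using zero_left orthonormalD(2)[OF B a] by simp
qed

lemma onb_subset: "onb E B \<Longrightarrow> E \<subseteq> S"
  unfolding onb_def using orthonormalD(2) span_minimal[OF _ subspace] by blast

lemma onb_expand:
  assumes B: "onb E B" and v: "v \<in> E"
  shows "v = (\<Sum>b\<in>B. G v b *\<^sub>R b)"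
proof -
  have o: "orthonormal B" using B by (simp add: onb_def)
  obtain c where "v = (\<Sum>b\<in>B. c b *\<^sub>R b)"
    using v B span_finite[OF orthonormalD(1)[OF o]] unfolding onb_def by auto
  then show ?thesis using orthonormal_coeff[OF o] by simp
qed

lemma parseval:
  assumes B: "onb E B" and v: "v \<in> E" and w: "w \<in> S"
  shows "G v w = (\<Sum>b\<in>B. G v b * G b w)"
proof -
  have o: "orthonormal B" using B by (simp add: onb_def)
  have "G v w = G (\<Sum>b\<in>B. G v b *\<^sub>R b) w" using onb_expand[OF B v] by simp
  also have "\<dots> = (\<Sum>b\<in>B. G v b * G b w)" by (rule sum_left[OF w orthonormalD(2)[OF o]])
  finally show ?thesis .
qed

lemma onb_card: "onb E B \<Longrightarrow> card B = dim E"
  unfolding onb_def using orthonormal_independent dim_span_eq_card_independent by metis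

text \<open>One Gram-Schmidt step: subtract the projection to the span of \<open>B\<close>, which
  leaves a nonzero vector, and normalise.\<close>

lemma orthonormal_extend:
  assumes B: "orthonormal B" and v: "v \<in> S" and nv: "v \<notin> span B"
  obtains e where "orthonormal (insert e B)" "e \<notin> B" "e \<in> span (insert v B)"
proof -
  define w where "w = v - (\<Sum>b\<in>B. G v b *\<^sub>R b)"
  have sB: "(\<Sum>b\<in>B. G v b *\<^sub>R b) \<in> span B" by (intro span_sum span_scale span_base)
  have sS: "(\<Sum>b\<in>B. G v b *\<^sub>R b) \<in> S" by (rule lincomb_in) (rule orthonormalD(2)[OF B])
  have w: "w \<in> S" unfolding w_def by (rule subspace_diff[OF subspace v sS])
  have w0: "w \<noteq> 0" using nv sB by (auto simp: w_def)
  have wb: "G w b = 0" if "b \<in> B" for b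
    using orthonormal_coeff[OF B that] diff_left[OF orthonormalD(2)[OF B that] v sS] by (simp add: w_def)
  define e where "e = (1 / sqrt (G w w)) *\<^sub>R w"
  have e: "e \<in> S" unfolding e_def by (rule subspace_scale[OF subspace w])
  have eb: "G e b = 0" "G b e = 0" if "b \<in> B" for b
    using wb[OF that] scale_left[OF w orthonormalD(2)[OF B that]]
      commute[OF e orthonormalD(2)[OF B that]] by (auto simp: e_def)
  have ee: "G e e = 1"
    using pos[OF w w0] scale_left[OF w e] scale_right[OF w w] by (simp add: e_def)
  have "e \<notin> B" using eb(1)[of e] ee by auto
  moreover from this have "orthonormal (insert e B)"
    unfolding orthonormal_def using orthonormalD[OF B] e eb ee by auto
  moreover have "e \<in> span (insert v B)"
    unfolding e_def w_def using sB span_mono[of B "insert v B"]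
    by (intro span_scale span_diff) (auto intro: span_base)
  ultimately show ?thesis using that by blast
qed

lemma orthonormal_card_le:
  "orthonormal B \<Longrightarrow> B \<subseteq> span X \<Longrightarrow> finite X \<Longrightarrow> card B \<le> card X"
  using independent_span_bound[OF _ orthonormal_independent] by blast

text \<open>Orthonormal subsets of \<open>E\<close> have at most \<open>card X\<close> elements, so
  there is one of maximal size; if it did not span \<open>E\<close>,
  \<open>orthonormal_extend\<close> would enlarge it.\<close>

lemma onb_exists:
  assumes E: "subspace E" "E \<subseteq> S" and X: "finite X" "E \<subseteq> span X"
  obtains B where "onb E B"
proof -
  let ?P = "\<lambda>B. orthonormal B \<and> B \<subseteq> E"
  have "?P {}" by (simp add: orthonormal_def)
  moreover have "\<forall>B. ?P B \<longrightarrow> card B \<le> card X"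
    using orthonormal_card_le[OF _ _ X(1)] X(2) by blast
  ultimately have "\<exists>n. (\<exists>B. ?P B \<and> card B = n) \<and> (\<forall>k. (\<exists>B. ?P B \<and> card B = k) \<longrightarrow> k \<le> n)"
    by (intro Nat.ex_has_greatest_nat[of _ 0 "card X"]) (auto intro: exI[of _ "{}"])
  then obtain B where B: "?P B" "\<And>C. ?P C \<Longrightarrow> card C \<le> card B" by blast
  have "E \<subseteq> span B"
  proof (rule ccontr)
    assume "\<not> E \<subseteq> span B"
    then obtain v where v: "v \<in> E" "v \<notin> span B" by blast
    obtain e where e: "orthonormal (insert e B)" "e \<notin> B" "e \<in> span (insert v B)"
      using orthonormal_extend[of B v] B v E by blast
    have "span (insert v B) \<subseteq> E" using B v by (intro span_minimal E) auto
    then have "card (insert e B) \<le> card B" using B e by auto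
    then show False using e(2) orthonormalD(1) B(1) by auto
  qed
  moreover have "span B \<subseteq> E" using B by (intro span_minimal E) auto
  ultimately have "onb E B" using B unfolding onb_def by blast
  then show ?thesis by (rule that)
qed

text \<open>A vector outside the span would yield an orthonormal set larger than the spanning set
  \<open>X\<close>. This converts a count of dimensions into completeness of a frame.\<close>

lemma orthonormal_full:
  assumes B: "orthonormal B" and X: "finite X" "S \<subseteq> span X" "card X \<le> card B"
  shows "onb S B"
proof -
  have "S \<subseteq> span B"
  proof (rule ccontr)
    assume "\<not> S \<subseteq> span B"
    then obtain v where v: "v \<in> S" "v \<notin> span B" by blast
    obtain e where e: "orthonormal (insert e B)" "e \<notin> B"
      using orthonormal_extend[OF B v] by blast
    have "card (insert e B) \<le> card X"
      by (rule orthonormal_card_le[OF e(1)]) (use X orthonormalD(2)[OF e(1)] in auto)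
    then show False using e(2) orthonormalD(1)[OF B] X by simp
  qed
  moreover have "span B \<subseteq> S" using orthonormalD(2)[OF B] by (intro span_minimal subspace) auto
  ultimately show ?thesis using B unfolding onb_def by blast
qed

lemma orthonormal_Un:
  assumes "orthonormal B" "orthonormal C" "\<And>b c. b \<in> B \<Longrightarrow> c \<in> C \<Longrightarrow> G b c = 0"
  shows "orthonormal (B \<union> C)" and "B \<inter> C = {}"
proof -
  show d: "B \<inter> C = {}" using orthonormalD(3)[OF assms(1)] assms(3) by fastforce
  have "G c b = 0" if "b \<in> B" "c \<in> C" for b c
    using assms(3)[OF that] commute orthonormalD(2)[OF assms(1) that(1)]
      orthonormalD(2)[OF assms(2) that(2)] by simp
  then show "orthonormal (B \<union> C)"
    using orthonormalD[OF assms(1)] orthonormalD[OF assms(2)] assms(3) d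
    unfolding orthonormal_def by auto
qed

text \<open>A repeated entry would have inner product both 0 and 1 with its copy. So the list is
  distinct, and sums over indices are sums over the set.\<close>

lemma orthonormal_basis_imp_onb:
  assumes "orthonormal_basis G E es" "E \<subseteq> S"
  shows "onb E (set es)"
    and "(\<Sum>i<length es. \<phi> (es ! i)) = (\<Sum>e\<in>set es. \<phi> e)"
proof -
  have *: "G (es ! i) (es ! j) = (if i = j then 1 else 0)" if "i < length es" "j < length es" for i j
    using assms(1) that by (simp add: orthonormal_basis_def)
  have d: "distinct es"
    unfolding distinct_conv_nth using * by (metis zero_neq_one)
  show "onb E (set es)"
    using assms d unfolding onb_def orthonormal_def orthonormal_basis_def
    by (auto simp: in_set_conv_nth nth_eq_iff_index_eq)
  show "(\<Sum>i<length es. \<phi> (es ! i)) = (\<Sum>e\<in>set es. \<phi> e)"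
    by (rule sum.reindex_bij_betw[OF bij_betw_nth[OF d refl refl]])
qed

lemma onb_imp_orthonormal_basis:
  assumes "onb E B"
  obtains es where "orthonormal_basis G E es"
proof -
  have o: "orthonormal B" using assms by (simp add: onb_def)
  obtain es where es: "set es = B" "distinct es"
    using finite_distinct_list[OF orthonormalD(1)[OF o]] by blast
  have "orthonormal_basis G E es"
    unfolding orthonormal_basis_def
    using es assms orthonormalD[OF o] span_superset[of B]
    by (auto simp: onb_def nth_eq_iff_index_eq)
  then show ?thesis by (rule that)
qed

text \<open>\<open>orth_proj\<close> is a definite description, so uniqueness has to be shown: the
  difference of two candidates lies in \<open>E\<close> and is orthogonal to itself.\<close>

lemma orth_projI:
  assumes E: "subspace E" "E \<subseteq> S" and v: "v \<in> S" and w: "w \<in> E"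
    and orth: "\<And>u. u \<in> E \<Longrightarrow> G (v - w) u = 0"
  shows "orth_proj G E v = w"
  unfolding orth_proj_def
proof (rule the_equality)
  show "w \<in> E \<and> (\<forall>u\<in>E. G (v - w) u = 0)" using w orth by blast
  fix w' assume w': "w' \<in> E \<and> (\<forall>u\<in>E. G (v - w') u = 0)"
  have d: "w' - w \<in> E" using w w' by (intro subspace_diff[OF E(1)]) auto
  have "G ((v - w) - (v - w')) (w' - w) = 0"
    using diff_left[of "w' - w" "v - w" "v - w'"] w' orth d w v E
      subspace_diff[OF subspace] by (auto simp: subset_iff)
  then have "G (w' - w) (w' - w) = 0" by simp
  then show "w' = w" using eq_0_iff d E(2) by auto
qed

lemma orth_proj_onb:
  assumes B: "onb E B" and v: "v \<in> S"
  shows "orth_proj G E v = (\<Sum>b\<in>B. G v b *\<^sub>R b)"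
    and "(\<Sum>b\<in>B. G v b *\<^sub>R b) \<in> E"
    and "u \<in> E \<Longrightarrow> G (v - (\<Sum>b\<in>B. G v b *\<^sub>R b)) u = 0"
proof -
  have o: "orthonormal B" using B by (simp add: onb_def)
  have E: "subspace E" "E \<subseteq> S"
    using B subspace_span onb_subset[OF B] by (auto simp: onb_def)
  let ?w = "\<Sum>b\<in>B. G v b *\<^sub>R b"
  show w: "?w \<in> E"
    using B span_superset[of B] by (auto simp: onb_def intro!: subspace_sum[OF E(1)] subspace_scale[OF E(1)])
  show orth: "G (v - ?w) u = 0" if u: "u \<in> E" for u
  proof -
    have vw: "v - ?w \<in> S" using v w E(2) subspace_diff[OF subspace] by auto
    have b: "G (v - ?w) b = 0" if "b \<in> B" for b
      using orthonormal_coeff[OF o that] diff_left[of b v ?w] orthonormalD(2)[OF o that] v w E(2) by auto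
    have "G u (v - ?w) = (\<Sum>b\<in>B. G u b * G b (v - ?w))" by (rule parseval[OF B u vw])
    also have "\<dots> = 0"
      by (rule sum.neutral) (use b commute[OF vw] orthonormalD(2)[OF o] in auto)
    finally show ?thesis using commute[OF vw, of u] u E(2) by auto
  qed
  show "orth_proj G E v = ?w" by (rule orth_projI[OF E v w orth])
qed

end

text \<open>Invariance of a trace. Each \<open>L b\<close> is expanded in \<open>C\<close>; the sum
  over b of G b c * G b d collapses to \<open>G c d\<close> by Parseval in \<open>B\<close>.\<close>

lemma sum_norm_sq_onb_invariant:
  assumes "inner_space S G" "inner_space S' G'"
    and B: "inner_space.onb S G E B" and C: "inner_space.onb S G E C"
    and L: "linear_on_space E L" "\<And>v. v \<in> E \<Longrightarrow> L v \<in> S'"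
  shows "(\<Sum>b\<in>B. G' (L b) (L b)) = (\<Sum>c\<in>C. G' (L c) (L c))"
proof -
  interpret S: inner_space S G by fact
  interpret S': inner_space S' G' by fact
  have o: "S.orthonormal B" "S.orthonormal C" using B C by (auto simp: S.onb_def)
  have sub: "B \<subseteq> E" "C \<subseteq> E" "subspace E"
    using B C span_superset subspace_span by (auto simp: S.onb_def)
  have ES: "v \<in> S" if "v \<in> E" for v using S.onb_subset[OF B] that by auto
  have "G' (L b) (L b) = (\<Sum>c\<in>C. \<Sum>d\<in>C. G b c * G b d * G' (L c) (L d))" if b: "b \<in> B" for b
  proof -
    have e: "L b = (\<Sum>c\<in>C. G b c *\<^sub>R L c)"
    proof -
      have "L (\<Sum>c\<in>C. G b c *\<^sub>R c) = (\<Sum>c\<in>C. G b c *\<^sub>R L c)"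
        by (rule linear_on_space_sum[OF L(1) sub(3)]) (use sub in auto)
      then show ?thesis using S.onb_expand[OF C, of b] b sub(1) by auto
    qed
    have "G' (L b) (L b) = (\<Sum>c\<in>C. G b c * G' (L c) (L b))"
      by (subst e, rule S'.sum_left) (use L(2) sub b in auto)
    also have "\<dots> = (\<Sum>c\<in>C. G b c * (\<Sum>d\<in>C. G b d * G' (L c) (L d)))"
      by (intro sum.cong refl arg_cong2[of _ _ _ _ "(*)"], subst e, rule S'.sum_right)
        (use L(2) sub b in auto)
    finally show ?thesis by (simp add: sum_distrib_left mult.assoc)
  qed
  then have "(\<Sum>b\<in>B. G' (L b) (L b)) = (\<Sum>b\<in>B. \<Sum>c\<in>C. \<Sum>d\<in>C. G b c * G b d * G' (L c) (L d))"
    by simp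
  also have "\<dots> = (\<Sum>c\<in>C. \<Sum>b\<in>B. \<Sum>d\<in>C. G b c * G b d * G' (L c) (L d))"
    by (rule sum.swap)
  also have "\<dots> = (\<Sum>c\<in>C. \<Sum>d\<in>C. \<Sum>b\<in>B. G b c * G b d * G' (L c) (L d))"
    by (intro sum.cong refl sum.swap)
  also have "\<dots> = (\<Sum>c\<in>C. \<Sum>d\<in>C. G c d * G' (L c) (L d))"
  proof (intro sum.cong refl)
    fix c d assume "c \<in> C" "d \<in> C"
    then have "c \<in> E" "d \<in> E" using sub by auto
    then have "G c d = (\<Sum>b\<in>B. G b c * G b d)"
      using S.parseval[OF B \<open>c \<in> E\<close> ES[OF \<open>d \<in> E\<close>]] S.commute[OF ES[OF \<open>c \<in> E\<close>]] sub(1) ES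
      by (auto intro!: sum.cong)
    then show "(\<Sum>b\<in>B. G b c * G b d * G' (L c) (L d)) = G c d * G' (L c) (L d)"
      by (simp add: sum_distrib_right)
  qed
  also have "\<dots> = (\<Sum>c\<in>C. \<Sum>d\<in>C. if c = d then G' (L c) (L d) else 0)"
    by (intro sum.cong refl) (use S.orthonormalD(3)[OF o(2)] in auto)
  also have "\<dots> = (\<Sum>c\<in>C. G' (L c) (L c))"
    using S.orthonormalD(1)[OF o(2)] by (simp add: sum.delta)
  finally show ?thesis .
qed

text \<open>The squared norm of h is defined through a chosen basis; this permits a change to one
  adapted to D1 and D2. The basis is changed in one slot at a time.\<close>

lemma bilinear_sum_norm_sq_invariant:
  assumes S: "inner_space S G" and S': "inner_space S' G'"
    and B: "inner_space.onb S G E B" and C: "inner_space.onb S G E C"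
    and L: "\<And>v. v \<in> E \<Longrightarrow> linear_on_space E (\<lambda>u. h u v)" "\<And>u. u \<in> E \<Longrightarrow> linear_on_space E (h u)"
      "\<And>u v. u \<in> E \<Longrightarrow> v \<in> E \<Longrightarrow> h u v \<in> S'"
  shows "(\<Sum>a\<in>B. \<Sum>b\<in>B. G' (h a b) (h a b)) = (\<Sum>a\<in>C. \<Sum>b\<in>C. G' (h a b) (h a b))"
proof -
  have sub: "B \<subseteq> E" "C \<subseteq> E"
    using B C span_superset by (auto simp: inner_space.onb_def[OF S])
  have "(\<Sum>a\<in>B. \<Sum>b\<in>B. G' (h a b) (h a b)) = (\<Sum>a\<in>B. \<Sum>b\<in>C. G' (h a b) (h a b))"
    by (intro sum.cong refl sum_norm_sq_onb_invariant[OF S S' B C] L) (use sub in auto)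
  also have "\<dots> = (\<Sum>b\<in>C. \<Sum>a\<in>B. G' (h a b) (h a b))" by (rule sum.swap)
  also have "\<dots> = (\<Sum>b\<in>C. \<Sum>a\<in>C. G' (h a b) (h a b))"
    by (intro sum.cong refl sum_norm_sq_onb_invariant[OF S S' B C, where L = "\<lambda>u. h u _"] L)
      (use sub in auto)
  also have "\<dots> = (\<Sum>a\<in>C. \<Sum>b\<in>C. G' (h a b) (h a b))" by (rule sum.swap)
  finally show ?thesis .
qed

section \<open>Pointwise algebra of semi-slant submanifolds\<close>

text \<open>The linear algebra at a single point, with \<open>J\<close> the differential of the
  immersion. The bound \<open>dim_N\<close> is 2 n + 1 for n = m1 + 2 m2, because D1 has dimension 2
  m1 and D2 has dimension 2 m2.\<close>

locale semi_slant_point =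
  M: inner_space TM gM + N: inner_space TN G
  for TM :: "'a::real_vector set" and gM and TN :: "'b::real_vector set" and G +
  fixes J :: "'a \<Rightarrow> 'b" and phi :: "'b \<Rightarrow> 'b" and xi :: 'b
    and D1 D2 :: "'a set" and theta :: real
  assumes J_linear: "linear J"
    and J_in: "\<And>v. v \<in> TM \<Longrightarrow> J v \<in> TN"
    and J_isometry: "\<And>u v. u \<in> TM \<Longrightarrow> v \<in> TM \<Longrightarrow> G (J u) (J v) = gM u v"
    and phi_in: "\<And>v. v \<in> TN \<Longrightarrow> phi v \<in> TN"
    and phi_linear: "linear_on_space TN phi"
    and phi_skew: "\<And>u v. u \<in> TN \<Longrightarrow> v \<in> TN \<Longrightarrow> G (phi u) v = - G u (phi v)"
    and phi_isometry: "\<And>u v. u \<in> TN \<Longrightarrow> v \<in> TN \<Longrightarrow> G (phi u) (phi v) = G u v - G u xi * G v xi"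
    and xi_in: "xi \<in> TN" and xi_unit: "G xi xi = 1"
    and xi_normal: "\<And>v. v \<in> TM \<Longrightarrow> G xi (J v) = 0"
    and D1: "subspace D1" "D1 \<subseteq> TM"
    and D2: "D2 = {v \<in> TM. \<forall>w\<in>D1. gM v w = 0}"
    and decomposition: "TM = {u + v |u v. u \<in> D1 \<and> v \<in> D2}"
    and phi_D1: "phi ` J ` D1 \<subseteq> J ` D1"
    and slant: "\<And>x. x \<in> D2 \<Longrightarrow> x \<noteq> 0 \<Longrightarrow> subspace_angle G (phi (J x)) (J ` D2) = theta"
    and theta: "0 < theta" "theta < pi / 2"
    and finite_M: "\<exists>Y. finite Y \<and> TM \<subseteq> span Y"
    and dim_N: "\<exists>X. finite X \<and> TN \<subseteq> span X \<and> card X \<le> dim D1 + 2 * dim D2 + 1"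
begin

lemma decomposeE:
  assumes "u \<in> TM" obtains v w where "u = v + w" "v \<in> D1" "w \<in> D2"
proof -
  have "\<exists>v w. u = v + w \<and> v \<in> D1 \<and> w \<in> D2" using assms unfolding decomposition by simp
  then show ?thesis using that by blast
qed

lemma D2_sub: "D2 \<subseteq> TM" and D2_orth: "v \<in> D2 \<Longrightarrow> w \<in> D1 \<Longrightarrow> gM v w = 0"
  unfolding D2 by auto

lemma D1_in: "v \<in> D1 \<Longrightarrow> v \<in> TM" and D2_in: "v \<in> D2 \<Longrightarrow> v \<in> TM"
  using D1 D2_sub by auto

lemma D12_orth: "v \<in> D1 \<Longrightarrow> w \<in> D2 \<Longrightarrow> gM v w = 0"
  using D2_orth[of w v] M.commute[OF D1_in D2_in, of v w] by simp

lemma D2_subspace: "subspace D2"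
proof (rule subspaceI)
  show "0 \<in> D2" unfolding D2 using subspace_0[OF M.subspace] M.zero_left D1_in by auto
  show "x + y \<in> D2" if "x \<in> D2" "y \<in> D2" for x y
    using that M.add_left D1_in unfolding D2 by (auto intro: subspace_add[OF M.subspace])
  show "c *\<^sub>R x \<in> D2" if "x \<in> D2" for c x
    using that M.scale_left D1_in unfolding D2 by (auto intro: subspace_scale[OF M.subspace])
qed

lemma onb_D1: obtains B where "M.onb D1 B"
  using finite_M M.onb_exists[OF D1] D1(2) by (meson order_trans)

lemma onb_D2: obtains B where "M.onb D2 B"
  using finite_M M.onb_exists[OF D2_subspace D2_sub] D2_sub by (meson order_trans)

lemma J_onb:
  assumes "M.onb E B" shows "N.onb (J ` E) (J ` B)" "inj_on J TM"
proof -
  show inj: "inj_on J TM"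
  proof (rule inj_onI)
    fix u v assume uv: "u \<in> TM" "v \<in> TM" "J u = J v"
    have d: "u - v \<in> TM" using uv by (intro subspace_diff[OF M.subspace])
    have "J (u - v) = 0" using uv linear_diff[OF J_linear] by simp
    then have "gM (u - v) (u - v) = 0" using J_isometry[OF d d] N.zero_left[of 0] subspace_0[OF N.subspace] by simp
    then show "u = v" using M.eq_0_iff[OF d] by simp
  qed
  have o: "M.orthonormal B" and s: "span B = E" using assms by (auto simp: M.onb_def)
  note oD = M.orthonormalD[OF o]
  have "N.orthonormal (J ` B)"
    unfolding N.orthonormal_def using oD J_in J_isometry inj_on_eq_iff[OF inj] by auto
  moreover have "span (J ` B) = J ` E" using linear_span_image[OF J_linear, of B] s by simp
  ultimately show "N.onb (J ` E) (J ` B)" by (simp add: N.onb_def)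
qed

lemma onb_TM:
  assumes "M.onb D1 B1" "M.onb D2 B2"
  shows "M.onb TM (B1 \<union> B2)" "B1 \<inter> B2 = {}"
proof -
  have o: "M.orthonormal B1" "M.orthonormal B2" and s: "span B1 = D1" "span B2 = D2"
    using assms by (auto simp: M.onb_def)
  have b: "b \<in> B1 \<Longrightarrow> b \<in> D1" "c \<in> B2 \<Longrightarrow> c \<in> D2" for b c using s span_base by auto
  note u = M.orthonormal_Un[OF o D12_orth[OF b]]
  have "span (B1 \<union> B2) = TM" unfolding span_Un s decomposition by blast
  then show "M.onb TM (B1 \<union> B2)" using u(1) by (simp add: M.onb_def)
  show "B1 \<inter> B2 = {}" by (rule u(2))
qed

lemma normal_part:
  assumes v: "v \<in> TN"
  shows "v - orth_proj G (J ` TM) v \<in> TN"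
    and "u \<in> TM \<Longrightarrow> G (v - orth_proj G (J ` TM) v) (J u) = 0"
    and "\<exists>w\<in>TM. orth_proj G (J ` TM) v = J w"
proof -
  obtain B1 B2 where B: "M.onb D1 B1" "M.onb D2 B2" using onb_D1 onb_D2 by metis
  note p = N.orth_proj_onb[OF J_onb(1)[OF onb_TM(1)[OF B]] v]
  show "v - orth_proj G (J ` TM) v \<in> TN"
    unfolding p(1) by (rule subspace_diff[OF N.subspace v]) (use p(2) J_in in auto)
  show "G (v - orth_proj G (J ` TM) v) (J u) = 0" if "u \<in> TM" for u
    unfolding p(1) by (rule p(3)) (use that in auto)
  show "\<exists>w\<in>TM. orth_proj G (J ` TM) v = J w" unfolding p(1) using p(2) by auto
qed

lemma xi_J: "v \<in> TM \<Longrightarrow> G (J v) xi = 0"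
  using xi_normal N.commute[OF J_in xi_in] by simp

lemma phi_xi: "phi xi = 0"
  using phi_isometry[OF xi_in xi_in] N.eq_0_iff[OF phi_in[OF xi_in]] by (simp add: xi_unit)

lemma phi_J_xi: "v \<in> TM \<Longrightarrow> G (phi (J v)) xi = 0"
  using phi_skew[OF J_in xi_in] N.zero_right[OF J_in] by (simp add: phi_xi)

lemma phi_J_isometry: "u \<in> TM \<Longrightarrow> v \<in> TM \<Longrightarrow> G (phi (J u)) (phi (J v)) = gM u v"
  using phi_isometry[OF J_in J_in] xi_J J_isometry by simp

lemma phi_J_in: "v \<in> TM \<Longrightarrow> phi (J v) \<in> TN"
  by (rule phi_in[OF J_in])

text \<open>phi restricted to the invariant distribution D1 and read back through the injective map
  \<open>J\<close>.\<close>

definition phi1 :: "'a \<Rightarrow> 'a" where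
  "phi1 X = (SOME Y. Y \<in> D1 \<and> J Y = phi (J X))"

lemma phi1: "X \<in> D1 \<Longrightarrow> phi1 X \<in> D1" "X \<in> D1 \<Longrightarrow> J (phi1 X) = phi (J X)"
proof -
  have "phi1 X \<in> D1 \<and> J (phi1 X) = phi (J X)" if X: "X \<in> D1"
  proof -
    have "phi (J X) \<in> J ` D1" using phi_D1 X by auto
    then have "\<exists>Y. Y \<in> D1 \<and> J Y = phi (J X)" by auto
    then show ?thesis unfolding phi1_def by (rule someI_ex)
  qed
  then show "X \<in> D1 \<Longrightarrow> phi1 X \<in> D1" "X \<in> D1 \<Longrightarrow> J (phi1 X) = phi (J X)" by auto
qed

lemma phi1_skew: "X \<in> D1 \<Longrightarrow> Y \<in> D1 \<Longrightarrow> gM (phi1 X) Y = - gM X (phi1 Y)"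
  using J_isometry[of "phi1 X" Y] J_isometry[of X "phi1 Y"] phi1 D1_in phi_skew[OF J_in J_in, of X Y]
  by simp

lemma phi1_isometry: "X \<in> D1 \<Longrightarrow> gM (phi1 X) (phi1 X) = gM X X"
  using J_isometry[of "phi1 X" "phi1 X"] phi1 D1_in phi_J_isometry[of X X] by simp

text \<open>The projection is onto the image of D2 alone. It is nevertheless the whole tangential
  part of phi Z, because phi Z has no component along D1; see \<open>F_normal\<close>.\<close>

definition T :: "'a \<Rightarrow> 'a" where
  "T Z = (SOME Y. Y \<in> D2 \<and> J Y = orth_proj G (J ` D2) (phi (J Z)))"

lemma T_in: "Z \<in> D2 \<Longrightarrow> T Z \<in> D2"
  and J_T: "Z \<in> D2 \<Longrightarrow> J (T Z) = orth_proj G (J ` D2) (phi (J Z))"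
proof -
  have "T Z \<in> D2 \<and> J (T Z) = orth_proj G (J ` D2) (phi (J Z))" if Z: "Z \<in> D2"
  proof -
    obtain B where B: "M.onb D2 B" by (rule onb_D2)
    have "orth_proj G (J ` D2) (phi (J Z)) \<in> J ` D2"
      using N.orth_proj_onb(1,2)[OF J_onb(1)[OF B] phi_J_in[OF D2_in[OF Z]]] by simp
    then have "\<exists>Y. Y \<in> D2 \<and> J Y = orth_proj G (J ` D2) (phi (J Z))" by auto
    then show ?thesis unfolding T_def by (rule someI_ex)
  qed
  then show "Z \<in> D2 \<Longrightarrow> T Z \<in> D2"
    "Z \<in> D2 \<Longrightarrow> J (T Z) = orth_proj G (J ` D2) (phi (J Z))" by auto
qed

definition F :: "'a \<Rightarrow> 'b" where
  "F Z = phi (J Z) - J (T Z)"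

lemma F_in: "Z \<in> D2 \<Longrightarrow> F Z \<in> TN"
  unfolding F_def by (intro subspace_diff[OF N.subspace] phi_J_in J_in D2_in T_in)

text \<open>Against D2 this is the projection property. Against D1 both terms vanish: skewness moves
  phi to the D1 vector, where it stays in D1, and T Z lies in D2.\<close>

lemma F_normal:
  assumes Z: "Z \<in> D2" and u: "u \<in> TM" shows "G (F Z) (J u) = 0"
proof -
  obtain B where B: "M.onb D2 B" by (rule onb_D2)
  obtain v w where vw: "u = v + w" "v \<in> D1" "w \<in> D2" using decomposeE[OF u] .
  note J = J_in[OF D1_in[OF vw(2)]] J_in[OF D2_in[OF vw(3)]]
  have "G (F Z) (J w) = 0"
    using N.orth_proj_onb(3)[OF J_onb(1)[OF B] phi_J_in[OF D2_in[OF Z]], of "J w"] vw(3)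
      N.orth_proj_onb(1)[OF J_onb(1)[OF B] phi_J_in[OF D2_in[OF Z]]]
    by (simp add: F_def J_T[OF Z])
  moreover have "G (F Z) (J v) = 0"
  proof -
    have "G (phi (J Z)) (J v) = - gM Z (phi1 v)"
      using phi_skew[OF J_in[OF D2_in[OF Z]] J(1)] phi1[OF vw(2)]
        J_isometry[OF D2_in[OF Z] D1_in[OF phi1(1)[OF vw(2)]]] by simp
    then show ?thesis
      unfolding F_def
      using N.diff_left[OF J(1) phi_J_in[OF D2_in[OF Z]] J_in[OF D2_in[OF T_in[OF Z]]]]
        J_isometry[OF D2_in[OF T_in[OF Z]] D1_in[OF vw(2)]]
        D2_orth[OF Z phi1(1)[OF vw(2)]] D2_orth[OF T_in[OF Z] vw(2)] by simp
  qed
  ultimately show ?thesis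
    using N.add_right[OF F_in[OF Z] J] linear_add[OF J_linear, of v w] vw(1) by simp
qed

lemma F_normal': "Z \<in> D2 \<Longrightarrow> u \<in> TM \<Longrightarrow> G (J u) (F Z) = 0"
  using F_normal N.commute[OF F_in J_in] by simp

lemma phi_J_eq: "phi (J Z) = J (T Z) + F Z"
  by (simp add: F_def)

lemma G_phi_J: "Z \<in> D2 \<Longrightarrow> u \<in> TM \<Longrightarrow> G (phi (J Z)) (J u) = gM (T Z) u"
  unfolding phi_J_eq
  using N.add_left[OF J_in J_in[OF D2_in[OF T_in]] F_in] F_normal J_isometry[OF D2_in[OF T_in]] by simp

lemma T_skew: "Z \<in> D2 \<Longrightarrow> W \<in> D2 \<Longrightarrow> gM (T Z) W = - gM Z (T W)"
  using G_phi_J[OF _ D2_in, of Z W] G_phi_J[OF _ D2_in, of W Z] phi_skew[OF J_in J_in, of Z W]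
    N.commute[OF phi_J_in J_in, of W Z] M.commute[of "T W" Z] T_in D2_in by simp

lemma T_eqI: "W \<in> D2 \<Longrightarrow> (\<And>u. u \<in> D2 \<Longrightarrow> gM W u = gM W' u) \<Longrightarrow> W' \<in> D2 \<Longrightarrow> W = W'"
  using M.eq_0_iff[of "W - W'"] M.diff_left[of "W - W'" W W'] subspace_diff[OF D2_subspace] D2_in
  by auto

text \<open>Both sides lie in D2 and are tested against D2. Skewness moves \<open>T\<close> onto the
  test vector, and what remains is additivity of the metric.\<close>

lemma T_add:
  assumes "Z \<in> D2" "W \<in> D2" shows "T (Z + W) = T Z + T W"
proof (rule T_eqI)
  note Z = assms(1) and W = assms(2)
  have ZW: "Z + W \<in> D2" by (rule subspace_add[OF D2_subspace Z W])
  show "T (Z + W) \<in> D2" "T Z + T W \<in> D2"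
    using T_in[OF ZW] subspace_add[OF D2_subspace T_in[OF Z] T_in[OF W]] by auto
  fix u assume u: "u \<in> D2"
  note i = D2_in[OF T_in[OF Z]] D2_in[OF T_in[OF W]] D2_in[OF T_in[OF u]] D2_in[OF u]
  show "gM (T (Z + W)) u = gM (T Z + T W) u"
    using T_skew[OF ZW u] M.add_left[OF i(3) D2_in[OF Z] D2_in[OF W]] T_skew[OF Z u] T_skew[OF W u]
      M.add_left[OF i(4,1,2)] by simp
qed

lemma G_F_F:
  assumes Z: "Z \<in> D2" and W: "W \<in> D2"
  shows "G (F Z) (F W) = gM Z W - gM (T Z) (T W)"
proof -
  note i = J_in[OF D2_in[OF T_in[OF Z]]] J_in[OF D2_in[OF T_in[OF W]]] F_in[OF Z] F_in[OF W]
  have "gM Z W = G (J (T Z) + F Z) (J (T W) + F W)"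
    using phi_J_isometry[OF D2_in[OF Z] D2_in[OF W]] by (simp add: phi_J_eq)
  also have "\<dots> = gM (T Z) (T W) + G (F Z) (F W)"
    using N.add_left[OF subspace_add[OF N.subspace i(2,4)] i(1,3)]
      N.add_right[OF i(1) i(2,4)] N.add_right[OF i(3) i(2,4)]
      F_normal[OF Z D2_in[OF T_in[OF W]]] F_normal'[OF W D2_in[OF T_in[OF Z]]]
      J_isometry[OF D2_in[OF T_in[OF Z]] D2_in[OF T_in[OF W]]] by simp
  finally show ?thesis by simp
qed

text \<open>The cosine of the slant angle is |T Z| / |Z|, because g(phi Z, T Z) = |T Z|^2 and |phi
  Z| = |Z|. The slant condition says nothing about Z = 0, which is treated apart.\<close>

lemma T_norm:
  assumes Z: "Z \<in> D2" shows "gM (T Z) (T Z) = (cos theta)\<^sup>2 * gM Z Z"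
proof (cases "Z = 0")
  case True
  have "T Z + T Z = T Z" using T_add[OF Z Z] True by simp
  then have "T Z = 0" by simp
  then show ?thesis using True M.zero_left[OF D2_in[OF Z]] by simp
next
  case False
  let ?a = "gM (T Z) (T Z)" and ?b = "gM Z Z"
  have TZ: "T Z \<in> TM" and ZM: "Z \<in> TM" using T_in[OF Z] Z D2_in by auto
  have b: "?b > 0" using M.pos[OF ZM False] .
  have a: "0 \<le> ?a" using M.nonneg[OF TZ] .
  have ab: "?a \<le> ?b" using G_F_F[OF Z Z] N.nonneg[OF F_in[OF Z]] by simp
  \<comment> \<open>If \<open>?a\<close> is 0, division by 0 makes the left side 0, in agreement
    with the right side.\<close>
  have q: "?a / (sqrt ?b * sqrt ?a) = sqrt (?a / ?b)"
    using a b by (cases "?a = 0") (auto simp: real_sqrt_divide field_simps)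
  have "theta = arccos (?a / (sqrt ?b * sqrt ?a))"
    using slant[OF Z False] J_T[OF Z, symmetric] G_phi_J[OF Z TZ] J_isometry[OF TZ TZ]
      phi_J_isometry[OF ZM ZM] by (simp add: subspace_angle_def vec_angle_def)
  then have "theta = arccos (sqrt (?a / ?b))" unfolding q .
  \<comment> \<open>The bound by 1 is \<open>ab\<close>, that is, nonnegativity of |F Z|^2; it puts
    the quotient where cos inverts arccos.\<close>
  moreover have "0 \<le> sqrt (?a / ?b)" "sqrt (?a / ?b) \<le> 1" using a b ab by auto
  moreover from this have "cos (arccos (sqrt (?a / ?b))) = sqrt (?a / ?b)"
    by (intro cos_arccos) linarith+
  ultimately have "cos theta = sqrt (?a / ?b)" by simp
  then show ?thesis using a b by (simp add: field_simps)
qed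

text \<open>Polarisation of \<open>T_norm\<close>, using additivity of \<open>T\<close>.\<close>

lemma T_inner:
  assumes Z: "Z \<in> D2" and W: "W \<in> D2"
  shows "gM (T Z) (T W) = (cos theta)\<^sup>2 * gM Z W"
proof -
  have polar: "gM (u + v) (u + v) = gM u u + 2 * gM u v + gM v v" if "u \<in> TM" "v \<in> TM" for u v
    using M.add_left[OF subspace_add[OF M.subspace that] that] M.add_right[OF that(1) that]
      M.add_right[OF that(2) that] M.commute[OF that] by simp
  have "gM (T Z + T W) (T Z + T W) = (cos theta)\<^sup>2 * gM (Z + W) (Z + W)"
    using T_norm[OF subspace_add[OF D2_subspace Z W]] T_add[OF Z W] by simp
  then show ?thesis
    using polar[OF D2_in[OF T_in[OF Z]] D2_in[OF T_in[OF W]]] polar[OF D2_in[OF Z] D2_in[OF W]]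
      T_norm[OF Z] T_norm[OF W] by (simp add: algebra_simps)
qed

text \<open>Hence \<open>F\<close> divided by sin theta is an isometry of D2 into the normal space;
  this is where the cosecant comes from.\<close>

lemma F_inner:
  assumes Z: "Z \<in> D2" and W: "W \<in> D2"
  shows "G (F Z) (F W) = (sin theta)\<^sup>2 * gM Z W"
  unfolding G_F_F[OF Z W] T_inner[OF Z W] sin_squared_eq by (simp add: algebra_simps)

lemma F_xi: "Z \<in> D2 \<Longrightarrow> G (F Z) xi = 0"
  unfolding F_def
  using N.diff_left[OF xi_in phi_J_in J_in] phi_J_xi xi_J D2_in T_in by simp

lemma sin_pos: "sin theta > 0"
  using theta pi_gt_zero by (intro sin_gt_zero) linarith+

definition normal_space :: "'b set" where
  "normal_space = {v \<in> TN. \<forall>u\<in>TM. G v (J u) = 0}"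

text \<open>By the dimension assumption the normal space is spanned by \<open>F D2\<close> and \<open>xi\<close>.\<close>

lemma normal_norm_sq:
  assumes B: "M.onb D2 B" and v: "v \<in> normal_space" and vxi: "G v xi = 0"
  shows "G v v = (1 / sin theta)\<^sup>2 * (\<Sum>b\<in>B. (G v (F b))\<^sup>2)"
proof -
  obtain B1 where B1: "M.onb D1 B1" by (rule onb_D1)
  let ?f = "\<lambda>b. (1 / sin theta) *\<^sub>R F b"
  have o: "M.orthonormal B" and s: "span B = D2" using B by (auto simp: M.onb_def)
  have bD: "b \<in> D2" if "b \<in> B" for b using that s span_base by auto
  have f_in: "?f b \<in> TN" if "b \<in> B" for b
    by (intro subspace_scale[OF N.subspace] F_in bD that)
  have ff: "G (?f a) (?f b) = (if a = b then 1 else 0)" if "a \<in> B" "b \<in> B" for a b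
    using N.scale_left[OF F_in[OF bD[OF that(1)]] f_in[OF that(2)]]
      N.scale_right[OF F_in[OF bD[OF that(1)]] F_in[OF bD[OF that(2)]]]
      F_inner[OF bD[OF that(1)] bD[OF that(2)]] M.orthonormalD(3)[OF o that] sin_pos
    by (simp add: power2_eq_square)
  have inj: "inj_on ?f B"
    by (rule inj_onI) (metis ff zero_neq_one)
  have of: "N.orthonormal (?f ` B)"
    unfolding N.orthonormal_def using M.orthonormalD(1)[OF o] f_in ff inj_on_eq_iff[OF inj] by auto
  have ox: "N.orthonormal {xi}" using xi_in xi_unit by (simp add: N.orthonormal_def)
  have fx: "G (?f b) xi = 0" if "b \<in> B" for b
    using N.scale_left[OF F_in[OF bD[OF that]] xi_in] F_xi[OF bD[OF that]] by simp
  have C: "N.orthonormal (?f ` B \<union> {xi})" "?f ` B \<inter> {xi} = {}"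
    using N.orthonormal_Un[OF of ox] fx by auto
  let ?E = "J ` (B1 \<union> B)"
  note oE = J_onb(1)[OF onb_TM(1)[OF B1 B]]
  have tn: "G (J u) c = 0" if "u \<in> TM" "c \<in> ?f ` B \<union> {xi}" for u c
    using that N.scale_right[OF J_in[OF that(1)] F_in[OF bD]] F_normal'[OF bD that(1)] xi_J[OF that(1)]
    by auto
  have sub: "B1 \<union> B \<subseteq> TM"
    using onb_TM(1)[OF B1 B] span_superset[of "B1 \<union> B"] unfolding M.onb_def by blast
  have tE: "G e c = 0" if e: "e \<in> ?E" and c: "c \<in> ?f ` B \<union> {xi}" for e c
  proof -
    obtain u where "e = J u" "u \<in> TM" using e sub by blast
    then show ?thesis using tn c by simp
  qed
  have E: "N.orthonormal ?E" using oE unfolding N.onb_def by simp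
  note O = N.orthonormal_Un[OF E C(1) tE]
  obtain X where X: "finite X" "TN \<subseteq> span X" "card X \<le> dim D1 + 2 * dim D2 + 1" using dim_N by blast
  have fin: "finite B1" "finite B"
    using B1 B M.orthonormalD(1) by (auto simp: M.onb_def)
  have "card ?E = card (B1 \<union> B)"
    by (rule card_image) (rule inj_on_subset[OF J_onb(2)[OF B1] sub])
  also have "\<dots> = dim D1 + dim D2"
    using card_Un_disjoint[OF fin onb_TM(2)[OF B1 B]] M.onb_card[OF B1] M.onb_card[OF B] by simp
  finally have cE: "card ?E = dim D1 + dim D2" .
  have cC: "card (?f ` B \<union> {xi}) = dim D2 + 1"
    using card_Un_disjoint[OF _ _ C(2)] card_image[OF inj] fin M.onb_card[OF B] by simp
  \<comment> \<open>The frame has dim D1 + dim D2 tangent and dim D2 + 1 normal vectors, exactly the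
    bound on a spanning set of TN, so it is complete.\<close>
  have "card (?E \<union> (?f ` B \<union> {xi})) = dim D1 + 2 * dim D2 + 1"
    using card_Un_disjoint[OF _ _ O(2)] cE cC fin by simp
  then have full: "N.onb TN (?E \<union> (?f ` B \<union> {xi}))"
    using N.orthonormal_full[OF O(1) X(1,2)] X(3) by simp
  have vT: "v \<in> TN" and vJ: "\<And>u. u \<in> TM \<Longrightarrow> G v (J u) = 0"
    using v by (auto simp: normal_space_def)
  have "G v v = (\<Sum>b\<in>?E \<union> (?f ` B \<union> {xi}). G v b * G b v)"
    by (rule N.parseval[OF full vT vT])
  also have "\<dots> = (\<Sum>b\<in>?E. G v b * G b v) + ((\<Sum>b\<in>?f ` B. G v b * G b v) + (\<Sum>b\<in>{xi}. G v b * G b v))"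
    using fin C(2) O(2) by (subst sum.union_disjoint, simp, simp, blast)+ (simp)
  also have "(\<Sum>b\<in>?E. G v b * G b v) = 0" by (rule sum.neutral) (use vJ sub in auto)
  also have "(\<Sum>b\<in>?f ` B. G v b * G b v) = (\<Sum>b\<in>B. (1 / sin theta)\<^sup>2 * (G v (F b))\<^sup>2)"
    unfolding sum.reindex[OF inj] o_def
  proof (rule sum.cong[OF refl])
    fix b assume b: "b \<in> B"
    have "G v (?f b) = (1 / sin theta) * G v (F b)" by (rule N.scale_right[OF vT F_in[OF bD[OF b]]])
    then show "G v (?f b) * G (?f b) v = (1 / sin theta)\<^sup>2 * (G v (F b))\<^sup>2"
      using N.commute[OF vT f_in[OF b]] by (simp add: power2_eq_square)
  qed
  finally show ?thesis using vxi by (simp add: sum_distrib_left)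
qed

end

text \<open>
  \<open>dd u v\<close> is the ambient covariant derivative, in the direction \<open>u\<close>, of an extension of \<open>v\<close>, and
  \<open>lam\<close> is the differential of the logarithm of the warping function.
\<close>

locale warped_point = semi_slant_point +
  fixes dd :: "'a \<Rightarrow> 'a \<Rightarrow> 'b" and lam :: "'a \<Rightarrow> real"
  assumes dd_in: "\<And>u v. u \<in> TM \<Longrightarrow> v \<in> TM \<Longrightarrow> dd u v \<in> TN"
    and dd_linear: "\<And>v. v \<in> TM \<Longrightarrow> linear_on_space TM (\<lambda>u. dd u v)"
    and dd_commute: "\<And>u v. u \<in> TM \<Longrightarrow> v \<in> TM \<Longrightarrow> dd u v = dd v u"
    and dd_xi: "\<And>u v. u \<in> TM \<Longrightarrow> v \<in> TM \<Longrightarrow> G (dd u v) xi = 0"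
    and dd11: "\<And>X Y Z. X \<in> D1 \<Longrightarrow> Y \<in> D1 \<Longrightarrow> Z \<in> D2 \<Longrightarrow> G (dd X Y) (J Z) = 0"
      "\<And>X Y Z. X \<in> D1 \<Longrightarrow> Y \<in> D1 \<Longrightarrow> Z \<in> D2 \<Longrightarrow> G (dd X Y) (phi (J Z)) = 0"
    and dd12: "\<And>X Z W. X \<in> D1 \<Longrightarrow> Z \<in> D2 \<Longrightarrow> W \<in> D2 \<Longrightarrow> G (dd X Z) (J W) = lam X * gM Z W"
      "\<And>X Y Z W. X \<in> D1 \<Longrightarrow> Y \<in> D1 \<Longrightarrow> J Y = phi (J X) \<Longrightarrow> Z \<in> D2 \<Longrightarrow> W \<in> D2 \<Longrightarrow>
        G (dd X Z) (phi (J W)) = - lam Y * gM Z W"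
    and lam_linear: "linear_on_space TM lam"
    and lam_D2: "\<And>Z. Z \<in> D2 \<Longrightarrow> lam Z = 0"
begin

section \<open>The second fundamental form at one point\<close>

definition sff :: "'a \<Rightarrow> 'a \<Rightarrow> 'b" where
  "sff u v = dd u v - orth_proj G (J ` TM) (dd u v)"

lemma sff_in: "u \<in> TM \<Longrightarrow> v \<in> TM \<Longrightarrow> sff u v \<in> TN"
  and sff_normal: "u \<in> TM \<Longrightarrow> v \<in> TM \<Longrightarrow> w \<in> TM \<Longrightarrow> G (sff u v) (J w) = 0"
  unfolding sff_def using normal_part dd_in by blast+

lemma sff_normal_space: "u \<in> TM \<Longrightarrow> v \<in> TM \<Longrightarrow> sff u v \<in> normal_space"
  by (simp add: normal_space_def sff_in sff_normal)

lemma sff_commute: "u \<in> TM \<Longrightarrow> v \<in> TM \<Longrightarrow> sff u v = sff v u"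
  using dd_commute by (simp add: sff_def)

lemma G_sff_normal:
  assumes uv: "u \<in> TM" "v \<in> TM" and n: "n \<in> normal_space"
  shows "G (sff u v) n = G (dd u v) n"
proof -
  obtain w where w: "w \<in> TM" "orth_proj G (J ` TM) (dd u v) = J w"
    using normal_part(3)[OF dd_in[OF uv]] by blast
  have nT: "n \<in> TN" "G n (J w) = 0" using n w by (auto simp: normal_space_def)
  then have "G (J w) n = 0" using N.commute[OF nT(1) J_in[OF w(1)]] by simp
  then show ?thesis
    unfolding sff_def w(2) using N.diff_left[OF nT(1) dd_in[OF uv] J_in[OF w(1)]] by simp
qed

lemma F_normal_space: "Z \<in> D2 \<Longrightarrow> F Z \<in> normal_space"
  using F_in F_normal by (simp add: normal_space_def)

lemma xi_normal_space: "xi \<in> normal_space"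
  using xi_in xi_normal by (simp add: normal_space_def)

lemma sff_xi: "u \<in> TM \<Longrightarrow> v \<in> TM \<Longrightarrow> G (sff u v) xi = 0"
  using G_sff_normal[OF _ _ xi_normal_space] dd_xi by simp

lemma G_sff_F:
  assumes uv: "u \<in> TM" "v \<in> TM" and Z: "Z \<in> D2"
  shows "G (sff u v) (F Z) = G (dd u v) (phi (J Z)) - G (dd u v) (J (T Z))"
  using G_sff_normal[OF uv F_normal_space[OF Z]]
    N.diff_right[OF dd_in[OF uv] phi_J_in[OF D2_in[OF Z]] J_in[OF D2_in[OF T_in[OF Z]]]]
  by (simp add: F_def)

text \<open>Both terms of \<open>G_sff_F\<close> vanish by \<open>dd11\<close> and the xi-component
  by \<open>sff_xi\<close>, so every component in the normal frame is 0.\<close>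

lemma sff11:
  assumes "X \<in> D1" "Y \<in> D1" shows "sff X Y = 0"
proof -
  obtain B where B: "M.onb D2 B" by (rule onb_D2)
  have "b \<in> D2" if "b \<in> B" for b using that B span_base by (auto simp: M.onb_def)
  then have "G (sff X Y) (F b) = 0" if "b \<in> B" for b
    using G_sff_F[OF D1_in[OF assms(1)] D1_in[OF assms(2)], of b] dd11 assms T_in that by simp
  then have "G (sff X Y) (sff X Y) = 0"
    using normal_norm_sq[OF B sff_normal_space sff_xi] assms D1_in by simp
  then show ?thesis using N.eq_0_iff[OF sff_in] assms D1_in by simp
qed

text \<open>The component along F b is - lam (phi1 X) gM Z b + lam X gM (T Z) b. Parseval sums the
  squares over b, and the mixed term is a multiple of gM Z (T Z), which is 0 by skewness.\<close>

lemma sff12_norm: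
  assumes X: "X \<in> D1" and Z: "Z \<in> D2"
  shows "G (sff X Z) (sff X Z) =
    (1 / sin theta)\<^sup>2 * ((lam (phi1 X))\<^sup>2 + (cos theta)\<^sup>2 * (lam X)\<^sup>2) * gM Z Z"
proof -
  obtain B where B: "M.onb D2 B" by (rule onb_D2)
  have bD: "b \<in> D2" if "b \<in> B" for b using that B span_base by (auto simp: M.onb_def)
  note XM = D1_in[OF X] and ZM = D2_in[OF Z] and TZ = T_in[OF Z]
  let ?a = "lam (phi1 X)" and ?c = "lam X"
  have "(G (sff X Z) (F b))\<^sup>2 =
      ?a\<^sup>2 * (gM Z b * gM b Z) - 2 * ?a * ?c * (gM Z b * gM b (T Z)) + ?c\<^sup>2 * (gM (T Z) b * gM b (T Z))"
    if b: "b \<in> B" for b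
  proof -
    have "G (sff X Z) (F b) = - ?a * gM Z b - ?c * gM Z (T b)"
      using G_sff_F[OF XM ZM bD[OF b]] dd12(1)[OF X Z T_in[OF bD[OF b]]]
        dd12(2)[OF X phi1(1)[OF X] phi1(2)[OF X] Z bD[OF b]] by simp
    also have "gM Z (T b) = - gM (T Z) b" using T_skew[OF Z bD[OF b]] by simp
    finally have "(G (sff X Z) (F b))\<^sup>2 = (- ?a * gM Z b + ?c * gM (T Z) b)\<^sup>2" by simp
    moreover have "gM b Z = gM Z b" "gM b (T Z) = gM (T Z) b"
      using M.commute[OF D2_in[OF bD[OF b]] ZM] M.commute[OF D2_in[OF bD[OF b]] D2_in[OF TZ]] by auto
    ultimately show ?thesis by (simp add: power2_eq_square algebra_simps)
  qed
  then have "(\<Sum>b\<in>B. (G (sff X Z) (F b))\<^sup>2) =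
      ?a\<^sup>2 * (\<Sum>b\<in>B. gM Z b * gM b Z) - 2 * ?a * ?c * (\<Sum>b\<in>B. gM Z b * gM b (T Z)) +
      ?c\<^sup>2 * (\<Sum>b\<in>B. gM (T Z) b * gM b (T Z))"
    by (simp add: sum.distrib sum_subtractf sum_distrib_left)
  also have "\<dots> = ?a\<^sup>2 * gM Z Z - 2 * ?a * ?c * gM Z (T Z) + ?c\<^sup>2 * gM (T Z) (T Z)"
    using M.parseval[OF B Z ZM] M.parseval[OF B Z D2_in[OF TZ]] M.parseval[OF B TZ D2_in[OF TZ]] by simp
  also have "gM Z (T Z) = 0" using T_skew[OF Z Z] M.commute[OF ZM D2_in[OF TZ]] by simp
  finally show ?thesis
    using normal_norm_sq[OF B sff_normal_space[OF XM ZM] sff_xi[OF XM ZM]] T_norm[OF Z]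
    by (simp add: algebra_simps)
qed

text \<open>Riesz representation in finite dimension; it justifies the definite description in
  \<open>gradient\<close>.\<close>

lemma grad_exists: "\<exists>!v. v \<in> TM \<and> (\<forall>u\<in>TM. gM v u = lam u)"
proof -
  obtain B1 B2 where B: "M.onb D1 B1" "M.onb D2 B2" using onb_D1 onb_D2 by metis
  let ?B = "B1 \<union> B2"
  note B' = onb_TM(1)[OF B]
  have o: "M.orthonormal ?B" using B' by (simp add: M.onb_def)
  have bT: "b \<in> TM" if "b \<in> ?B" for b using M.orthonormalD(2)[OF o that] .
  let ?v = "\<Sum>b\<in>?B. lam b *\<^sub>R b"
  have v: "?v \<in> TM" by (rule M.lincomb_in) (rule bT)
  have "gM ?v u = lam u" if u: "u \<in> TM" for u
  proof -
    have "gM ?v u = (\<Sum>b\<in>?B. lam b * gM b u)" by (rule M.sum_left[OF u bT])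
    also have "\<dots> = (\<Sum>b\<in>?B. gM u b *\<^sub>R lam b)"
      by (intro sum.cong refl) (use M.commute[OF u bT] in auto)
    also have "\<dots> = lam (\<Sum>b\<in>?B. gM u b *\<^sub>R b)"
      by (rule linear_on_space_sum[OF lam_linear M.subspace, symmetric]) (rule bT)
    also have "\<dots> = lam u" using M.onb_expand[OF B' u] by simp
    finally show ?thesis .
  qed
  then have ex: "?v \<in> TM \<and> (\<forall>u\<in>TM. gM ?v u = lam u)" using v by blast
  show ?thesis
  proof (rule ex1I)
    show "?v \<in> TM \<and> (\<forall>u\<in>TM. gM ?v u = lam u)" by (rule ex)
    fix w assume w: "w \<in> TM \<and> (\<forall>u\<in>TM. gM w u = lam u)"
    have d: "w - ?v \<in> TM" using w v by (intro subspace_diff[OF M.subspace]) auto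
    have "gM (w - ?v) (w - ?v) = 0" using M.diff_left[OF d] w ex d by simp
    then show "w = ?v" using M.eq_0_iff[OF d] by simp
  qed
qed

text \<open>\<open>dd\<close> is linear in this slot by assumption, and the projection is linear
  because an orthonormal basis gives it by inner products.\<close>

lemma sff_linear_left: assumes v: "v \<in> TM" shows "linear_on_space TM (\<lambda>u. sff u v)"
  unfolding linear_on_space_def
proof (intro ballI allI)
  fix u w a b assume u: "u \<in> TM" and w: "w \<in> TM"
  obtain B1 B2 where B: "M.onb D1 B1" "M.onb D2 B2" using onb_D1 onb_D2 by metis
  let ?P = "orth_proj G (J ` TM)"
  have c: "N.onb (J ` TM) (J ` (B1 \<union> B2))" by (rule J_onb(1)[OF onb_TM(1)[OF B]])
  then have "N.orthonormal (J ` (B1 \<union> B2))" unfolding N.onb_def by simp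
  note bN = N.orthonormalD(2)[OF this]
  have i: "dd u v \<in> TN" "dd w v \<in> TN" "a *\<^sub>R dd u v + b *\<^sub>R dd w v \<in> TN"
    using dd_in u w v by (auto intro!: subspace_add[OF N.subspace] subspace_scale[OF N.subspace])
  have "?P (a *\<^sub>R dd u v + b *\<^sub>R dd w v) = a *\<^sub>R ?P (dd u v) + b *\<^sub>R ?P (dd w v)"
    unfolding N.orth_proj_onb(1)[OF c i(1)] N.orth_proj_onb(1)[OF c i(2)] N.orth_proj_onb(1)[OF c i(3)]
      scaleR_sum_right sum.distrib[symmetric]
  proof (intro sum.cong refl)
    fix x assume x: "x \<in> J ` (B1 \<union> B2)"
    have "G (a *\<^sub>R dd u v + b *\<^sub>R dd w v) x = a * G (dd u v) x + b * G (dd w v) x"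
      using N.linear_left[OF bN[OF x]] i by (simp add: linear_on_space_def)
    then show "G (a *\<^sub>R dd u v + b *\<^sub>R dd w v) x *\<^sub>R x = a *\<^sub>R G (dd u v) x *\<^sub>R x + b *\<^sub>R G (dd w v) x *\<^sub>R x"
      by (simp add: scaleR_add_left)
  qed
  moreover have "dd (a *\<^sub>R u + b *\<^sub>R w) v = a *\<^sub>R dd u v + b *\<^sub>R dd w v"
    using dd_linear[OF v] u w by (simp add: linear_on_space_def)
  ultimately show "sff (a *\<^sub>R u + b *\<^sub>R w) v = a *\<^sub>R sff u v + b *\<^sub>R sff w v"
    by (simp add: sff_def scaleR_diff_right)
qed

text \<open>\<open>dd\<close> is given as linear in its first slot; symmetry carries this over to
  the second.\<close>

lemma sff_linear_right: assumes u: "u \<in> TM" shows "linear_on_space TM (sff u)"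
  unfolding linear_on_space_def
proof (intro ballI allI)
  fix v w a b assume vw: "v \<in> TM" "w \<in> TM"
  then have "a *\<^sub>R v + b *\<^sub>R w \<in> TM"
    by (auto intro!: subspace_add[OF M.subspace] subspace_scale[OF M.subspace])
  then show "sff u (a *\<^sub>R v + b *\<^sub>R w) = a *\<^sub>R sff u v + b *\<^sub>R sff u w"
    using sff_linear_left[OF u] vw sff_commute[OF u] by (simp add: linear_on_space_def)
qed

text \<open>A sum of squared lengths vanishes only termwise, and bilinearity carries the vanishing
  from the basis to all of D2.\<close>

lemma sff22_eq_0_iff:
  assumes B: "M.onb D2 B"
  shows "(\<Sum>a\<in>B. \<Sum>b\<in>B. G (sff a b) (sff a b)) = 0 \<longleftrightarrow> (\<forall>v\<in>D2. \<forall>w\<in>D2. sff v w = 0)"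
proof -
  have o: "M.orthonormal B" using B by (simp add: M.onb_def)
  have bD: "b \<in> D2" if "b \<in> B" for b using that B span_base by (auto simp: M.onb_def)
  note bM = D2_in[OF bD] and fin = M.orthonormalD(1)[OF o]
  have nn: "G (sff a b) (sff a b) \<ge> 0" if "a \<in> B" "b \<in> B" for a b
    using N.nonneg[OF sff_in] bM that by simp
  have "(\<Sum>a\<in>B. \<Sum>b\<in>B. G (sff a b) (sff a b)) = 0 \<longleftrightarrow> (\<forall>a\<in>B. \<forall>b\<in>B. G (sff a b) (sff a b) = 0)"
    using nn by (simp add: sum_nonneg_eq_0_iff[OF fin] sum_nonneg)
  also have "\<dots> \<longleftrightarrow> (\<forall>a\<in>B. \<forall>b\<in>B. sff a b = 0)"
    using N.eq_0_iff[OF sff_in] bM by simp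
  also have "\<dots> \<longleftrightarrow> (\<forall>v\<in>D2. \<forall>w\<in>D2. sff v w = 0)"
  proof
    assume z: "\<forall>a\<in>B. \<forall>b\<in>B. sff a b = 0"
    show "\<forall>v\<in>D2. \<forall>w\<in>D2. sff v w = 0"
    proof (intro ballI)
      fix v w assume v: "v \<in> D2" and w: "w \<in> D2"
      have 1: "sff v b = 0" if b: "b \<in> B" for b
      proof -
        have "sff (\<Sum>a\<in>B. gM v a *\<^sub>R a) b = (\<Sum>a\<in>B. gM v a *\<^sub>R sff a b)"
          by (rule linear_on_space_sum[OF sff_linear_left[OF bM[OF b]] M.subspace]) (rule bM)
        then show ?thesis using M.onb_expand[OF B v] z b by simp
      qed
      have "sff v (\<Sum>b\<in>B. gM w b *\<^sub>R b) = (\<Sum>b\<in>B. gM w b *\<^sub>R sff v b)"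
        by (rule linear_on_space_sum[OF sff_linear_right[OF D2_in[OF v]] M.subspace]) (rule bM)
      then show "sff v w = 0" using M.onb_expand[OF B w] 1 by simp
    qed
  qed (use bD in blast)
  finally show ?thesis .
qed

theorem sff_norm_sq:
  assumes B: "M.onb TM B" and B2: "M.onb D2 B2"
    and grad: "grad \<in> TM" "\<And>u. u \<in> TM \<Longrightarrow> gM grad u = lam u"
  shows "(\<Sum>a\<in>B. \<Sum>b\<in>B. G (sff a b) (sff a b)) =
    2 * real (card B2) * ((1 / sin theta)\<^sup>2 + (cot theta)\<^sup>2) * gM grad grad +
    (\<Sum>a\<in>B2. \<Sum>b\<in>B2. G (sff a b) (sff a b))"
proof -
  obtain B1 where B1: "M.onb D1 B1" by (rule onb_D1)
  note B12 = onb_TM[OF B1 B2]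
  have b1: "b \<in> D1" if "b \<in> B1" for b using that B1 span_base by (auto simp: M.onb_def)
  have b2: "b \<in> D2" if "b \<in> B2" for b using that B2 span_base by (auto simp: M.onb_def)
  have o: "M.orthonormal B1" "M.orthonormal B2" using B1 B2 by (auto simp: M.onb_def)
  note fin = M.orthonormalD(1)[OF o(1)] M.orthonormalD(1)[OF o(2)]
  let ?N = "\<lambda>a b. G (sff a b) (sff a b)"
  \<comment> \<open>The sum is moved to a basis adapted to the splitting, where it breaks into four
    blocks.\<close>
  have "(\<Sum>a\<in>B. \<Sum>b\<in>B. ?N a b) = (\<Sum>a\<in>B1 \<union> B2. \<Sum>b\<in>B1 \<union> B2. ?N a b)"
    by (rule bilinear_sum_norm_sq_invariant[OF M.inner_space_axioms N.inner_space_axioms B B12(1)])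
      (use sff_linear_left sff_linear_right sff_in in auto)
  also have "\<dots> = (\<Sum>a\<in>B1. \<Sum>b\<in>B1. ?N a b) + (\<Sum>a\<in>B1. \<Sum>b\<in>B2. ?N a b) +
      ((\<Sum>a\<in>B2. \<Sum>b\<in>B1. ?N a b) + (\<Sum>a\<in>B2. \<Sum>b\<in>B2. ?N a b))"
    by (simp only: sum.union_disjoint[OF fin B12(2)] sum.distrib)
  also have "(\<Sum>a\<in>B1. \<Sum>b\<in>B1. ?N a b) = 0"
    by (intro sum.neutral ballI) (use sff11 b1 N.zero_left subspace_0[OF N.subspace] in auto)
  \<comment> \<open>The two mixed blocks agree by symmetry; this is the factor 2.\<close>
  also have "(\<Sum>a\<in>B2. \<Sum>b\<in>B1. ?N a b) = (\<Sum>a\<in>B2. \<Sum>b\<in>B1. ?N b a)"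
    by (intro sum.cong refl) (use sff_commute b1 b2 D1_in D2_in in auto)
  also have "\<dots> = (\<Sum>a\<in>B1. \<Sum>b\<in>B2. ?N a b)" by (rule sum.swap)
  also have "(\<Sum>a\<in>B1. \<Sum>b\<in>B2. ?N a b) =
      real (card B2) * ((1 / sin theta)\<^sup>2 + (cot theta)\<^sup>2) * gM grad grad"
  proof -
    \<comment> \<open>The gradient built from D1 alone. Since \<open>lam\<close> vanishes on D2, it
      represents \<open>lam\<close> on all of TM and therefore equals \<open>grad\<close>.\<close>
    define grad1 where "grad1 = (\<Sum>b\<in>B1. lam b *\<^sub>R b)"
    have g1: "grad1 \<in> D1"
      unfolding grad1_def using b1 by (auto intro!: subspace_sum[OF D1(1)] subspace_scale[OF D1(1)])
    have g1M: "grad1 \<in> TM" by (rule D1_in[OF g1])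
    have gr: "gM grad1 X = lam X" if X: "X \<in> D1" for X
    proof -
      have "gM grad1 X = (\<Sum>b\<in>B1. lam b * gM b X)"
        unfolding grad1_def by (rule M.sum_left[OF D1_in[OF X] D1_in[OF b1]])
      also have "\<dots> = (\<Sum>b\<in>B1. gM X b *\<^sub>R lam b)"
        by (intro sum.cong refl) (use M.commute[OF D1_in[OF X] D1_in[OF b1]] in auto)
      also have "\<dots> = lam (\<Sum>b\<in>B1. gM X b *\<^sub>R b)"
        by (rule linear_on_space_sum[OF lam_linear M.subspace, symmetric]) (rule D1_in[OF b1])
      also have "\<dots> = lam X" using M.onb_expand[OF B1 X] by simp
      finally show ?thesis .
    qed
    have "gM grad1 u = lam u" if u: "u \<in> TM" for u
    proof -
      obtain v w where vw: "u = v + w" "v \<in> D1" "w \<in> D2" using decomposeE[OF u] .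
      then show ?thesis
        using M.add_right[OF g1M D1_in[OF vw(2)] D2_in[OF vw(3)]] gr[OF vw(2)] D12_orth[OF g1 vw(3)]
          lam_D2[OF vw(3)] linear_on_spaceD(1)[OF lam_linear D1_in[OF vw(2)] D2_in[OF vw(3)] M.subspace]
        by simp
    qed
    then have gg: "grad1 = grad" using grad_exists grad g1M by blast
    have s1: "(\<Sum>a\<in>B1. (lam a)\<^sup>2) = gM grad grad"
    proof -
      have "gM grad1 grad1 = (\<Sum>a\<in>B1. gM grad1 a * gM a grad1)" by (rule M.parseval[OF B1 g1 g1M])
      also have "\<dots> = (\<Sum>a\<in>B1. (lam a)\<^sup>2)"
      proof (intro sum.cong refl)
        fix a assume "a \<in> B1"
        then have "a \<in> D1" by (rule b1)
        then show "gM grad1 a * gM a grad1 = (lam a)\<^sup>2"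
          using gr M.commute[OF D1_in g1M] by (simp add: power2_eq_square)
      qed
      finally show ?thesis by (simp add: gg)
    qed
    \<comment> \<open>By skewness lam (phi1 a) is minus the a-component of phi1 grad, and phi1
      preserves lengths; so this sum equals the one in \<open>s1\<close>.\<close>
    have s2: "(\<Sum>a\<in>B1. (lam (phi1 a))\<^sup>2) = gM grad grad"
    proof -
      note p = phi1(1)[OF g1]
      have "gM grad1 grad1 = (\<Sum>a\<in>B1. gM (phi1 grad1) a * gM a (phi1 grad1))"
        using phi1_isometry[OF g1] M.parseval[OF B1 p D1_in[OF p]] by simp
      also have "\<dots> = (\<Sum>a\<in>B1. (lam (phi1 a))\<^sup>2)"
      proof (intro sum.cong refl)
        fix a assume "a \<in> B1"
        then have a: "a \<in> D1" by (rule b1)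
        have "lam (phi1 a) = - gM (phi1 grad1) a"
          using gr[OF phi1(1)[OF a]] phi1_skew[OF g1 a] by simp
        then show "gM (phi1 grad1) a * gM a (phi1 grad1) = (lam (phi1 a))\<^sup>2"
          using M.commute[OF D1_in[OF a] D1_in[OF p]] by (simp add: power2_eq_square)
      qed
      finally show ?thesis by (simp add: gg)
    qed
    have "(\<Sum>a\<in>B1. \<Sum>b\<in>B2. ?N a b) =
        (\<Sum>a\<in>B1. \<Sum>b\<in>B2. (1 / sin theta)\<^sup>2 * ((lam (phi1 a))\<^sup>2 + (cos theta)\<^sup>2 * (lam a)\<^sup>2))"
      by (intro sum.cong refl) (use sff12_norm b1 b2 M.orthonormalD(3)[OF o(2)] in auto)
    also have "\<dots> = real (card B2) * ((1 / sin theta)\<^sup>2 *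
        ((\<Sum>a\<in>B1. (lam (phi1 a))\<^sup>2) + (cos theta)\<^sup>2 * (\<Sum>a\<in>B1. (lam a)\<^sup>2)))"
      by (simp add: sum_distrib_left sum.distrib distrib_left)
    \<comment> \<open>Here csc^2 (1 + cos^2) becomes csc^2 + cot^2.\<close>
    also have "\<dots> = real (card B2) * ((1 / sin theta)\<^sup>2 + (cot theta)\<^sup>2) * gM grad grad"
      unfolding s1 s2 cot_def by (simp add: power_divide algebra_simps add_divide_distrib)
    finally show ?thesis .
  qed
  finally show ?thesis by simp
qed

end

section \<open>Product manifolds\<close>

lemma inv_into_map_prod:
  assumes "inj_on x U" "inj_on y V" "a \<in> x ` U" "b \<in> y ` V"
  shows "inv_into (U \<times> V) (map_prod x y) (a, b) = (inv_into U x a, inv_into V y b)"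
  by (rule inv_into_f_eq[OF map_prod_inj_on[OF assms(1,2)]])
    (use assms f_inv_into_f[of a x U] f_inv_into_f[of b y V] inv_into_into[of a x U]
      inv_into_into[of b y V] in auto)

lemma smooth_on_fst:
  fixes f :: "'a::euclidean_space \<Rightarrow> 'c::real_normed_vector"
  assumes "smooth_on S f" "open T"
  shows "smooth_on (S \<times> T) (\<lambda>z::'a \<times> 'b::euclidean_space. f (fst z))"
  by (rule smooth_on_compose[OF assms(1) smooth_on_bounded_linear[OF _ bounded_linear_fst]])
    (use assms smooth_on_open in \<open>auto intro: open_Times\<close>)

lemma smooth_on_snd:
  fixes f :: "'b::euclidean_space \<Rightarrow> 'c::real_normed_vector"
  assumes "smooth_on T f" "open S"
  shows "smooth_on (S \<times> T) (\<lambda>z::'a::euclidean_space \<times> 'b. f (snd z))"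
  by (rule smooth_on_compose[OF assms(1) smooth_on_bounded_linear[OF _ bounded_linear_snd]])
    (use assms smooth_on_open in \<open>auto intro: open_Times\<close>)

locale product_manifold =
  B: manifold AB + F: manifold AF
  for AB :: "('b::{t2_space, second_countable_topology}, 'eb::euclidean_space) chart set"
    and AF :: "('f::{t2_space, second_countable_topology}, 'ef::euclidean_space) chart set"
begin

abbreviation AM :: "('b \<times> 'f, 'eb \<times> 'ef) chart set" where
  "AM \<equiv> prod_atlas AB AF"

lemma prod_chart_inv:
  assumes "(U, x) \<in> AB" "(V, y) \<in> AF" "z \<in> x ` U \<times> y ` V"
  shows "inv_into (U \<times> V) (map_prod x y) z = (inv_into U x (fst z), inv_into V y (snd z))"
  using inv_into_map_prod[OF B.chart_inj[OF assms(1)] F.chart_inj[OF assms(2)]] assms(3)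
  by (cases z) auto

lemma prod_is_chart:
  assumes U: "(U, x) \<in> AB" and V: "(V, y) \<in> AF"
  shows "is_chart (U \<times> V, map_prod x y)"
proof -
  note o = B.chart_image_open[OF U open_UNIV] F.chart_image_open[OF V open_UNIV]
  have im: "map_prod x y ` (U \<times> V) = x ` U \<times> y ` V" by (rule map_prod_surj_on) auto
  have "homeomorphism (U \<times> V) (x ` U \<times> y ` V) (map_prod x y) (inv_into (U \<times> V) (map_prod x y))"
  proof (rule homeomorphismI)
    show "continuous_on (U \<times> V) (map_prod x y)"
      unfolding map_prod_def case_prod_beta
      by (intro continuous_on_Pair continuous_on_compose2[OF B.chart_continuous[OF U]]
          continuous_on_compose2[OF F.chart_continuous[OF V]] continuous_intros) auto
    have "continuous_on (x ` U \<times> y ` V) (\<lambda>z. (inv_into U x (fst z), inv_into V y (snd z)))"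
      by (intro continuous_on_Pair continuous_on_compose2[OF B.chart_inv_continuous[OF U]]
          continuous_on_compose2[OF F.chart_inv_continuous[OF V]] continuous_intros) auto
    then show "continuous_on (x ` U \<times> y ` V) (inv_into (U \<times> V) (map_prod x y))"
      using prod_chart_inv[OF U V] by (subst continuous_on_cong[OF refl]) auto
  qed (use im B.chart_inv[OF U] F.chart_inv[OF V] prod_chart_inv[OF U V] in auto)
  then show ?thesis
    using B.chart_open[OF U] F.chart_open[OF V] o im by (auto simp: is_chart_def open_Times)
qed

lemma prod_smooth_atlas: "smooth_atlas AM"
  unfolding smooth_atlas_def
proof (intro conjI ballI)
  show "is_chart c" if "c \<in> AM" for c
    using that prod_is_chart by (auto simp: prod_atlas_def)
  have "p \<in> (\<Union>c\<in>AM. fst c)" for p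
  proof -
    obtain U x where U: "(U, x) \<in> AB" "fst p \<in> U" by (rule B.chartE)
    obtain V y where V: "(V, y) \<in> AF" "snd p \<in> V" by (rule F.chartE)
    have "(U \<times> V, map_prod x y) \<in> AM" using U V by (auto simp: prod_atlas_def)
    then show ?thesis using U V by (cases p) force
  qed
  then show "(\<Union>c\<in>AM. fst c) = UNIV" by blast
next
  have *: "smooth_on (map_prod x y ` ((U \<times> V) \<inter> (U' \<times> V')))
      (map_prod x' y' \<circ> inv_into (U \<times> V) (map_prod x y))"
    if m: "(U, x) \<in> AB" "(V, y) \<in> AF" "(U', x') \<in> AB" "(V', y') \<in> AF" for U x V y U' x' V' y'
  proof -
    let ?S = "x ` (U \<inter> U')" and ?T = "y ` (V \<inter> V')"
    have o: "open ?S" "open ?T"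
      using B.chart_image_open[OF m(1) B.chart_open[OF m(3)]]
        F.chart_image_open[OF m(2) F.chart_open[OF m(4)]] by auto
    have im: "map_prod x y ` ((U \<times> V) \<inter> (U' \<times> V')) = ?S \<times> ?T"
      by (simp add: Times_Int_Times map_prod_surj_on)
    have "smooth_on (?S \<times> ?T) (\<lambda>z. ((x' \<circ> inv_into U x) (fst z), (y' \<circ> inv_into V y) (snd z)))"
      by (intro smooth_on_Pair smooth_on_fst[OF B.transition_smooth[OF m(1,3)] o(2)]
          smooth_on_snd[OF F.transition_smooth[OF m(2,4)] o(1)])
    then show ?thesis
      unfolding im by (rule smooth_on_cong) (use prod_chart_inv[OF m(1,2)] in auto)
  qed
  show "case c of (U, x) \<Rightarrow> \<forall>(V, y)\<in>AM. smooth_on (x ` (U \<inter> V)) (y \<circ> inv_into U x)"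
    if "c \<in> AM" for c
    using that by (auto simp: prod_atlas_def simp del: Sigma_Int_distrib1 intro!: *)
qed

end

sublocale product_manifold \<subseteq> M: manifold AM
  by unfold_locales (rule prod_smooth_atlas)

context product_manifold
begin

lemma smooth_map_fst: "smooth_map AM AB fst"
  unfolding smooth_map_def
proof (intro conjI ballI)
  show "continuous_on UNIV fst" by (intro continuous_intros)
  have *: "smooth_on (map_prod x y ` ((U \<times> V) \<inter> fst -` U'))
      (x' \<circ> fst \<circ> inv_into (U \<times> V) (map_prod x y))"
    if m: "(U, x) \<in> AB" "(V, y) \<in> AF" "(U', x') \<in> AB" for U x V y U' x'
  proof -
    let ?S = "x ` (U \<inter> U')" and ?T = "y ` V"
    have o: "open ?T" using F.chart_image_open[OF m(2) open_UNIV] by simp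
    have im: "map_prod x y ` ((U \<times> V) \<inter> fst -` U') = ?S \<times> ?T" by force
    have "smooth_on (?S \<times> ?T) (\<lambda>z. (x' \<circ> inv_into U x) (fst z))"
      by (rule smooth_on_fst[OF B.transition_smooth[OF m(1,3)] o])
    then show ?thesis
      unfolding im by (rule smooth_on_cong) (use prod_chart_inv[OF m(1,2)] in auto)
  qed
  show "case c of (U, x) \<Rightarrow> \<forall>(V, y)\<in>AB. smooth_on (x ` (U \<inter> fst -` V)) (y \<circ> fst \<circ> inv_into U x)"
    if "c \<in> AM" for c
    using that by (auto simp: prod_atlas_def intro!: *)
qed

lemma smooth_map_snd: "smooth_map AM AF snd"
  unfolding smooth_map_def
proof (intro conjI ballI)
  show "continuous_on UNIV snd" by (intro continuous_intros)
  have *: "smooth_on (map_prod x y ` ((U \<times> V) \<inter> snd -` V'))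
      (y' \<circ> snd \<circ> inv_into (U \<times> V) (map_prod x y))"
    if m: "(U, x) \<in> AB" "(V, y) \<in> AF" "(V', y') \<in> AF" for U x V y V' y'
  proof -
    let ?S = "x ` U" and ?T = "y ` (V \<inter> V')"
    have o: "open ?S" using B.chart_image_open[OF m(1) open_UNIV] by simp
    have im: "map_prod x y ` ((U \<times> V) \<inter> snd -` V') = ?S \<times> ?T" by force
    have "smooth_on (?S \<times> ?T) (\<lambda>z. (y' \<circ> inv_into V y) (snd z))"
      by (rule smooth_on_snd[OF F.transition_smooth[OF m(2,3)] o])
    then show ?thesis
      unfolding im by (rule smooth_on_cong) (use prod_chart_inv[OF m(1,2)] in auto)
  qed
  show "case c of (U, x) \<Rightarrow> \<forall>(V, y)\<in>AF. smooth_on (x ` (U \<inter> snd -` V)) (y \<circ> snd \<circ> inv_into U x)"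
    if "c \<in> AM" for c
    using that by (auto simp: prod_atlas_def intro!: *)
qed

end

sublocale product_manifold \<subseteq> fst: smooth_map_between AM AB fst
  by unfold_locales (rule smooth_map_fst)

sublocale product_manifold \<subseteq> snd: smooth_map_between AM AF snd
  by unfold_locales (rule smooth_map_snd)

locale product_chart = product_manifold +
  fixes U x V y
  assumes U: "(U, x) \<in> AB" and V: "(V, y) \<in> AF"
begin

text \<open>Directions are pairs: those of the form (a, 0) give fields tangent to the leaves, those
  of the form (0, b) fields tangent to the fibres.\<close>

abbreviation X :: "'b \<times> 'd \<Rightarrow> ('a \<times> 'c) vfield" where
  "X u \<equiv> coord_vector AM (U \<times> V) (map_prod x y) u"

lemma chart: "(U \<times> V, map_prod x y) \<in> AM"
  using U V by (auto simp: prod_atlas_def)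

lemma X_in: "q \<in> U \<times> V \<Longrightarrow> X u q \<in> tangent_space AM q"
  by (rule M.coord_vector_in_tangent_space[OF chart])

lemma X_linear: "q \<in> U \<times> V \<Longrightarrow> linear (\<lambda>u. X u q)"
  by (rule M.coord_vector_linear[OF chart])

lemma chart_image: "map_prod x y ` (U \<times> V) = x ` U \<times> y ` V"
  by (rule map_prod_surj_on) auto

lemma chart_image_open: "open (x ` U \<times> y ` V)"
  using B.chart_image_open[OF U open_UNIV] F.chart_image_open[OF V open_UNIV]
  by (simp add: open_Times)

lemma differential_fst_X:
  assumes q: "q \<in> U \<times> V"
  shows "differential AB fst q (X u q) = coord_vector AB U x (fst u) (fst q)"
proof (rule ext)
  fix k
  show "differential AB fst q (X u q) k = coord_vector AB U x (fst u) (fst q) k"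
  proof (cases "smooth_near AB (fst q) k")
    case True
    have fq: "fst q \<in> U" using q by auto
    have "((\<lambda>z. (k \<circ> inv_into U x) (fst z)) has_derivative
        (\<lambda>u. frechet_derivative (k \<circ> inv_into U x) (at (x (fst q))) (fst u))) (at (map_prod x y q))"
      by (rule has_derivative_compose[OF has_derivative_fst[OF has_derivative_ident]])
        (use B.smooth_near_has_derivative[OF True U fq] in \<open>simp add: case_prod_beta map_prod_def del: o_apply\<close>)
    then have "((\<lambda>q. k (fst q)) \<circ> inv_into (U \<times> V) (map_prod x y) has_derivative
        (\<lambda>u. frechet_derivative (k \<circ> inv_into U x) (at (x (fst q))) (fst u))) (at (map_prod x y q))"
      by (rule has_derivative_transform_within_open[OF _ chart_image_open])
        (use q prod_chart_inv[OF U V] in \<open>auto simp: chart_image[symmetric]\<close>)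
    from M.coord_vector_derivative[OF fst.smooth_near_pullback[OF True] chart q this]
    show ?thesis
      by (simp add: fst.differential_smooth[OF True] B.coord_vector_smooth[OF True])
  qed (simp add: differential_def B.coord_vector_not_smooth)
qed

lemma differential_snd_X:
  assumes q: "q \<in> U \<times> V"
  shows "differential AF snd q (X u q) = coord_vector AF V y (snd u) (snd q)"
proof (rule ext)
  fix k
  show "differential AF snd q (X u q) k = coord_vector AF V y (snd u) (snd q) k"
  proof (cases "smooth_near AF (snd q) k")
    case True
    have sq: "snd q \<in> V" using q by auto
    have "((\<lambda>z. (k \<circ> inv_into V y) (snd z)) has_derivative
        (\<lambda>u. frechet_derivative (k \<circ> inv_into V y) (at (y (snd q))) (snd u))) (at (map_prod x y q))"
      by (rule has_derivative_compose[OF has_derivative_snd[OF has_derivative_ident]])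
        (use F.smooth_near_has_derivative[OF True V sq] in \<open>simp add: case_prod_beta map_prod_def del: o_apply\<close>)
    then have "((\<lambda>q. k (snd q)) \<circ> inv_into (U \<times> V) (map_prod x y) has_derivative
        (\<lambda>u. frechet_derivative (k \<circ> inv_into V y) (at (y (snd q))) (snd u))) (at (map_prod x y q))"
      by (rule has_derivative_transform_within_open[OF _ chart_image_open])
        (use q prod_chart_inv[OF U V] in \<open>auto simp: chart_image[symmetric]\<close>)
    from M.coord_vector_derivative[OF snd.smooth_near_pullback[OF True] chart q this]
    show ?thesis
      by (simp add: snd.differential_smooth[OF True] F.coord_vector_smooth[OF True])
  qed (simp add: differential_def F.coord_vector_not_smooth)
qed

text \<open>The differential of \<open>snd\<close> keeps only the second component of the direction,
  and a coordinate vector is 0 only for direction 0.\<close>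

lemma base_bundle_eq:
  assumes q: "q \<in> U \<times> V"
  shows "base_bundle AB AF q = range (\<lambda>a. X (a, 0) q)"
proof -
  have sq: "snd q \<in> V" using q by auto
  show ?thesis
    unfolding base_bundle_def M.tangent_space_eq[OF chart q]
    using differential_snd_X[OF q] F.coord_vector_eq_0_iff[OF V sq] by force
qed

lemma fibre_bundle_eq:
  assumes q: "q \<in> U \<times> V"
  shows "fibre_bundle AB AF q = range (\<lambda>b. X (0, b) q)"
proof -
  have fq: "fst q \<in> U" using q by auto
  show ?thesis
    unfolding fibre_bundle_def M.tangent_space_eq[OF chart q]
    using differential_fst_X[OF q] B.coord_vector_eq_0_iff[OF U fq] by force
qed

lemma X_fibre_fst:
  assumes q: "q \<in> U \<times> V" and k: "smooth_near AB (fst q) k"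
  shows "X (0, b) q (\<lambda>z. k (fst z)) = 0"
  using fst.differential_smooth[OF k, of "X (0, b) q"] differential_fst_X[OF q, of "(0, b)"]
    B.coord_vector_eq_0_iff[OF U, of "fst q" 0] q by auto

lemma X_base_snd:
  assumes q: "q \<in> U \<times> V" and k: "smooth_near AF (snd q) k"
  shows "X (a, 0) q (\<lambda>z. k (snd z)) = 0"
  using snd.differential_smooth[OF k, of "X (a, 0) q"] differential_snd_X[OF q, of "(a, 0)"]
    F.coord_vector_eq_0_iff[OF V, of "snd q" 0] q by auto

end

section \<open>Warped product semi-slant submanifolds\<close>

lemma proper_pointwise_semi_slantD:
  assumes "proper_pointwise_semi_slant A A' F phi g D1 D2 theta"
  shows "smooth_map A A' F"
    and "inj_on (differential A' F p) (tangent_space A p)"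
    and "distribution A D1"
    and "D2 p = {v \<in> tangent_space A p. \<forall>w\<in>D1 p. induced_metric A' F g p v w = 0}"
    and "tangent_space A p = {u + v | u v. u \<in> D1 p \<and> v \<in> D2 p}"
    and "phi (F p) ` differential A' F p ` D1 p \<subseteq> differential A' F p ` D1 p"
    and "x \<in> D2 p \<Longrightarrow> x \<noteq> 0 \<Longrightarrow> subspace_angle (g (F p)) (phi (F p) (differential A' F p x))
      (differential A' F p ` D2 p) = theta p"
    and "0 < theta p" and "theta p < pi / 2"
proof -
  note unfolded = assms[unfolded proper_pointwise_semi_slant_def pointwise_semi_slant_def
      submanifold_def]
  have *: "smooth_map A A' F"
    "\<forall>p. inj_on (differential A' F p) (tangent_space A p)"
    "distribution A D1"
    "\<forall>p. D2 p = {v \<in> tangent_space A p. \<forall>w\<in>D1 p. induced_metric A' F g p v w = 0}"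
    "\<forall>p. tangent_space A p = {u + v | u v. u \<in> D1 p \<and> v \<in> D2 p} \<and> D1 p \<inter> D2 p = {0}"
    "\<forall>p. phi (F p) ` (differential A' F p ` D1 p) \<subseteq> differential A' F p ` D1 p"
    "\<forall>p. \<forall>x\<in>D2 p. x \<noteq> 0 \<longrightarrow>
        subspace_angle (g (F p)) (phi (F p) (differential A' F p x))
          (differential A' F p ` D2 p) = theta p"
    "\<forall>p. 0 < theta p \<and> theta p < pi / 2"
    by (insert unfolded, (elim conjE, assumption)+)
  show "smooth_map A A' F" "distribution A D1" by (rule *)+
  show "inj_on (differential A' F p) (tangent_space A p)" by (rule *(2)[rule_format])
  show "D2 p = {v \<in> tangent_space A p. \<forall>w\<in>D1 p. induced_metric A' F g p v w = 0}"
    by (rule *(4)[THEN spec])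
  show "tangent_space A p = {u + v | u v. u \<in> D1 p \<and> v \<in> D2 p}"
    by (rule conjunct1[OF *(5)[THEN spec]])
  show "phi (F p) ` differential A' F p ` D1 p \<subseteq> differential A' F p ` D1 p"
    by (rule *(6)[THEN spec])
  show "x \<in> D2 p \<Longrightarrow> x \<noteq> 0 \<Longrightarrow> subspace_angle (g (F p)) (phi (F p) (differential A' F p x))
      (differential A' F p ` D2 p) = theta p" by (rule *(7)[rule_format])
  show "0 < theta p" "theta p < pi / 2" using *(8) by simp_all
qed

lemma second_fundamental_formD:
  "second_fundamental_form A A' F g D h \<Longrightarrow> vector_field_on A U X \<Longrightarrow> vector_field_on A U Y \<Longrightarrow>
    p \<in> U \<Longrightarrow> h p (X p) (Y p) =
      normal_part A A' F g p (D p (X p) (\<lambda>q. differential A' F q (Y q)))"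
  by (simp add: second_fundamental_form_def)

locale warped_semi_slant =
  N: cosymplectic_manifold AN phi xi eta g nabla + product_manifold AB AF
  for AN :: "('n::{t2_space, second_countable_topology}, 'en::euclidean_space) chart set"
    and phi xi eta g nabla
    and AB :: "('b::{t2_space, second_countable_topology}, 'eb::euclidean_space) chart set"
    and AF :: "('f::{t2_space, second_countable_topology}, 'ef::euclidean_space) chart set" +
  fixes gB :: "'b metric" and gF :: "'f metric" and f :: "'b \<Rightarrow> real" and i :: "'b \<times> 'f \<Rightarrow> 'n"
    and D1 D2 :: "'b \<times> 'f \<Rightarrow> ('b \<times> 'f) tangent set" and theta :: "'b \<times> 'f \<Rightarrow> real"
    and D :: "'b \<times> 'f \<Rightarrow> ('b \<times> 'f) tangent \<Rightarrow> ('b \<times> 'f \<Rightarrow> 'n tangent) \<Rightarrow> 'n tangent"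
    and h :: "'b \<times> 'f \<Rightarrow> ('b \<times> 'f) tangent \<Rightarrow> ('b \<times> 'f) tangent \<Rightarrow> 'n tangent"
    and m1 m2 :: nat
  assumes dim_N: "DIM('en) = 2 * (m1 + 2 * m2) + 1"
    and gB: "riemannian_metric AB gB" and gF: "riemannian_metric AF gF"
    and f_smooth: "smooth_fun_on AB UNIV f" and f_pos: "\<And>b. f b > 0"
    and warped: "\<And>p u v. u \<in> tangent_space (prod_atlas AB AF) p \<Longrightarrow>
      v \<in> tangent_space (prod_atlas AB AF) p \<Longrightarrow>
      induced_metric AN i g p u v = warped_metric AB AF gB gF f p u v"
    and semi_slant: "proper_pointwise_semi_slant (prod_atlas AB AF) AN i phi g D1 D2 theta"
    and D1_base: "\<And>p. D1 p = base_bundle AB AF p" and dim_D1: "\<And>p. dim (D1 p) = 2 * m1"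
    and D2_fibre: "\<And>p. D2 p = fibre_bundle AB AF p" and dim_D2: "\<And>p. dim (D2 p) = 2 * m2"
    and xi_normal: "\<And>p. xi (i p) \<in> normal_bundle (prod_atlas AB AF) AN i g p"
    and D: "pullback_connection (prod_atlas AB AF) AN i nabla D"
    and h: "second_fundamental_form (prod_atlas AB AF) AN i g D h"
begin

abbreviation gM where "gM \<equiv> induced_metric AN i g"

lemma immersion: "smooth_map AM AN i" "inj_on (differential AN i p) (tangent_space AM p)"
  by (rule proper_pointwise_semi_slantD[OF semi_slant])+

end

sublocale warped_semi_slant \<subseteq> i: pullback_levi_civita AM AN i g nabla D
  by unfold_locales (rule immersion N.metric N.levi_civita D)+

context warped_semi_slant
begin

lemma inner_space_N: "inner_space (tangent_space AN q) (g q)"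
  using riemannian_metricD[OF N.metric] N.subspace_tangent_space by unfold_locales auto

text \<open>Positivity is where the immersion enters: a nonzero tangent vector has a nonzero
  image.\<close>

lemma inner_space_M: "inner_space (tangent_space AM p) (gM p)"
proof
  show "subspace (tangent_space AM p)" by (rule M.subspace_tangent_space)
  note J = i.differential_in_tangent_space
  interpret N: inner_space "tangent_space AN (i p)" "g (i p)" by (rule inner_space_N)
  show "gM p u v = gM p v u" if "u \<in> tangent_space AM p" "v \<in> tangent_space AM p" for u v
    unfolding induced_metric_def by (rule N.commute[OF J J]) (use that in auto)
  show "linear_on_space (tangent_space AM p) (\<lambda>u. gM p u v)" if "v \<in> tangent_space AM p" for v
    using N.linear_left[OF J[OF that]] J i.differential_linear
    by (auto simp: linear_on_space_def induced_metric_def linear_add linear_scale)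
  show "gM p v v > 0" if v: "v \<in> tangent_space AM p" "v \<noteq> 0" for v
  proof -
    have "differential AN i p v \<noteq> differential AN i p 0"
      using inj_onD[OF immersion(2) _ v(1) subspace_0[OF M.subspace_tangent_space]] v(2) by blast
    then show ?thesis
      unfolding induced_metric_def
      by (intro N.pos[OF J[OF v(1)]]) (simp add: linear_0[OF i.differential_linear])
  qed
qed

end

locale warped_chart =
  warped_semi_slant AN phi xi eta g nabla AB AF gB gF f i D1 D2 theta D h m1 m2 +
  product_chart AB AF U x V y
  for AN :: "('n::{t2_space, second_countable_topology}, 'en::euclidean_space) chart set"
    and phi xi eta g nabla
    and AB :: "('b::{t2_space, second_countable_topology}, 'eb::euclidean_space) chart set"
    and AF :: "('f::{t2_space, second_countable_topology}, 'ef::euclidean_space) chart set"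
    and gB gF f i D1 D2 theta D h m1 m2 U x V y +
  fixes p
  assumes p: "p \<in> U \<times> V"
begin

section \<open>The warped metric on coordinate fields\<close>

definition E :: "'eb \<times> 'ef \<Rightarrow> 'b \<times> 'f \<Rightarrow> 'n tangent" where
  "E u = (\<lambda>q. differential AN i q (X u q))"

lemma open_chart: "open (U \<times> V)"
  by (rule M.chart_open[OF chart])

lemma E_field: "field_along AM AN i (U \<times> V) (E u)"
  unfolding E_def by (rule i.field_along_differential[OF M.vector_field_on_coord_vector[OF chart]])

lemma E_in: "q \<in> U \<times> V \<Longrightarrow> E u q \<in> tangent_space AN (i q)"
  by (rule i.field_alongD(2)[OF E_field])

lemma E_linear: "q \<in> U \<times> V \<Longrightarrow> linear (\<lambda>u. E u q)"
  unfolding E_def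
  using linear_compose[OF X_linear i.differential_linear] by (simp add: o_def)

lemma E_phi_field: "field_along AM AN i (U \<times> V) (\<lambda>q. phi (i q) (E u q))"
  by (rule i.field_along_tensor[OF E_field N.phi_linear N.phi_field])

lemma E_metric:
  assumes q: "q \<in> U \<times> V"
  shows "g (i q) (E u q) (E v q) =
    gB (fst q) (coord_vector AB U x (fst u) (fst q)) (coord_vector AB U x (fst v) (fst q)) +
    (f (fst q))\<^sup>2 * gF (snd q) (coord_vector AF V y (snd u) (snd q)) (coord_vector AF V y (snd v) (snd q))"
  using warped[OF X_in[OF q] X_in[OF q], of u v]
  by (simp add: E_def induced_metric_def warped_metric_def differential_fst_X[OF q] differential_snd_X[OF q])

lemma fst_p: "fst p \<in> U" and snd_p: "snd p \<in> V"
  using p by auto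

lemma metric_zero:
  assumes "manifold A" "riemannian_metric A G" "v \<in> tangent_space A q"
  shows "G q 0 v = 0" "G q v 0 = 0"
proof -
  interpret A: manifold A by fact
  show "G q 0 v = 0"
    by (rule linear_on_spaceD(5)[OF riemannian_metricD(2)[OF assms(2,3)] assms(3,3) A.subspace_tangent_space])
  show "G q v 0 = 0"
    by (rule linear_on_spaceD(5)[OF A.riemannian_metric_linear_right[OF assms(2,3)] assms(3,3)
          A.subspace_tangent_space])
qed

lemma coord_zero: "q \<in> U \<Longrightarrow> coord_vector AB U x 0 q = 0" "r \<in> V \<Longrightarrow> coord_vector AF V y 0 r = 0"
  using B.coord_vector_eq_0_iff[OF U] F.coord_vector_eq_0_iff[OF V] by auto

lemma E_base_fibre:
  assumes q: "q \<in> U \<times> V" shows "g (i q) (E (a, 0) q) (E (0, b) q) = 0"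
  using q metric_zero(2)[OF B.manifold_axioms gB B.coord_vector_in_tangent_space[OF U, of "fst q" a]]
    metric_zero(1)[OF F.manifold_axioms gF F.coord_vector_in_tangent_space[OF V, of "snd q" b]]
  by (auto simp: E_metric coord_zero)

lemma E_base_base:
  assumes q: "q \<in> U \<times> V"
  shows "g (i q) (E (a, 0) q) (E (a', 0) q) =
    gB (fst q) (coord_vector AB U x a (fst q)) (coord_vector AB U x a' (fst q))"
  using q metric_zero(1)[OF F.manifold_axioms gF F.coord_vector_in_tangent_space[OF V, of "snd q" 0]]
  by (auto simp: E_metric coord_zero)

lemma E_fibre_fibre:
  assumes q: "q \<in> U \<times> V"
  shows "g (i q) (E (0, b) q) (E (0, b') q) =
    (f (fst q))\<^sup>2 * gF (snd q) (coord_vector AF V y b (snd q)) (coord_vector AF V y b' (snd q))"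
  using q metric_zero(1)[OF B.manifold_axioms gB B.coord_vector_in_tangent_space[OF U, of "fst q" 0]]
  by (auto simp: E_metric coord_zero)

section \<open>The Koszul formula for the warped metric\<close>

definition lam :: "('b \<times> 'f) tangent \<Rightarrow> real" where
  "lam v = v (\<lambda>q. ln (f (fst q)))"

lemma f_near: "smooth_near AB b f"
  by (rule B.smooth_nearI[OF f_smooth UNIV_I])

lemma ln_f_near: "smooth_near AB b (\<lambda>z. ln (f z))"
  by (rule B.smooth_nearI[OF B.smooth_fun_on_compose_real[OF f_smooth smooth_on_ln] UNIV_I])
    (use f_pos in auto)

lemma lam_fibre: "lam (X (0, b) p) = 0"
  unfolding lam_def by (rule X_fibre_fst[OF p ln_f_near])

lemma lam_eq: "v \<in> tangent_space AM p \<Longrightarrow> v (\<lambda>q. f (fst q)) = f (fst p) * lam v"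
  using M.tangent_chain[OF _ fst.smooth_near_pullback[OF f_near] fst.smooth_near_pullback[OF ln_f_near]
      DERIV_ln_divide[OF f_pos], of v p] f_pos[of "fst p"]
  by (simp add: lam_def)

text \<open>The derivative of a metric coefficient in a coordinate direction, that is, one term of
  the Koszul formula.\<close>

definition m :: "'eb \<times> 'ef \<Rightarrow> 'eb \<times> 'ef \<Rightarrow> 'eb \<times> 'ef \<Rightarrow> real" where
  "m u v w = X u p (\<lambda>q. g (i q) (E v q) (E w q))"

lemma m_commute: "m u v w = m u w v"
  unfolding m_def
  by (rule M.tangent_local[OF X_in[OF p] open_chart p]) (rule i.g_symmetric[OF E_in E_in])

lemma m_base_fibre: "m u (a, 0) (0, b) = 0" "m u (0, b) (a, 0) = 0"
proof -
  have "m u (a, 0) (0, b) = X u p (\<lambda>q. 0)"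
    unfolding m_def by (rule M.tangent_local[OF X_in[OF p] open_chart p]) (rule E_base_fibre)
  then show "m u (a, 0) (0, b) = 0" using M.tangent_const[OF X_in[OF p]] by simp
  then show "m u (0, b) (a, 0) = 0" using m_commute by simp
qed

lemma m_fibre_base_base: "m (0, b) (a, 0) (a', 0) = 0"
proof -
  let ?k = "\<lambda>z. gB z (coord_vector AB U x a z) (coord_vector AB U x a' z)"
  have "m (0, b) (a, 0) (a', 0) = X (0, b) p (\<lambda>q. ?k (fst q))"
    unfolding m_def by (rule M.tangent_local[OF X_in[OF p] open_chart p]) (rule E_base_base)
  also have "\<dots> = 0"
    by (rule X_fibre_fst[OF p B.smooth_nearI[OF riemannian_metricD(4)[OF gB
          B.vector_field_on_coord_vector[OF U] B.vector_field_on_coord_vector[OF U]] fst_p]])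
  finally show ?thesis .
qed

text \<open>The coefficient is f^2 times a function on the fibre, which is constant in base
  directions; and d(f^2) = 2 f^2 d(ln f) supplies the factor 2.\<close>

lemma m_base_fibre_fibre:
  "m (a, 0) (0, b) (0, b') = 2 * lam (X (a, 0) p) * g (i p) (E (0, b) p) (E (0, b') p)"
proof -
  let ?k = "\<lambda>z. gF z (coord_vector AF V y b z) (coord_vector AF V y b' z)"
  have k: "smooth_near AF (snd p) ?k"
    by (rule F.smooth_nearI[OF riemannian_metricD(4)[OF gF
          F.vector_field_on_coord_vector[OF V] F.vector_field_on_coord_vector[OF V]] snd_p])
  note kp = snd.smooth_near_pullback[OF k] and fp = fst.smooth_near_pullback[OF f_near[of "fst p"]]
  note Xp = X_in[OF p, of "(a, 0)"]
  have "m (a, 0) (0, b) (0, b') = X (a, 0) p (\<lambda>q. (f (fst q) * f (fst q)) * ?k (snd q))"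
    unfolding m_def
    by (rule M.tangent_local[OF Xp open_chart p]) (simp only: E_fibre_fibre power2_eq_square)
  also have "\<dots> = X (a, 0) p (\<lambda>q. f (fst q) * f (fst q)) * ?k (snd p) +
      f (fst p) * f (fst p) * X (a, 0) p (\<lambda>q. ?k (snd q))"
    by (rule M.tangent_mult[OF Xp M.smooth_near_mult[OF fp fp] kp])
  also have "X (a, 0) p (\<lambda>q. ?k (snd q)) = 0" by (rule X_base_snd[OF p k])
  also have "X (a, 0) p (\<lambda>q. f (fst q) * f (fst q)) = 2 * (f (fst p))\<^sup>2 * lam (X (a, 0) p)"
    unfolding M.tangent_mult[OF Xp fp fp] lam_eq[OF Xp] by (simp add: power2_eq_square)
  finally show ?thesis by (simp add: E_fibre_fibre[OF p])
qed

definition d :: "'eb \<times> 'ef \<Rightarrow> 'eb \<times> 'ef \<Rightarrow> 'n tangent" where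
  "d u v = D p (X u p) (E v)"

lemma d_in: "d u v \<in> tangent_space AN (i p)"
  unfolding d_def by (rule i.D_in_tangent_space[OF p X_in[OF p] E_field])

lemma d_commute: "d u v = d v u"
  unfolding d_def E_def by (rule i.D_coord_commute[OF chart p])

lemma m_eq: "m u v w = g (i p) (d u v) (E w p) + g (i p) (E v p) (d u w)"
  unfolding m_def d_def by (rule i.metric_compatible[OF p X_in[OF p] E_field E_field])

text \<open>Bracket terms are absent because coordinate fields commute. Expanding the three terms by
  \<open>m_eq\<close>, all but one pair cancels by symmetry of \<open>d\<close>.\<close>

lemma koszul: "2 * g (i p) (d u v) (E w p) = m u v w + m v u w - m w u v"
  unfolding m_eq
  using d_commute[of u v] d_commute[of u w] d_commute[of v w]
    i.g_symmetric[OF E_in[OF p] d_in] by simp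

text \<open>With the next three lemmas this gives the classical warped product formulas: leaves are
  totally geodesic, nabla_X Z = X(ln f) Z for mixed pairs, and fibres are umbilical in M with mean
  curvature vector - grad ln f.\<close>

lemma d_base_base_fibre: "g (i p) (d (a, 0) (a', 0)) (E (0, b) p) = 0"
  using koszul[of "(a, 0)" "(a', 0)" "(0, b)"] m_base_fibre m_fibre_base_base by simp

lemma d_base_fibre_fibre:
  "g (i p) (d (a, 0) (0, b)) (E (0, b') p) = lam (X (a, 0) p) * g (i p) (E (0, b) p) (E (0, b') p)"
  using koszul[of "(a, 0)" "(0, b)" "(0, b')"] m_base_fibre m_base_fibre_fibre by simp

lemma d_base_fibre_base: "g (i p) (d (a, 0) (0, b)) (E (a', 0) p) = 0"
  using koszul[of "(a, 0)" "(0, b)" "(a', 0)"] m_base_fibre m_fibre_base_base by simp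

lemma d_fibre_fibre_base:
  "g (i p) (d (0, b) (0, b')) (E (a, 0) p) = - lam (X (a, 0) p) * g (i p) (E (0, b) p) (E (0, b') p)"
  using koszul[of "(0, b)" "(0, b')" "(a, 0)"] m_base_fibre m_base_fibre_fibre by simp

section \<open>Differentiating the relations with phi and xi\<close>

lemma D_phi: "D p (X u p) (\<lambda>q. phi (i q) (E v q)) = phi (i p) (d u v)"
  unfolding d_def
  by (rule i.D_tensor[OF p X_in[OF p] E_field _ N.phi_linear N.phi_field N.phi_parallel])
    (use N.phi_in_tangent_space in auto)

lemma phi_E_base: "q \<in> U \<times> V \<Longrightarrow> \<exists>a'. phi (i q) (E (a, 0) q) = E (a', 0) q"
proof -
  assume q: "q \<in> U \<times> V"
  have "phi (i q) ` (differential AN i q ` D1 q) \<subseteq> differential AN i q ` D1 q"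
    by (rule proper_pointwise_semi_slantD(6)[OF semi_slant])
  moreover have "X (a, 0) q \<in> D1 q" unfolding D1_base base_bundle_eq[OF q] by simp
  ultimately have "phi (i q) (E (a, 0) q) \<in> differential AN i q ` D1 q" unfolding E_def by blast
  then show ?thesis unfolding D1_base base_bundle_eq[OF q] E_def by blast
qed

lemma base_phi_fibre:
  assumes q: "q \<in> U \<times> V" shows "g (i q) (E (a, 0) q) (phi (i q) (E (0, b) q)) = 0"
proof -
  obtain a' where a': "phi (i q) (E (a, 0) q) = E (a', 0) q" using phi_E_base[OF q] by blast
  show ?thesis
    using N.phi_skew[OF E_in[OF q] E_in[OF q], of "(a, 0)" "(0, b)"] E_base_fibre[OF q] by (simp add: a')
qed

text \<open>
  Differentiating \<open>g(E\<^sub>a, phi E\<^sub>b) = 0\<close> moves \<open>phi\<close> off the fibre direction, without any need for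
  smooth coefficients of \<open>phi E\<^sub>a\<close> with respect to the coordinate frame.
\<close>

lemma d_phi_fibre:
  assumes a': "phi (i p) (E (a, 0) p) = E (a', 0) p"
  shows "g (i p) (d u (a, 0)) (phi (i p) (E (0, b) p)) = g (i p) (E (a', 0) p) (d u (0, b))"
proof -
  have "X u p (\<lambda>q. g (i q) (E (a, 0) q) (phi (i q) (E (0, b) q))) = X u p (\<lambda>q. 0)"
    by (rule M.tangent_local[OF X_in[OF p] open_chart p]) (rule base_phi_fibre)
  then have "g (i p) (d u (a, 0)) (phi (i p) (E (0, b) p)) +
      g (i p) (E (a, 0) p) (phi (i p) (d u (0, b))) = 0"
    using i.metric_compatible[OF p X_in[OF p] E_field E_phi_field, of u "(a, 0)" "(0, b)"]
      M.tangent_const[OF X_in[OF p]] D_phi by (simp add: d_def)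
  then show ?thesis
    using N.phi_skew[OF E_in[OF p] d_in, of "(a, 0)" u "(0, b)"] a' by simp
qed

lemma xi_E: "q \<in> U \<times> V \<Longrightarrow> g (i q) (E v q) (xi (i q)) = 0"
  using xi_normal[of q] X_in[of q v] i.g_symmetric[OF E_in N.xi_in_tangent_space]
  by (auto simp: normal_bundle_def tangent_image_def E_def)

text \<open>Differentiate g(E, xi) = 0 along M. The term with the derivative of xi drops out because
  xi is parallel, so h has no xi-component.\<close>

lemma d_xi: "g (i p) (d u v) (xi (i p)) = 0"
proof -
  have fx: "field_along AM AN i UNIV (\<lambda>q. xi (i q))"
    using i.field_along_comp[OF N.xi_field] by simp
  have x0: "D p (X u p) (\<lambda>q. xi (i q)) = 0"
    using i.D_comp[OF p X_in[OF p] N.xi_field UNIV_I]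
      N.nabla_xi[OF i.differential_in_tangent_space[OF X_in[OF p]]] by simp
  have "X u p (\<lambda>q. g (i q) (E v q) (xi (i q))) = X u p (\<lambda>q. 0)"
    by (rule M.tangent_local[OF X_in[OF p] open_chart p]) (rule xi_E)
  then have "g (i p) (d u v) (xi (i p)) + g (i p) (E v p) 0 = 0"
    using i.metric_compatible[OF p X_in[OF p] E_field i.field_along_subset[OF fx open_chart subset_UNIV],
        of u v] M.tangent_const[OF X_in[OF p]] by (simp add: d_def x0)
  then show ?thesis using metric_zero(2)[OF N.manifold_axioms N.metric E_in[OF p]] by simp
qed

text \<open>A tangent vector \<open>v\<close> at \<open>p\<close> is extended to the field with constant coordinates \<open>coords v\<close>.\<close>

definition coords :: "('b \<times> 'f) tangent \<Rightarrow> 'eb \<times> 'ef" where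
  "coords v = (\<Sum>k\<in>Basis. v (\<lambda>q. map_prod x y q \<bullet> k) *\<^sub>R k)"

lemma X_coords: "v \<in> tangent_space AM p \<Longrightarrow> X (coords v) p = v"
  unfolding coords_def linear_sum[OF X_linear[OF p]] linear_scale[OF X_linear[OF p]]
  using M.tangent_expand[OF chart p] by simp

lemma coords_X: "coords (X u p) = u"
  unfolding coords_def M.coord_vector_coord[OF chart p] by (simp add: euclidean_representation)

text \<open>Extensions with constant coordinates commute, which makes \<open>dd\<close> symmetric.
  Its tangential part depends on the chart; its normal part is \<open>h\<close>.\<close>

definition dd :: "('b \<times> 'f) tangent \<Rightarrow> ('b \<times> 'f) tangent \<Rightarrow> 'n tangent" where
  "dd v w = D p v (E (coords w))"

lemma dd_X: "dd (X u p) (X v p) = d u v"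
  by (simp add: dd_def d_def coords_X)

lemma tangentE: assumes "v \<in> tangent_space AM p" obtains u where "v = X u p"
  using X_coords[OF assms] by metis

lemma h_eq:
  assumes v: "v \<in> tangent_space AM p" and w: "w \<in> tangent_space AM p"
  shows "h p v w = dd v w - orth_proj (g (i p)) (differential AN i p ` tangent_space AM p) (dd v w)"
proof -
  have "h p (X (coords v) p) (X (coords w) p) =
      normal_part AM AN i g p (D p (X (coords v) p) (E (coords w)))"
    unfolding E_def
    by (rule second_fundamental_formD[OF h M.vector_field_on_coord_vector[OF chart]
          M.vector_field_on_coord_vector[OF chart] p])
  then show ?thesis
    by (simp add: X_coords[OF v] X_coords[OF w] normal_part_def tangent_image_def dd_def)
qed

end

sublocale warped_chart \<subseteq> pt: warped_point "tangent_space AM p" "gM p" "tangent_space AN (i p)" "g (i p)"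
  "differential AN i p" "phi (i p)" "xi (i p)" "D1 p" "D2 p" "theta p" dd lam
proof (intro warped_point.intro semi_slant_point.intro inner_space_M inner_space_N)
  note s = proper_pointwise_semi_slantD(3)[OF semi_slant]
    proper_pointwise_semi_slantD(4-9)[OF semi_slant, where p = p]
  note J = i.differential_in_tangent_space
  have D1X: "\<exists>a. v = X (a, 0) p" if "v \<in> D1 p" for v
    using that unfolding D1_base base_bundle_eq[OF p] by auto
  have D2X: "\<exists>b. v = X (0, b) p" if "v \<in> D2 p" for v
    using that unfolding D2_fibre fibre_bundle_eq[OF p] by auto
  show "semi_slant_point_axioms (tangent_space AM p) (gM p) (tangent_space AN (i p)) (g (i p))
     (differential AN i p) (phi (i p)) (xi (i p)) (D1 p) (D2 p) (theta p)"
  proof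
    show "\<exists>Y. finite Y \<and> tangent_space AM p \<subseteq> span Y"
      using M.tangent_space_span[of p] by auto
    show "\<exists>X. finite X \<and> tangent_space AN (i p) \<subseteq> span X \<and> card X \<le> dim (D1 p) + 2 * dim (D2 p) + 1"
      using N.tangent_space_span[of "i p"] dim_N dim_D1 dim_D2 by auto
    show "subspace (D1 p)" "D1 p \<subseteq> tangent_space AM p"
      using s(1) unfolding distribution_def by blast+
    show "g (i p) (xi (i p)) (differential AN i p v) = 0" if "v \<in> tangent_space AM p" for v
      using xi_normal[of p] that by (auto simp: normal_bundle_def tangent_image_def)
    show "g (i p) (phi (i p) u) (phi (i p) v) = g (i p) u v - g (i p) u (xi (i p)) * g (i p) v (xi (i p))"
      if "u \<in> tangent_space AN (i p)" "v \<in> tangent_space AN (i p)" for u v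
      using N.phi_isometry[OF that] N.eta_eq_g that by simp
    show "g (i p) (differential AN i p u) (differential AN i p v) = gM p u v" for u v
      by (simp add: induced_metric_def)
  qed (rule linear_add[OF i.differential_linear] linear_scale[OF i.differential_linear] J N.phi_in_tangent_space N.phi_linear N.phi_skew
      N.xi_in_tangent_space N.g_xi_xi s; assumption)+
  show "warped_point_axioms (tangent_space AM p) (gM p) (tangent_space AN (i p)) (g (i p))
     (differential AN i p) (phi (i p)) (xi (i p)) (D1 p) (D2 p) dd lam"
  proof
    show "dd u v \<in> tangent_space AN (i p)" if "u \<in> tangent_space AM p" "v \<in> tangent_space AM p" for u v
      unfolding dd_def by (rule i.D_in_tangent_space[OF p that(1) E_field])
    show "linear_on_space (tangent_space AM p) (\<lambda>u. dd u v)" if "v \<in> tangent_space AM p" for v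
      unfolding dd_def by (rule i.D_linear[OF p that E_field])
    show "dd u v = dd v u" if "u \<in> tangent_space AM p" "v \<in> tangent_space AM p" for u v
      using that d_commute by (auto elim!: tangentE simp: dd_X)
    show "g (i p) (dd u v) (xi (i p)) = 0" if "u \<in> tangent_space AM p" "v \<in> tangent_space AM p" for u v
      using that d_xi by (auto elim!: tangentE simp: dd_X)
    show "linear_on_space (tangent_space AM p) lam"
      by (simp add: linear_on_space_def lam_def)
    show "lam Z = 0" if "Z \<in> D2 p" for Z using D2X[OF that] lam_fibre by auto
    fix Y Z assume Y: "Y \<in> D1 p" and Z: "Z \<in> D2 p"
    obtain a b where ab: "Y = X (a, 0) p" "Z = X (0, b) p" using D1X[OF Y] D2X[OF Z] by blast
    show "g (i p) (dd X' Y) (differential AN i p Z) = 0" if X': "X' \<in> D1 p" for X'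
    proof -
      obtain a' where "X' = X (a', 0) p" using D1X[OF X'] by blast
      then show ?thesis using d_base_base_fibre by (simp add: ab dd_X E_def)
    qed
    show "g (i p) (dd X' Y) (phi (i p) (differential AN i p Z)) = 0" if X': "X' \<in> D1 p" for X'
    proof -
      obtain c where c: "X' = X (c, 0) p" using D1X[OF X'] by blast
      obtain a' where a': "phi (i p) (E (a, 0) p) = E (a', 0) p" using phi_E_base[OF p] by blast
      \<comment> \<open>\<open>d_phi_fibre\<close> trades phi on the fibre vector for phi on the
        base vector; what remains is a mixed derivative paired with the base, which is 0.\<close>
      have "g (i p) (E (a', 0) p) (d (c, 0) (0, b)) = 0"
        using d_base_fibre_base i.g_symmetric[OF E_in[OF p] d_in] by simp
      then show ?thesis using d_phi_fibre[OF a', of "(c, 0)" b] by (simp add: ab c dd_X E_def)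
    qed
    fix W assume W: "W \<in> D2 p"
    obtain b' where b': "W = X (0, b') p" using D2X[OF W] by blast
    show "g (i p) (dd Y Z) (differential AN i p W) = lam Y * gM p Z W"
      using d_base_fibre_fibre by (simp add: ab b' dd_X E_def induced_metric_def)
    show "g (i p) (dd Y Z) (phi (i p) (differential AN i p W)) = - lam Y' * gM p Z W"
      if Y': "Y' \<in> D1 p" "differential AN i p Y' = phi (i p) (differential AN i p Y)" for Y'
    proof -
      obtain a' where a': "Y' = X (a', 0) p" using D1X[OF Y'(1)] by blast
      have e: "phi (i p) (E (a, 0) p) = E (a', 0) p" using Y'(2) by (simp add: ab a' E_def)
      \<comment> \<open>The derivative of the base field in the fibre direction is used, so that
        removing phi leaves a fibre-fibre derivative paired with phi X; its umbilical formula gives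
        the minus sign.\<close>
      have "g (i p) (d (0, b) (a, 0)) (phi (i p) (E (0, b') p)) = g (i p) (d (0, b) (0, b')) (E (a', 0) p)"
        using d_phi_fibre[OF e, of "(0, b)" b'] i.g_symmetric[OF E_in[OF p] d_in] by simp
      then show ?thesis
        using d_fibre_fibre_base[of b b' a'] d_commute[of "(a, 0)" "(0, b)"]
        by (simp add: ab a' b' dd_X E_def induced_metric_def)
    qed
  qed
qed

section \<open>Extension by bump functions\<close>

text \<open>A bump in coordinates is extended by 0. The set \<open>K\<close> is the preimage of a
  closed ball, so it is compact, hence closed in a Hausdorff space; \<open>U\<close> and the
  complement of \<open>K\<close> cover, and the function is smooth on both.\<close>

lemma (in manifold) bump_function:
  assumes U: "(U, x) \<in> A" and p: "p \<in> U"
  obtains b K where "smooth_fun_on A UNIV b" "b p > 0" "closed K" "K \<subseteq> U" "\<And>q. q \<notin> K \<Longrightarrow> b q = 0"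
proof -
  have o: "open (x ` U)" using chart_image_open[OF U open_UNIV] by simp
  then obtain r where r: "r > 0" "cball (x p) r \<subseteq> x ` U"
    using p open_contains_cball by blast
  obtain \<beta> :: "'e \<Rightarrow> real" where \<beta>: "smooth_on UNIV \<beta>" "\<beta> (x p) > 0" "\<And>z. dist (x p) z \<ge> r \<Longrightarrow> \<beta> z = 0"
    using smooth_bump[OF r(1), of "x p"] by blast
  define K where "K = inv_into U x ` cball (x p) r"
  define b where "b = (\<lambda>q. if q \<in> U then \<beta> (x q) else 0)"
  have "compact K"
    unfolding K_def
    by (intro compact_continuous_image continuous_on_subset[OF chart_inv_continuous[OF U] r(2)]) simp
  then have K: "closed K" by (rule compact_imp_closed)
  have KU: "K \<subseteq> U"
    unfolding K_def using r(2) by (meson image_subsetI inv_into_into subset_iff)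
  have b0: "b q = 0" if "q \<notin> K" for q
  proof (cases "q \<in> U")
    case True
    have "x q \<notin> cball (x p) r"
      using that chart_inv[OF U True] unfolding K_def by (metis imageI)
    then show ?thesis using \<beta>(3) True by (simp add: b_def)
  qed (simp add: b_def)
  have "smooth_fun_on A UNIV b"
  proof (rule smooth_fun_on_local)
    fix q :: 'p
    show "\<exists>W. q \<in> W \<and> W \<subseteq> UNIV \<and> smooth_fun_on A W b"
    proof (cases "q \<in> U")
      case True
      have "smooth_fun_on A U b"
        by (rule smooth_fun_on_cong[OF smooth_fun_on_chart_compose[OF U \<beta>(1)]]) (auto simp: b_def)
      then show ?thesis using True by (intro exI[of _ U]) simp
    next
      case False
      have "smooth_fun_on A (- K) b"
        by (rule smooth_fun_on_cong[OF smooth_fun_on_const]) (use K b0 in auto)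
      then show ?thesis using False KU by (intro exI[of _ "- K"]) auto
    qed
  qed
  moreover have "b p > 0" using p \<beta>(2) by (simp add: b_def)
  ultimately show ?thesis using that K KU b0 by blast
qed

context smooth_map_between
begin

text \<open>\<open>U\<close> and the complement of \<open>K\<close> are open and cover; the
  extension is a scaled field on the first and 0 on the second.\<close>

lemma field_along_extend:
  assumes V: "field_along A A' F U V" and b: "smooth_fun_on A UNIV b" and K: "closed K" "K \<subseteq> U"
    and b0: "\<And>q. q \<notin> K \<Longrightarrow> b q = 0"
  shows "field_along A A' F UNIV (\<lambda>q. if q \<in> U then b q *\<^sub>R V q else 0)"
proof (rule field_along_local)
  fix q :: 'p
  show "\<exists>W. q \<in> W \<and> W \<subseteq> UNIV \<and> field_along A A' F W (\<lambda>q. if q \<in> U then b q *\<^sub>R V q else 0)"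
  proof (cases "q \<in> U")
    case True
    have "field_along A A' F U (\<lambda>q. if q \<in> U then b q *\<^sub>R V q else 0)"
      by (rule field_along_cong[OF field_along_scale[OF
              M.smooth_fun_on_subset[OF b field_alongD(1)[OF V]] V]]) auto
    then show ?thesis using True by (intro exI[of _ U]) simp
  next
    case False
    have "field_along A A' F (- K) (\<lambda>q. if q \<in> U then b q *\<^sub>R V q else 0)"
      by (rule field_along_cong[OF field_along_zero]) (use K b0 in auto)
    then show ?thesis using False K(2) by (intro exI[of _ "- K"]) auto
  qed
qed

end

lemma (in manifold) vector_field_extend:
  assumes X: "vector_field_on A U X" and b: "smooth_fun_on A UNIV b" and K: "closed K" "K \<subseteq> U"
    and b0: "\<And>q. q \<notin> K \<Longrightarrow> b q = 0"
  shows "vector_field_on A UNIV (\<lambda>q. if q \<in> U then b q *\<^sub>R X q else 0)"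
  unfolding vector_field_on_def
proof (intro conjI ballI allI impI open_UNIV)
  fix p
  show "(if p \<in> U then b p *\<^sub>R X p else 0) \<in> tangent_space A p"
    using vector_field_onD(2)[OF X, of p] subspace_tangent_space
    by (auto intro: subspace_scale subspace_0)
next
  fix W f assume f: "smooth_fun_on A W f"
  show "smooth_fun_on A W (\<lambda>p. (if p \<in> U then b p *\<^sub>R X p else 0) f)"
  proof (rule smooth_fun_on_local)
    fix q assume q: "q \<in> W"
    show "\<exists>W'. q \<in> W' \<and> W' \<subseteq> W \<and> smooth_fun_on A W' (\<lambda>p. (if p \<in> U then b p *\<^sub>R X p else 0) f)"
    proof (cases "q \<in> U")
      case True
      have o: "open (W \<inter> U)" using smooth_fun_on_open[OF f] vector_field_onD(1)[OF X] by blast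
      have "smooth_fun_on A (W \<inter> U) (\<lambda>p. b p * X p f)"
        by (rule smooth_fun_on_mult[OF smooth_fun_on_subset[OF b o subset_UNIV]
              vector_field_onD(3)[OF X Int_lower2 smooth_fun_on_subset[OF f o Int_lower1]]])
      then have "smooth_fun_on A (W \<inter> U) (\<lambda>p. (if p \<in> U then b p *\<^sub>R X p else 0) f)"
        by (rule smooth_fun_on_cong) auto
      then show ?thesis using True q by (intro exI[of _ "W \<inter> U"]) simp
    next
      case False
      have o: "open (W \<inter> - K)" using smooth_fun_on_open[OF f] K(1) by blast
      have "smooth_fun_on A (W \<inter> - K) (\<lambda>p. (if p \<in> U then b p *\<^sub>R X p else 0) f)"
        by (rule smooth_fun_on_cong[OF smooth_fun_on_const[OF o, of 0]]) (use b0 in auto)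
      then show ?thesis using False q K(2) by (intro exI[of _ "W \<inter> - K"]) auto
    qed
  qed
qed

section \<open>Normal fields\<close>

context warped_chart
begin

text \<open>
  Gram--Schmidt without division: a multiple \<open>c V\<^sub>0\<close> is made orthogonal to the coordinate fields,
  so that smoothness is preserved with no need to invert anything.
\<close>

lemma orthogonalise:
  assumes "finite K" "independent K" "field_along AM AN i (U \<times> V) V0"
  shows "\<exists>V1 c. field_along AM AN i (U \<times> V) V1 \<and> (\<forall>q\<in>U \<times> V. c q \<noteq> 0 \<and>
    (\<forall>u\<in>K. g (i q) (V1 q) (E u q) = 0) \<and> (\<exists>\<tau>\<in>span K. V1 q = c q *\<^sub>R V0 q + E \<tau> q))"
  using assms
proof (induction K arbitrary: V0 rule: finite_induct)
  case empty
  have "V0 q = 1 *\<^sub>R V0 q + E 0 q" if "q \<in> U \<times> V" for q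
    using linear_0[OF E_linear[OF that]] by simp
  then have "\<forall>q\<in>U \<times> V. (1::real) \<noteq> 0 \<and> (\<forall>u\<in>{}. g (i q) (V0 q) (E u q) = 0) \<and>
      (\<exists>\<tau>\<in>span {}. V0 q = 1 *\<^sub>R V0 q + E \<tau> q)" by auto
  then show ?case
    using empty.prems(2) by (intro exI[of _ V0] exI[of _ "\<lambda>_. 1"]) (rule conjI)
next
  case (insert u K)
  have ind: "independent K" and uK: "u \<notin> span K"
    using insert.prems(1) insert.hyps(2) by (auto simp: independent_insert)
  obtain V1 c where V1: "field_along AM AN i (U \<times> V) V1"
    and V1q: "\<And>q. q \<in> U \<times> V \<Longrightarrow> c q \<noteq> 0 \<and> (\<forall>u\<in>K. g (i q) (V1 q) (E u q) = 0) \<and>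
      (\<exists>\<tau>\<in>span K. V1 q = c q *\<^sub>R V0 q + E \<tau> q)"
    using insert.IH[OF ind insert.prems(2)] by metis
  \<comment> \<open>The induction hypothesis is used again, on the coordinate field itself:
    \<open>P\<close> is a multiple of \<open>E u\<close> made orthogonal to the fields of
    \<open>K\<close>.\<close>
  obtain P e where P: "field_along AM AN i (U \<times> V) P"
    and Pq: "\<And>q. q \<in> U \<times> V \<Longrightarrow> e q \<noteq> 0 \<and> (\<forall>u\<in>K. g (i q) (P q) (E u q) = 0) \<and>
      (\<exists>\<tau>\<in>span K. P q = e q *\<^sub>R E u q + E \<tau> q)"
    using insert.IH[OF ind E_field[of u]] by metis
  \<comment> \<open>The usual step subtracts (r / N) P from \<open>V1\<close>; multiplying through
    by \<open>N\<close> = |P|^2 leaves only sums and products.\<close>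
  define N where "N = (\<lambda>q. g (i q) (P q) (P q))"
  define r where "r = (\<lambda>q. g (i q) (V1 q) (P q))"
  define V2 where "V2 = (\<lambda>q. N q *\<^sub>R V1 q + (- r q) *\<^sub>R P q)"
  have "field_along AM AN i (U \<times> V) V2"
    unfolding V2_def N_def r_def
    by (intro i.field_along_add i.field_along_scale V1 P M.smooth_fun_on_minus
        i.smooth_fun_on_metric[OF N.metric])
  moreover have "N q * c q \<noteq> 0 \<and> (\<forall>w\<in>insert u K. g (i q) (V2 q) (E w q) = 0) \<and>
      (\<exists>\<tau>\<in>span (insert u K). V2 q = (N q * c q) *\<^sub>R V0 q + E \<tau> q)" if q: "q \<in> U \<times> V" for q
  proof -
    interpret G: inner_space "tangent_space AN (i q)" "g (i q)" by (rule inner_space_N)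
    note El = E_linear[OF q] and Ei = E_in[OF q]
    have V1i: "V1 q \<in> tangent_space AN (i q)" and Pi: "P q \<in> tangent_space AN (i q)"
      using i.field_alongD(2)[OF V1 q] i.field_alongD(2)[OF P q] by auto
    obtain \<tau> where \<tau>: "\<tau> \<in> span K" "V1 q = c q *\<^sub>R V0 q + E \<tau> q" using V1q[OF q] by blast
    obtain \<sigma> where \<sigma>: "\<sigma> \<in> span K" "P q = e q *\<^sub>R E u q + E \<sigma> q" using Pq[OF q] by blast
    have PE: "P q = E (e q *\<^sub>R u + \<sigma>) q" using \<sigma>(2) by (simp add: linear_add[OF El] linear_scale[OF El])
    \<comment> \<open>\<open>P\<close> is nowhere 0, since \<open>u\<close> is independent of
      \<open>K\<close> and e is nonzero; this keeps the new factor N c nonzero.\<close>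
    have "e q *\<^sub>R u + \<sigma> \<noteq> 0"
    proof
      assume "e q *\<^sub>R u + \<sigma> = 0"
      then have "e q *\<^sub>R u = - \<sigma>" by (simp add: add_eq_0_iff2)
      then have "e q *\<^sub>R u \<in> span K" using \<sigma>(1) span_neg by metis
      then have "(1 / e q) *\<^sub>R e q *\<^sub>R u \<in> span K" by (rule span_scale)
      then show False using uK Pq[OF q] by simp
    qed
    then have "X (e q *\<^sub>R u + \<sigma>) q \<noteq> 0" using M.coord_vector_eq_0_iff[OF chart q] by simp
    then have "gM q (X (e q *\<^sub>R u + \<sigma>) q) (X (e q *\<^sub>R u + \<sigma>) q) > 0"
      by (rule inner_space.pos[OF inner_space_M X_in[OF q]])
    then have Npos: "N q > 0" by (simp add: N_def PE induced_metric_def E_def)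
    have rPi: "(- r q) *\<^sub>R P q \<in> tangent_space AN (i q)" "N q *\<^sub>R V1 q \<in> tangent_space AN (i q)"
      by (rule subspace_scale[OF G.subspace Pi], rule subspace_scale[OF G.subspace V1i])
    have V2i: "V2 q \<in> tangent_space AN (i q)" unfolding V2_def by (rule subspace_add[OF G.subspace rPi(2,1)])
    have expand: "g (i q) (V2 q) v = N q * g (i q) (V1 q) v - r q * g (i q) (P q) v"
      if v: "v \<in> tangent_space AN (i q)" for v
      unfolding V2_def
      using G.add_left[OF v rPi(2,1)] G.scale_left[OF V1i v] G.scale_left[OF Pi v, of "- r q"] by simp
    have K0: "g (i q) (V2 q) (E w q) = 0" if "w \<in> K" for w
      using expand[OF Ei] V1q[OF q] Pq[OF q] that by simp
    have "span K \<subseteq> {w. g (i q) (V2 q) (E w q) = 0}"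
    proof (rule span_minimal)
      show "subspace {w. g (i q) (V2 q) (E w q) = 0}"
        by (rule subspaceI)
          (auto simp: linear_0[OF El] linear_add[OF El] linear_scale[OF El] G.zero_right[OF V2i]
            G.add_right[OF V2i Ei Ei] G.scale_right[OF V2i Ei])
    qed (use K0 in blast)
    then have \<sigma>0: "g (i q) (V2 q) (E \<sigma> q) = 0" using \<sigma>(1) by blast
    \<comment> \<open>Orthogonality to \<open>P\<close> and to \<open>E \<sigma>\<close> leaves
      orthogonality to e E u, and e is nonzero.\<close>
    have "g (i q) (V2 q) (P q) = 0" using expand[OF Pi] by (simp add: N_def r_def)
    then have "g (i q) (V2 q) (e q *\<^sub>R E u q) + g (i q) (V2 q) (E \<sigma> q) = 0"
      using \<sigma>(2) G.add_right[OF V2i subspace_scale[OF G.subspace Ei] Ei] by metis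
    then have u0: "g (i q) (V2 q) (E u q) = 0"
      using \<sigma>0 G.scale_right[OF V2i Ei] Pq[OF q] by simp
    have "V2 q = (N q * c q) *\<^sub>R V0 q + E (N q *\<^sub>R \<tau> + (- r q) *\<^sub>R (e q *\<^sub>R u + \<sigma>)) q"
      unfolding V2_def \<tau>(2) PE
      by (simp add: linear_add[OF El] linear_scale[OF El] linear_neg[OF El] linear_diff[OF El]
          scaleR_add_right)
    moreover have "N q *\<^sub>R \<tau> + (- r q) *\<^sub>R (e q *\<^sub>R u + \<sigma>) \<in> span (insert u K)"
      using \<tau>(1) \<sigma>(1) span_mono[of K "insert u K"]
      by (intro span_add span_scale) (auto intro: span_base)
    ultimately show ?thesis using Npos V1q[OF q] u0 K0 by auto
  qed
  ultimately show ?case by (intro exI[of _ V2] exI[of _ "\<lambda>q. N q * c q"]) blast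
qed

lemma sff_eq_h: "v \<in> tangent_space AM p \<Longrightarrow> w \<in> tangent_space AM p \<Longrightarrow> pt.sff v w = h p v w"
  by (simp add: pt.sff_def h_eq)

text \<open>The hypothesis speaks of global sections only. Coordinate fibre fields times a bump
  realise \<open>v\<close> and \<open>w\<close> up to a positive factor, and for each Y in D2 a
  global normal field is built that detects the component of \<open>h p v w\<close> along F Y. These
  components determine \<open>h p v w\<close>.\<close>

lemma h_fibre_eq_0:
  assumes orth: "\<And>Z W V. vector_field_on AM UNIV Z \<Longrightarrow> (\<And>q. Z q \<in> fibre_bundle AB AF q) \<Longrightarrow>
      vector_field_on AM UNIV W \<Longrightarrow> (\<And>q. W q \<in> fibre_bundle AB AF q) \<Longrightarrow>
      field_along AM AN i UNIV V \<Longrightarrow> (\<And>q. V q \<in> normal_bundle AM AN i g q) \<Longrightarrow>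
      g (i p) (h p (Z p) (W p)) (V p) = 0"
    and v: "v \<in> D2 p" and w: "w \<in> D2 p"
  shows "h p v w = 0"
proof -
  obtain b K where b: "smooth_fun_on AM UNIV b" "b p > 0" "closed K" "K \<subseteq> U \<times> V"
    "\<And>q. q \<notin> K \<Longrightarrow> b q = 0"
    using M.bump_function[OF chart p] by metis
  define Z where "Z = (\<lambda>e q. if q \<in> U \<times> V then b q *\<^sub>R X (0, e) q else 0)"
  have Z: "vector_field_on AM UNIV (Z e)" for e
    unfolding Z_def by (rule M.vector_field_extend[OF M.vector_field_on_coord_vector[OF chart] b(1,3,4,5)])
  have Zf: "Z e q \<in> fibre_bundle AB AF q" for e q
  proof -
    have "subspace (fibre_bundle AB AF q)"
      unfolding fibre_bundle_def
      by (rule subspaceI)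
        (auto simp: linear_0[OF fst.differential_linear] linear_add[OF fst.differential_linear]
          linear_scale[OF fst.differential_linear] subspace_0[OF M.subspace_tangent_space]
          intro: subspace_add[OF M.subspace_tangent_space] subspace_scale[OF M.subspace_tangent_space])
    then show ?thesis
      using fibre_bundle_eq[of q] by (auto simp: Z_def intro: subspace_scale subspace_0)
  qed
  have Zp: "Z e p = b p *\<^sub>R X (0, e) p" for e using p by (simp add: Z_def)
  have D2X: "\<exists>e. v = X (0, e) p" if "v \<in> D2 p" for v
    using that unfolding D2_fibre fibre_bundle_eq[OF p] by auto
  obtain e1 e2 where e: "v = X (0, e1) p" "w = X (0, e2) p" using D2X v w by metis
  note vT = pt.D2_in[OF v] and wT = pt.D2_in[OF w]
  let ?s = "pt.sff v w"
  have sT: "?s \<in> tangent_space AN (i p)" by (rule pt.sff_in[OF vT wT])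
  have hZ: "h p (Z e1 p) (Z e2 p) = (b p * b p) *\<^sub>R ?s"
  proof -
    have bT: "b p *\<^sub>R w \<in> tangent_space AM p" "b p *\<^sub>R v \<in> tangent_space AM p"
      using subspace_scale[OF M.subspace_tangent_space] vT wT by auto
    have "pt.sff (b p *\<^sub>R v) (b p *\<^sub>R w) = b p *\<^sub>R pt.sff v (b p *\<^sub>R w)"
      by (rule linear_on_spaceD(2)[OF pt.sff_linear_left[OF bT(1)] vT vT M.subspace_tangent_space])
    also have "pt.sff v (b p *\<^sub>R w) = b p *\<^sub>R ?s"
      by (rule linear_on_spaceD(2)[OF pt.sff_linear_right[OF vT] wT wT M.subspace_tangent_space])
    finally have "pt.sff (b p *\<^sub>R v) (b p *\<^sub>R w) = b p *\<^sub>R b p *\<^sub>R ?s" .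
    then show ?thesis
      unfolding Zp e[symmetric] sff_eq_h[OF bT(2,1), symmetric] by (simp only: scaleR_scaleR)
  qed
  have "g (i p) ?s (pt.F Y) = 0" if Y: "Y \<in> D2 p" for Y
  proof -
    obtain e3 where e3: "Y = X (0, e3) p" using D2X[OF Y] by blast
    \<comment> \<open>Orthogonalising against the whole coordinate frame makes \<open>V1\<close>
      normal at every point of the chart, and it differs from a nonzero multiple of phi E only by a
      tangent vector.\<close>
    obtain V1 c where V1: "field_along AM AN i (U \<times> V) V1"
      and V1q: "\<And>q. q \<in> U \<times> V \<Longrightarrow> c q \<noteq> 0 \<and> (\<forall>u\<in>Basis. g (i q) (V1 q) (E u q) = 0) \<and>
        (\<exists>\<tau>\<in>span Basis. V1 q = c q *\<^sub>R phi (i q) (E (0, e3) q) + E \<tau> q)"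
      using orthogonalise[OF finite_Basis independent_Basis E_phi_field[of "(0, e3)"]] by metis
    define V2 where "V2 = (\<lambda>q. if q \<in> U \<times> V then b q *\<^sub>R V1 q else 0)"
    have V2: "field_along AM AN i UNIV V2"
      unfolding V2_def by (rule i.field_along_extend[OF V1 b(1,3,4,5)])
    have V2n: "V2 q \<in> normal_bundle AM AN i g q" for q
    proof -
      interpret G: inner_space "tangent_space AN (i q)" "g (i q)" by (rule inner_space_N)
      note V2i = i.field_alongD(2)[OF V2 UNIV_I, of q]
      have "g (i q) (V2 q) (differential AN i q t) = 0" if t: "t \<in> tangent_space AM q" for t
      proof (cases "q \<in> U \<times> V")
        case True
        note V1i = i.field_alongD(2)[OF V1 True] and El = E_linear[OF True] and Ei = E_in[OF True]
        obtain u where u: "t = X u q" using t M.tangentE[OF t chart True] by metis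
        have "E u q = (\<Sum>k\<in>Basis. (u \<bullet> k) *\<^sub>R E k q)"
          using linear_sum[OF El, of "\<lambda>k. (u \<bullet> k) *\<^sub>R k" Basis]
          by (simp add: euclidean_representation linear_scale[OF El])
        then have "g (i q) (V1 q) (E u q) = (\<Sum>k\<in>Basis. (u \<bullet> k) * g (i q) (V1 q) (E k q))"
          using G.sum_right[OF V1i, of Basis "\<lambda>k. E k q" "\<lambda>k. u \<bullet> k"] Ei by simp
        also have "\<dots> = 0" by (rule sum.neutral) (use V1q[OF True] in auto)
        finally have "g (i q) (b q *\<^sub>R V1 q) (E u q) = 0" using G.scale_left[OF V1i Ei] by simp
        then show ?thesis using True by (simp add: V2_def u E_def)
      next
        case False
        then have "V2 q = 0" by (simp add: V2_def)
        then show ?thesis using G.zero_left[OF i.differential_in_tangent_space[OF t]] by simp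
      qed
      then show ?thesis using V2i by (auto simp: normal_bundle_def tangent_image_def)
    qed
    note V1i = i.field_alongD(2)[OF V1 p]
    have V2p: "V2 p = b p *\<^sub>R V1 p" using p by (simp add: V2_def)
    have "g (i p) ((b p * b p) *\<^sub>R ?s) (b p *\<^sub>R V1 p) = 0"
      using orth[OF Z Zf Z Zf V2 V2n, of e1 e2] hZ V2p by simp
    then have s1: "g (i p) ?s (V1 p) = 0"
      using pt.N.scale_left[OF sT subspace_scale[OF pt.N.subspace V1i]] pt.N.scale_right[OF sT V1i] b(2) by simp
    obtain \<tau> where \<tau>: "V1 p = c p *\<^sub>R phi (i p) (E (0, e3) p) + E \<tau> p" using V1q[OF p] by blast
    have pE: "phi (i p) (E (0, e3) p) = differential AN i p (pt.T Y) + pt.F Y"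
      using pt.phi_J_eq[of Y] by (simp add: E_def e3)
    note YT = pt.D2_in[OF pt.T_in[OF Y]]
    note pEi = N.phi_in_tangent_space[OF E_in[OF p], of "(0, e3)"]
    \<comment> \<open>The correction \<open>E \<tau>\<close> and the tangent part T Y are invisible
      to the normal vector \<open>?s\<close>, so only its component along F Y remains.\<close>
    have "g (i p) ?s (E \<tau> p) = 0" using pt.sff_normal[OF vT wT X_in[OF p]] by (simp add: E_def)
    then have "c p * g (i p) ?s (phi (i p) (E (0, e3) p)) = 0"
      using s1 pt.N.add_right[OF sT subspace_scale[OF pt.N.subspace pEi] E_in[OF p], of "c p" \<tau>]
        pt.N.scale_right[OF sT pEi] by (simp add: \<tau>)
    then have "g (i p) ?s (phi (i p) (E (0, e3) p)) = 0" using V1q[OF p] by simp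
    then show ?thesis
      using pt.N.add_right[OF sT i.differential_in_tangent_space[OF YT] pt.F_in[OF Y]]
        pt.sff_normal[OF vT wT YT] by (simp add: pE)
  qed
  note F0 = this
  obtain B where B: "pt.M.onb (D2 p) B" by (rule pt.onb_D2)
  have "y \<in> D2 p" if "y \<in> B" for y using that B span_base by (auto simp: pt.M.onb_def)
  \<comment> \<open>The xi-component is always 0, so the components along F D2 carry the whole
    length.\<close>
  then have "g (i p) ?s ?s = 0"
    using pt.normal_norm_sq[OF B pt.sff_normal_space[OF vT wT] pt.sff_xi[OF vT wT]] F0 by simp
  then show ?thesis using pt.N.eq_0_iff[OF sT] sff_eq_h[OF vT wT] by simp
qed

text \<open>The remainder \<open>R\<close> is the squared length of the restriction of h to D2, so
  the inequality and its equality case are both read off from one identity.\<close>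

lemma sff_norm_sq_eq:
  defines "gr \<equiv> gradient AM gM (\<lambda>q. ln (f (fst q))) p"
  obtains R where
    "Defs.sff_norm_sq AM AN i g h p =
      4 * real m2 * ((1 / sin (theta p))\<^sup>2 + (cot (theta p))\<^sup>2) * gM p gr gr + R"
    "R \<ge> 0" "R = 0 \<longleftrightarrow> (\<forall>v\<in>D2 p. \<forall>w\<in>D2 p. h p v w = 0)"
proof -
  let ?T = "tangent_space AM p"
  have G: "gr \<in> ?T \<and> (\<forall>u\<in>?T. gM p gr u = lam u)"
    unfolding gr_def gradient_def lam_def[symmetric] by (rule theI'[OF pt.grad_exists])
  obtain B1 B2 where B1: "pt.M.onb (D1 p) B1" and B2: "pt.M.onb (D2 p) B2"
    using pt.onb_D1 pt.onb_D2 by metis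
  obtain es0 where "orthonormal_basis (gM p) ?T es0"
    using pt.M.onb_imp_orthonormal_basis[OF pt.onb_TM(1)[OF B1 B2]] by blast
  \<comment> \<open>The basis chosen in the definition is a genuine one because some orthonormal
    basis exists; the norm formula holds for any of them.\<close>
  let ?es = "SOME es. orthonormal_basis (gM p) ?T es"
  from \<open>orthonormal_basis (gM p) ?T es0\<close> have es: "orthonormal_basis (gM p) ?T ?es"
    by (rule someI)
  note B = pt.M.orthonormal_basis_imp_onb[OF es subset_refl]
  let ?R = "\<Sum>a\<in>B2. \<Sum>b\<in>B2. g (i p) (pt.sff a b) (pt.sff a b)"
  have bT: "e \<in> ?T" if "e \<in> set ?es" for e
    using es that unfolding orthonormal_basis_def by blast
  have "Defs.sff_norm_sq AM AN i g h p =
      (\<Sum>a\<in>set ?es. \<Sum>b\<in>set ?es. g (i p) (h p a b) (h p a b))"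
  proof -
    let ?Q = "\<lambda>a b. g (i p) (h p a b) (h p a b)"
    have "(\<Sum>k<length ?es. \<Sum>l<length ?es. ?Q (?es ! k) (?es ! l)) =
        (\<Sum>a\<in>set ?es. \<Sum>l<length ?es. ?Q a (?es ! l))" by (rule B(2))
    also have "\<dots> = (\<Sum>a\<in>set ?es. \<Sum>b\<in>set ?es. ?Q a b)" by (intro sum.cong refl B(2))
    finally show ?thesis unfolding Defs.sff_norm_sq_def Let_def .
  qed
  also have "\<dots> = (\<Sum>a\<in>set ?es. \<Sum>b\<in>set ?es. g (i p) (pt.sff a b) (pt.sff a b))"
    by (intro sum.cong refl) (simp add: sff_eq_h bT)
  also have "\<dots> = 2 * real (card B2) * ((1 / sin (theta p))\<^sup>2 + (cot (theta p))\<^sup>2) * gM p gr gr + ?R"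
    by (rule pt.sff_norm_sq[OF B(1) B2]) (use G in auto)
  \<comment> \<open>D2 has 2 m2 basis vectors, so 2 \<open>card B2\<close> is 4 m2.\<close>
  finally have eq: "Defs.sff_norm_sq AM AN i g h p =
      4 * real m2 * ((1 / sin (theta p))\<^sup>2 + (cot (theta p))\<^sup>2) * gM p gr gr + ?R"
    using pt.M.onb_card[OF B2] dim_D2[of p] by simp
  have b2: "y \<in> D2 p" if "y \<in> B2" for y using that B2 span_base by (auto simp: pt.M.onb_def)
  have "?R \<ge> 0"
    by (intro sum_nonneg pt.N.nonneg pt.sff_in pt.D2_in b2)
  moreover have "?R = 0 \<longleftrightarrow> (\<forall>v\<in>D2 p. \<forall>w\<in>D2 p. h p v w = 0)"
    unfolding pt.sff22_eq_0_iff[OF B2] by (intro ball_cong refl) (simp add: sff_eq_h pt.D2_in)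
  ultimately show ?thesis using that eq by blast
qed

end

theorem theorem10p5:
  fixes AN :: "('n::{t2_space, second_countable_topology}, 'en::euclidean_space) chart set"
    and phi :: "'n \<Rightarrow> 'n tangent \<Rightarrow> 'n tangent"
    and xi :: "'n vfield"
    and eta :: "'n \<Rightarrow> 'n tangent \<Rightarrow> real"
    and g :: "'n metric"
    and nabla :: "'n conn"
    and AB :: "('b::{t2_space, second_countable_topology}, 'eb::euclidean_space) chart set"
    and gB :: "'b metric"
    and AF :: "('f::{t2_space, second_countable_topology}, 'ef::euclidean_space) chart set"
    and gF :: "'f metric"
    and f :: "'b \<Rightarrow> real"
    and AM :: "('b \<times> 'f, 'eb \<times> 'ef) chart set"
    and i :: "'b \<times> 'f \<Rightarrow> 'n"
    and gM :: "('b \<times> 'f) metric"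
    and D1 D2 :: "'b \<times> 'f \<Rightarrow> ('b \<times> 'f) tangent set"
    and theta :: "'b \<times> 'f \<Rightarrow> real"
    and D :: "'b \<times> 'f \<Rightarrow> ('b \<times> 'f) tangent \<Rightarrow> ('b \<times> 'f \<Rightarrow> 'n tangent) \<Rightarrow> 'n tangent"
    and h :: "'b \<times> 'f \<Rightarrow> ('b \<times> 'f) tangent \<Rightarrow> ('b \<times> 'f) tangent \<Rightarrow> 'n tangent"
    and n m m1 m2 :: nat
  assumes N: "smooth_atlas AN" "DIM('en) = 2 * n + 1" "cosymplectic AN phi xi eta g nabla"
    and B: "smooth_atlas AB" "riemannian_metric AB gB"
    and F: "smooth_atlas AF" "riemannian_metric AF gF"
    and f: "smooth_fun_on AB UNIV f" "\<And>b. f b > 0"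
    and nontrivial: "\<not> (\<exists>c. \<forall>b. f b = c)"
    and M: "AM = prod_atlas AB AF" "DIM('eb \<times> 'ef) = m" "gM = induced_metric AN i g"
    and warped: "\<And>p u v. u \<in> tangent_space AM p \<Longrightarrow> v \<in> tangent_space AM p \<Longrightarrow>
                   gM p u v = warped_metric AB AF gB gF f p u v"
    and semi_slant: "proper_pointwise_semi_slant AM AN i phi g D1 D2 theta"
    and D1: "\<And>p. D1 p = base_bundle AB AF p" "\<And>p. dim (D1 p) = 2 * m1"
    and D2: "\<And>p. D2 p = fibre_bundle AB AF p" "\<And>p. dim (D2 p) = 2 * m2"
    and xi_normal: "\<And>p. xi (i p) \<in> normal_bundle AM AN i g p"
    and xi_mu: "\<And>p. xi (i p) \<in> mu_space AM AN i phi g D2 p"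
    and D: "pullback_connection AM AN i nabla D"
    and h: "second_fundamental_form AM AN i g D h"
    and n: "n = m1 + 2 * m2"
  shows "(\<forall>p. sff_norm_sq AM AN i g h p \<ge>
              4 * real m2 * ((1 / sin (theta p))\<^sup>2 + (cot (theta p))\<^sup>2) *
              (let G = gradient AM gM (\<lambda>q. ln (f (fst q))) p in gM p G G)) \<and>
         ((\<forall>p. sff_norm_sq AM AN i g h p =
              4 * real m2 * ((1 / sin (theta p))\<^sup>2 + (cot (theta p))\<^sup>2) *
              (let G = gradient AM gM (\<lambda>q. ln (f (fst q))) p in gM p G G)) \<longleftrightarrow>
          (\<forall>Z W V. vector_field_on AM UNIV Z \<longrightarrow> (\<forall>p. Z p \<in> fibre_bundle AB AF p) \<longrightarrow>
                   vector_field_on AM UNIV W \<longrightarrow> (\<forall>p. W p \<in> fibre_bundle AB AF p) \<longrightarrow>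
                   field_along AM AN i UNIV V \<longrightarrow> (\<forall>p. V p \<in> normal_bundle AM AN i g p) \<longrightarrow>
                   (\<forall>p. g (i p) (h p (Z p) (W p)) (V p) = 0)))"
proof -
  interpret P: product_manifold AB AF
    by unfold_locales (rule B(1) F(1))+
  interpret C: cosymplectic_manifold AN phi xi eta g nabla
    by unfold_locales (rule N)+
  interpret W: warped_semi_slant AN phi xi eta g nabla AB AF gB gF f i D1 D2 theta D h m1 m2
    by unfold_locales
      (use N(2) n B(2) F(2) f warped semi_slant D1 D2 xi_normal D h in \<open>simp_all add: M\<close>)
  \<comment> \<open>Every point lies in a product chart, so the results of
    \<open>warped_chart\<close>, proved for its fixed point, hold at all points.\<close>
  have chart: thesis
    if "\<And>U x V y. warped_chart AN phi xi eta g nabla AB AF gB gF f i D1 D2 theta D h m1 m2 U x V y p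
      \<Longrightarrow> thesis" for p thesis
  proof -
    obtain U x where U: "(U, x) \<in> AB" "fst p \<in> U" by (rule P.B.chartE)
    obtain V y where V: "(V, y) \<in> AF" "snd p \<in> V" by (rule P.F.chartE)
    have "p \<in> U \<times> V" using U V by (cases p) auto
    then show ?thesis
      by (intro that[of U x V y]) (unfold_locales, use U V in auto)
  qed
  let ?c = "\<lambda>p. 4 * real m2 * ((1 / sin (theta p))\<^sup>2 + (cot (theta p))\<^sup>2) *
    (let G = gradient AM gM (\<lambda>q. ln (f (fst q))) p in gM p G G)"
  have formula: "\<exists>R\<ge>0. sff_norm_sq AM AN i g h p = ?c p + R \<and>
      (R = 0 \<longleftrightarrow> (\<forall>v\<in>D2 p. \<forall>w\<in>D2 p. h p v w = 0))" for p
    by (rule chart[of p], erule warped_chart.sff_norm_sq_eq) (auto simp: M Let_def)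
  have "sff_norm_sq AM AN i g h p \<ge> ?c p" for p
    using formula[of p] by auto
  moreover have "sff_norm_sq AM AN i g h p = ?c p \<longleftrightarrow> (\<forall>v\<in>D2 p. \<forall>w\<in>D2 p. h p v w = 0)" for p
    using formula[of p] by auto
  \<comment> \<open>Equality everywhere is now the vanishing of h on D2 at each point; it remains to
    match this with the test by global sections.\<close>
  moreover have "(\<forall>p. \<forall>v\<in>D2 p. \<forall>w\<in>D2 p. h p v w = 0) \<longleftrightarrow>
      (\<forall>Z W V. vector_field_on AM UNIV Z \<longrightarrow> (\<forall>p. Z p \<in> fibre_bundle AB AF p) \<longrightarrow>
        vector_field_on AM UNIV W \<longrightarrow> (\<forall>p. W p \<in> fibre_bundle AB AF p) \<longrightarrow>
        field_along AM AN i UNIV V \<longrightarrow> (\<forall>p. V p \<in> normal_bundle AM AN i g p) \<longrightarrow>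
        (\<forall>p. g (i p) (h p (Z p) (W p)) (V p) = 0))" (is "?l \<longleftrightarrow> ?r")
  proof
    assume l: ?l
    show ?r
    proof (intro allI impI)
      fix Z W V p
      assume "\<forall>p. Z p \<in> fibre_bundle AB AF p" "\<forall>p. W p \<in> fibre_bundle AB AF p"
        and V: "\<forall>p. V p \<in> normal_bundle AM AN i g p"
      then have "Z p \<in> D2 p" "W p \<in> D2 p" unfolding D2(1) by blast+
      then have h0: "h p (Z p) (W p) = 0" using l by blast
      have "V p \<in> tangent_space AN (i p)" using V[rule_format, of p] by (simp add: normal_bundle_def)
      then show "g (i p) (h p (Z p) (W p)) (V p) = 0"
        unfolding h0 by (rule inner_space.zero_left[OF W.inner_space_N])
    qed
  next
    assume r: ?r
    show ?l
    proof (intro allI ballI)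
      fix p v w assume v: "v \<in> D2 p" and w: "w \<in> D2 p"
      show "h p v w = 0"
      proof (rule chart[of p])
        fix U x V y
        assume "warped_chart AN phi xi eta g nabla AB AF gB gF f i D1 D2 theta D h m1 m2 U x V y p"
        then interpret c: warped_chart AN phi xi eta g nabla AB AF gB gF f i D1 D2 theta D h m1 m2 U x V y p .
        show ?thesis
          by (rule c.h_fibre_eq_0[OF _ v w]) (rule r[unfolded M(1), rule_format]; assumption)
      qed
    qed
  qed
  ultimately show ?thesis by simp
qed

end
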